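(* Let $m,n\ge1$, let $\mathscr A=\mathscr A_q^{[2m]}$ be the quantum hypermatrix algebra of format $n^{2m}$, and let $A=\mathrm{Mat}_q(n)$ with generators $a_{ij}$. The map $\varphi:\mathscr A\to A^{\otimes m}$ given on generators by $$\varphi(a_{i_1,i_2,\ldots,i_{2m}})=a_{i_1,i_2}\otimes a_{i_3,i_4}\otimes\cdots\otimes a_{i_{2m-1},i_{2m}}$$ is an algebra homomorphism, and $$\varphi\big(\mathrm{Det}_q^{[2m]}(\mathscr A)\big)=([n]_{q^2}!)^{m-1}\,{\det}_q(A)^{\otimes m}.$$ Moreover, for any $\sigma\in S_{2m}$, the composite $\varphi\sigma$ is an algebra homomorphism $\mathscr A\to A^{\otimes m}$.
   Context: $q$ is a nonzero complex number, generic in the sense that $[n]_{q^2}!\ne0$; $F$ is the ground field, an extension field of $\mathbb C$; $[1,n]=\{1,\ldots,n\}$; $[r]_p=1+p+\cdots+p^{r-1}$ and $[r]_p!=[1]_p\cdots[r]_p$; $\ell(\sigma)$ is the number of inversions of a permutation. Quantum hypermatrix algebra: for $M\ge1$, $\mathscr A_q^{[M]}$ is the unital associative $F$-algebra generated by $a_{i_1\ldots i_M}$ ($1\le i_s\le n$). For $1\le k\le M$ and $\alpha=(j_1,\ldots,j_{k-1},j_{k+1},\ldots,j_M)$ write $a^{(k)}_{i\alpha}=a_{j_1\ldots j_{k-1}ij_{k+1}\ldots j_M}$. The defining relations are, for every $k$ and every $J=I_1\times\cdots\times I_{M-1}\subset[1,n]^{M-1}$ with all $|I_s|=2$, $$\sum_{\alpha\sqcup\beta=J}(-q)^{\mathrm{inv}(\alpha,\beta)}a^{(k)}_{i\alpha}a^{(k)}_{i\beta}=0,\qquad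 \sum_{\alpha\sqcup\beta=J}(-q)^{\mathrm{inv}(\alpha,\beta)}a^{(k)}_{j\alpha}a^{(k)}_{i\beta}=-q\sum_{\alpha\sqcup\beta=J}(-q)^{\mathrm{inv}(\alpha,\beta)}a^{(k)}_{i\alpha}a^{(k)}_{j\beta}\quad(i<j),$$ where the sums run over pairs $(\alpha,\beta)$ with $\{\alpha_s,\beta_s\}=I_s$ for all $s$, and $\mathrm{inv}(\alpha,\beta)=|\{s:\alpha_s>\beta_s\}|$. The symmetric group $S_M$ acts on $\mathscr A_q^{[M]}$ by algebra automorphisms $\sigma a_{i_1,\ldots,i_M}=a_{i_{\sigma^{-1}(1)},\ldots,i_{\sigma^{-1}(M)}}$. Quantum hyperdeterminant: $$\mathrm{Det}_q^{[M]}(\mathscr A)=\frac1{[n]_{q^2}!}\sum_{\sigma_1,\ldots,\sigma_M\in S_n}(-q)^{\sum_{s}\ell(\sigma_s)}\prod_{i=1}^{n}a_{\sigma_1(i),\ldots,\sigma_M(i)}$$ (products in the order $i=1,\ldots,n$). $\mathrm{Mat}_q(n)$ is the unital algebra generated by $a_{ij}$, $1\le i,j\le n$, with relations, for $i<j$, $k<l$: $a_{ik}a_{il}=qa_{il}a_{ik}$, $a_{ik}a_{jk}=qa_{jk}a_{ik}$, $a_{jk}a_{il}=a_{il}a_{jk}$, $a_{ik}a_{jl}-a_{jl}a_{ik}=(q-q^{-1})a_{il}a_{jk}$. Its quantum determinant is ${\det}_q(A)=\sum_{\sigma\in S_n}(-q)^{\ell(\sigma)}a_{1\sigma(1)}\cdots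 a_{n\sigma(n)}$. *)

theory Defs
  imports
    Complex_Main
    "HOL-Algebra.QuotRing"
    "HOL-Algebra.Module"
    "HOL-Algebra.Product_Groups"
    "HOL-Library.Poly_Mapping"
    "HOL-Combinatorics.Permutations"
begin

section \<open>Algebras over a field\<close>

text \<open>
  The locale \<^locale>\<open>algebra\<close> of HOL-Algebra is restricted to commutative algebras.  Here an algebra
  over the field type \<open>'f\<close> is a (not necessarily commutative) ring whose record also carries the
  scalar multiplication, and only the record type \<^typ>\<open>('f, 'a) module\<close> is reused.
\<close>

definition alg_hom ::
    "('f::field, 'a, 'r) module_scheme \<Rightarrow> ('f, 'b, 's) module_scheme \<Rightarrow> ('a \<Rightarrow> 'b) set" where
  "alg_hom A B =
     {h \<in> ring_hom A B. \<forall>c. \<forall>x\<in>carrier A. h (c \<odot>\<^bsub>A\<^esub> x) = c \<odot>\<^bsub>B\<^esub> h x}"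

definition alg_quot ::
    "('f::field, 'a, 'r) module_scheme \<Rightarrow> 'a set \<Rightarrow> ('f, 'a set) module" (infixl \<open>AQuot\<close> 65) where
  "A AQuot I =
     \<lparr>carrier = carrier (A Quot I), monoid.mult = monoid.mult (A Quot I), one = one (A Quot I),
      zero = zero (A Quot I), add = add (A Quot I),
      smult = (\<lambda>c X. \<Union>x\<in>X. I +>\<^bsub>A\<^esub> (c \<odot>\<^bsub>A\<^esub> x))\<rparr>"

text \<open>
  The monoid algebra of \<open>G\<close>: finitely supported functions on \<^term>\<open>carrier G\<close> under convolution, so
  that \<^term>\<open>Poly_Mapping.single g (1::'f::field)\<close> is the basis vector belonging to \<open>g\<close>.
\<close>

definition monoid_algebra :: "('g, 'r) monoid_scheme \<Rightarrow> ('f::field, 'g \<Rightarrow>\<^sub>0 'f) module" where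
  "monoid_algebra G =
     \<lparr>carrier = {f. Poly_Mapping.keys f \<subseteq> carrier G},
      monoid.mult = (\<lambda>f h. \<Sum>u\<in>Poly_Mapping.keys f. \<Sum>v\<in>Poly_Mapping.keys h.
                Poly_Mapping.single (u \<otimes>\<^bsub>G\<^esub> v)
                  (Poly_Mapping.lookup f u * Poly_Mapping.lookup h v)),
      one = Poly_Mapping.single \<one>\<^bsub>G\<^esub> 1, zero = 0, add = (+),
      smult = (\<lambda>c. Poly_Mapping.map ((*) c))\<rparr>"

definition word_monoid :: "'x set \<Rightarrow> 'x list monoid" where
  "word_monoid X = \<lparr>carrier = lists X, monoid.mult = (@), one = []\<rparr>"

abbreviation free_algebra :: "'x set \<Rightarrow> ('f::field, 'x list \<Rightarrow>\<^sub>0 'f) module" where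
  "free_algebra X \<equiv> monoid_algebra (word_monoid X)"

text \<open>The algebra with generators \<open>X\<close> and relators \<open>R\<close>, and the classes of its generators.\<close>

definition presented_algebra ::
    "'x set \<Rightarrow> ('x list \<Rightarrow>\<^sub>0 'f) set \<Rightarrow> ('f::field, ('x list \<Rightarrow>\<^sub>0 'f) set) module" where
  "presented_algebra X R = free_algebra X AQuot genideal (free_algebra X) R"

definition pgen ::
    "'x set \<Rightarrow> ('x list \<Rightarrow>\<^sub>0 'f::field) set \<Rightarrow> 'x \<Rightarrow> ('x list \<Rightarrow>\<^sub>0 'f) set" where
  "pgen X R x = genideal (free_algebra X) R +>\<^bsub>free_algebra X\<^esub> Poly_Mapping.single [x] 1"

definition list_prod :: "('a, 'r) monoid_scheme \<Rightarrow> 'a list \<Rightarrow> 'a" where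
  "list_prod G xs = foldr (monoid.mult G) xs \<one>\<^bsub>G\<^esub>"


section \<open>Tensor powers of an algebra\<close>

text \<open>
  The \<open>m\<close>-th tensor power is the free vector space on the \<open>m\<close>-tuples over \<open>A\<close>, modulo
  multilinearity, with the componentwise product of pure tensors.  As tuples multiply
  componentwise, the product of a multilinearity relator with a tuple is again such a relator, so
  the two-sided ideal generated by the relators in the monoid algebra of tuples is just their
  linear span.
\<close>

abbreviation tuple_monoid :: "('a, 'r) monoid_scheme \<Rightarrow> nat \<Rightarrow> (nat \<Rightarrow> 'a) monoid" where
  "tuple_monoid A m \<equiv> product_group {1..m} (\<lambda>_. A)"

definition tensor_relators ::
    "('f::field, 'a, 'r) module_scheme \<Rightarrow> nat \<Rightarrow> ((nat \<Rightarrow> 'a) \<Rightarrow>\<^sub>0 'f) set" where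
  "tensor_relators A m =
     {Poly_Mapping.single (x(s := u \<oplus>\<^bsub>A\<^esub> v)) 1
        - Poly_Mapping.single (x(s := u)) 1 - Poly_Mapping.single (x(s := v)) 1 | x s u v.
        x \<in> carrier (tuple_monoid A m) \<and> s \<in> {1..m} \<and> u \<in> carrier A \<and> v \<in> carrier A} \<union>
     {Poly_Mapping.single (x(s := c \<odot>\<^bsub>A\<^esub> u)) 1 - Poly_Mapping.single (x(s := u)) c | x s c u.
        x \<in> carrier (tuple_monoid A m) \<and> s \<in> {1..m} \<and> u \<in> carrier A}"

definition tensor_ideal ::
    "('f::field, 'a, 'r) module_scheme \<Rightarrow> nat \<Rightarrow> ((nat \<Rightarrow> 'a) \<Rightarrow>\<^sub>0 'f) set" where
  "tensor_ideal A m = genideal (monoid_algebra (tuple_monoid A m)) (tensor_relators A m)"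

definition tensor_power ::
    "('f::field, 'a, 'r) module_scheme \<Rightarrow> nat \<Rightarrow> ('f, ((nat \<Rightarrow> 'a) \<Rightarrow>\<^sub>0 'f) set) module" where
  "tensor_power A m = monoid_algebra (tuple_monoid A m) AQuot tensor_ideal A m"

definition pure_tensor ::
    "('f::field, 'a, 'r) module_scheme \<Rightarrow> nat \<Rightarrow> (nat \<Rightarrow> 'a) \<Rightarrow> ((nat \<Rightarrow> 'a) \<Rightarrow>\<^sub>0 'f) set" where
  "pure_tensor A m x =
     tensor_ideal A m +>\<^bsub>monoid_algebra (tuple_monoid A m)\<^esub> Poly_Mapping.single (restrict x {1..m}) 1"


section \<open>Quantum factorials and inversions\<close>

definition qint :: "'a::comm_semiring_1 \<Rightarrow> nat \<Rightarrow> 'a" where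
  "qint p r = (\<Sum>k<r. p ^ k)"

definition qfact :: "'a::comm_semiring_1 \<Rightarrow> nat \<Rightarrow> 'a" where
  "qfact p r = (\<Prod>k=1..r. qint p k)"

definition perm_inv :: "nat \<Rightarrow> (nat \<Rightarrow> nat) \<Rightarrow> nat" where
  "perm_inv n \<sigma> = card {(i, j). 1 \<le> i \<and> i < j \<and> j \<le> n \<and> \<sigma> i > \<sigma> j}"


section \<open>The quantum hypermatrix algebra\<close>

text \<open>
  A multi-index of format \<open>n\<^sup>M\<close> is an extensional function on \<open>{1..M}\<close>.  A partial index
  \<open>(j\<^sub>1, \<dots>, j\<^bsub>k-1\<^esub>, j\<^bsub>k+1\<^esub>, \<dots>, j\<^sub>M)\<close> is an extensional function \<open>\<alpha>\<close> on \<open>{1..M} - {k}\<close>, keeping the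
  original positions instead of renumbering them by \<open>1, \<dots>, M - 1\<close>; then \<open>a\<^sup>(\<^sup>k\<^sup>)\<close> with index
  \<open>i\<alpha>\<close> is the generator with index \<^term>\<open>\<alpha>(k := i)\<close>.
\<close>

definition hyper_indices :: "nat \<Rightarrow> nat \<Rightarrow> (nat \<Rightarrow> nat) set" where
  "hyper_indices M n = ({1..M} \<rightarrow>\<^sub>E {1..n})"

definition splittings :: "nat set \<Rightarrow> (nat \<Rightarrow> nat set) \<Rightarrow> ((nat \<Rightarrow> nat) \<times> (nat \<Rightarrow> nat)) set" where
  "splittings S I =
     {(\<alpha>, \<beta>). \<alpha> \<in> extensional S \<and> \<beta> \<in> extensional S \<and> (\<forall>s\<in>S. {\<alpha> s, \<beta> s} = I s)}"

definition index_inv :: "nat set \<Rightarrow> (nat \<Rightarrow> nat) \<Rightarrow> (nat \<Rightarrow> nat) \<Rightarrow> nat" where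
  "index_inv S \<alpha> \<beta> = card {s\<in>S. \<alpha> s > \<beta> s}"

text \<open>The sum of \<open>(-q)\<^bsup>inv(\<alpha>,\<beta>)\<^esup> a\<^bsub>i\<alpha>\<^esub> a\<^bsub>j\<beta>\<^esub>\<close> (in direction \<open>k\<close>), as an element of the free algebra.\<close>

definition split_sum ::
    "'f::field \<Rightarrow> nat \<Rightarrow> nat \<Rightarrow> (nat \<Rightarrow> nat set) \<Rightarrow> nat \<Rightarrow> nat \<Rightarrow> (nat \<Rightarrow> nat) list \<Rightarrow>\<^sub>0 'f" where
  "split_sum q M k I i j =
     (\<Sum>(\<alpha>, \<beta>)\<in>splittings ({1..M} - {k}) I.
        Poly_Mapping.single [\<alpha>(k := i), \<beta>(k := j)] ((- q) ^ index_inv ({1..M} - {k}) \<alpha> \<beta>))"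

definition hyper_relators :: "'f::field \<Rightarrow> nat \<Rightarrow> nat \<Rightarrow> ((nat \<Rightarrow> nat) list \<Rightarrow>\<^sub>0 'f) set" where
  "hyper_relators q M n =
     {split_sum q M k I i i | k I i.
        k \<in> {1..M} \<and> (\<forall>s\<in>{1..M} - {k}. I s \<subseteq> {1..n} \<and> card (I s) = 2) \<and> i \<in> {1..n}} \<union>
     {split_sum q M k I j i - Poly_Mapping.map ((*) (- q)) (split_sum q M k I i j) | k I i j.
        k \<in> {1..M} \<and> (\<forall>s\<in>{1..M} - {k}. I s \<subseteq> {1..n} \<and> card (I s) = 2) \<and>
        i \<in> {1..n} \<and> j \<in> {1..n} \<and> i < j}"

definition hyper_algebra ::
    "'f::field \<Rightarrow> nat \<Rightarrow> nat \<Rightarrow> ('f, ((nat \<Rightarrow> nat) list \<Rightarrow>\<^sub>0 'f) set) module" where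
  "hyper_algebra q M n = presented_algebra (hyper_indices M n) (hyper_relators q M n)"

definition hyper_gen ::
    "'f::field \<Rightarrow> nat \<Rightarrow> nat \<Rightarrow> (nat \<Rightarrow> nat) \<Rightarrow> ((nat \<Rightarrow> nat) list \<Rightarrow>\<^sub>0 'f) set" where
  "hyper_gen q M n = pgen (hyper_indices M n) (hyper_relators q M n)"

text \<open>
  The permutation \<open>\<sigma>\<close> replaces each letter \<open>a\<^bsub>i\<^esub>\<close> by the generator whose \<open>s\<close>-th index is
  \<open>i (\<sigma>\<^sup>-\<^sup>1 s)\<close>.  This automorphism of the free algebra maps the relators onto themselves, so taking
  images of cosets is the induced action on the quotient.
\<close>

definition free_perm_act ::
    "(nat \<Rightarrow> nat) \<Rightarrow> ((nat \<Rightarrow> nat) list \<Rightarrow>\<^sub>0 'f::field) \<Rightarrow> (nat \<Rightarrow> nat) list \<Rightarrow>\<^sub>0 'f" where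
  "free_perm_act \<sigma> f =
     (\<Sum>w\<in>Poly_Mapping.keys f.
        Poly_Mapping.single (map (\<lambda>i. i \<circ> Hilbert_Choice.inv \<sigma>) w) (Poly_Mapping.lookup f w))"

definition hyper_act ::
    "(nat \<Rightarrow> nat) \<Rightarrow> ((nat \<Rightarrow> nat) list \<Rightarrow>\<^sub>0 'f::field) set \<Rightarrow> ((nat \<Rightarrow> nat) list \<Rightarrow>\<^sub>0 'f) set" where
  "hyper_act \<sigma> X = free_perm_act \<sigma> ` X"

definition hyper_det :: "'f::field \<Rightarrow> nat \<Rightarrow> nat \<Rightarrow> ((nat \<Rightarrow> nat) list \<Rightarrow>\<^sub>0 'f) set" where
  "hyper_det q M n =
     (1 / qfact (q ^ 2) n) \<odot>\<^bsub>hyper_algebra q M n\<^esub>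
       (\<Oplus>\<^bsub>hyper_algebra q M n\<^esub> \<tau> \<in> ({1..M} \<rightarrow>\<^sub>E {\<sigma>. \<sigma> permutes {1..n}}).
          (- q) ^ (\<Sum>s=1..M. perm_inv n (\<tau> s)) \<odot>\<^bsub>hyper_algebra q M n\<^esub>
            list_prod (hyper_algebra q M n)
              (map (\<lambda>i. hyper_gen q M n (\<lambda>s\<in>{1..M}. \<tau> s i)) [1..<Suc n]))"


section \<open>The quantum matrix algebra\<close>

text \<open>
  The two \<open>q\<close>-commutation relations are imposed in every row and in every column; each of the
  conditions \<open>i < j\<close> and \<open>k < l\<close> is required only where both indices occur.
\<close>

definition mat_relators :: "'f::field \<Rightarrow> nat \<Rightarrow> ((nat \<times> nat) list \<Rightarrow>\<^sub>0 'f) set" where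
  "mat_relators q n =
     {Poly_Mapping.single [(i, k), (i, l)] 1 - Poly_Mapping.single [(i, l), (i, k)] q | i k l.
        i \<in> {1..n} \<and> k \<in> {1..n} \<and> l \<in> {1..n} \<and> k < l} \<union>
     {Poly_Mapping.single [(i, k), (j, k)] 1 - Poly_Mapping.single [(j, k), (i, k)] q | i j k.
        i \<in> {1..n} \<and> j \<in> {1..n} \<and> k \<in> {1..n} \<and> i < j} \<union>
     {Poly_Mapping.single [(j, k), (i, l)] 1 - Poly_Mapping.single [(i, l), (j, k)] 1 | i j k l.
        i \<in> {1..n} \<and> j \<in> {1..n} \<and> k \<in> {1..n} \<and> l \<in> {1..n} \<and> i < j \<and> k < l} \<union>
     {Poly_Mapping.single [(i, k), (j, l)] 1 - Poly_Mapping.single [(j, l), (i, k)] 1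
        - Poly_Mapping.single [(i, l), (j, k)] (q - inverse q) | i j k l.
        i \<in> {1..n} \<and> j \<in> {1..n} \<and> k \<in> {1..n} \<and> l \<in> {1..n} \<and> i < j \<and> k < l}"

definition mat_algebra ::
    "'f::field \<Rightarrow> nat \<Rightarrow> ('f, ((nat \<times> nat) list \<Rightarrow>\<^sub>0 'f) set) module" where
  "mat_algebra q n = presented_algebra ({1..n} \<times> {1..n}) (mat_relators q n)"

definition mat_gen :: "'f::field \<Rightarrow> nat \<Rightarrow> nat \<Rightarrow> nat \<Rightarrow> ((nat \<times> nat) list \<Rightarrow>\<^sub>0 'f) set" where
  "mat_gen q n i j = pgen ({1..n} \<times> {1..n}) (mat_relators q n) (i, j)"

definition mat_qdet :: "'f::field \<Rightarrow> nat \<Rightarrow> ((nat \<times> nat) list \<Rightarrow>\<^sub>0 'f) set" where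
  "mat_qdet q n =
     (\<Oplus>\<^bsub>mat_algebra q n\<^esub> \<sigma> \<in> {\<sigma>. \<sigma> permutes {1..n}}.
        (- q) ^ perm_inv n \<sigma> \<odot>\<^bsub>mat_algebra q n\<^esub>
          list_prod (mat_algebra q n) (map (\<lambda>i. mat_gen q n i (\<sigma> i)) [1..<Suc n]))"

end

theory Submission
  imports Defs
begin

text \<open>
  The image of a defining relation of the hypermatrix algebra is a pure tensor.  Indeed, a splitting
  \<open>(\<alpha>, \<beta>)\<close> of the index sets \<open>I\<^sub>s\<close> is an independent choice at every position \<open>s\<close>, the sign
  \<open>(-q)\<^bsup>inv(\<alpha>,\<beta>)\<^esup>\<close> is a product over the positions, and the tensor factor \<open>t\<close> reads exactly the positions
  \<open>2t-1\<close> and \<open>2t\<close>; by multilinearity (\<open>tensor_block_sums\<close>) the sum over all splittings is the tensor of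
  the sums over the splittings of the single factors.  Only the factor that reads the direction \<open>k\<close>
  depends on the prescribed indices \<open>i\<close> and \<open>j\<close>, and there the sum is a two-by-two expression
  \<open>a\<^bsub>ic\<^esub> a\<^bsub>jd\<^esub> - q a\<^bsub>id\<^esub> a\<^bsub>jc\<^esub>\<close> (\<open>k\<close> odd) or \<open>a\<^bsub>ci\<^esub> a\<^bsub>dj\<^esub> - q a\<^bsub>di\<^esub> a\<^bsub>cj\<^esub>\<close> (\<open>k\<close> even) with \<open>c < d\<close>
  (\<open>local_sum_own_factor\<close>).  By the relations of \<open>Mat\<^sub>q(n)\<close> it vanishes for \<open>i = j\<close> and is multiplied by
  \<open>-q\<close> when \<open>i < j\<close> are exchanged.  These are the relations of the hypermatrix algebra, so \<open>\<phi>\<close>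
  exists by the universal property of a presented algebra; it is unique because the generators
  determine it.

  The same factorization applies to the hyperdeterminant: up to \<open>1/[n]!\<close>, its image is the tensor power
  of the sum of \<open>(-q)\<^bsup>\<ell>(\<sigma>)+\<ell>(\<tau>)\<^esup> \<Prod> a\<^bsub>\<sigma>(i),\<tau>(i)\<^esub>\<close> over pairs of permutations.  For fixed \<open>\<sigma>\<close> the
  sum over \<open>\<tau>\<close> is a determinant with permuted rows, which is \<open>(-q)\<^bsup>\<ell>(\<sigma>)\<^esup>\<close> times the quantum determinant:
  the exchange rule for minors gives the case of adjacent rows, and adjacent exchanges sort \<open>\<sigma>\<close>
  (\<open>row_det_permuted\<close>).  As the sum of \<open>q\<^bsup>2\<ell>(\<sigma>)\<^esup>\<close> over all permutations is \<open>[n]!\<close> in the variable \<open>q\<^sup>2\<close>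
  (\<open>sum_perm_inv_eq_qfact\<close>), every factor is \<open>[n]!\<close> times the determinant (\<open>double_sum_det\<close>), which gives
  \<open>[n]!\<close> to the power \<open>m - 1\<close> altogether.

  Finally, a permutation of the positions maps the relators to relators, so it acts on the
  hypermatrix algebra by an endomorphism (\<open>hyper_act_alg_hom\<close>), which is composed with \<open>\<phi>\<close>.
\<close>

section \<open>Associative algebras and their homomorphisms\<close>

locale assoc_algebra = ring A
  for A :: "('f::field, 'a, 'r) module_scheme" (structure) +
  assumes smult_closed [simp, intro]: "x \<in> carrier A \<Longrightarrow> c \<odot> x \<in> carrier A"
    and smult_add_left: "x \<in> carrier A \<Longrightarrow> (c + d) \<odot> x = c \<odot> x \<oplus> d \<odot> x"
    and smult_add_right:
      "x \<in> carrier A \<Longrightarrow> y \<in> carrier A \<Longrightarrow> c \<odot> (x \<oplus> y) = c \<odot> x \<oplus> c \<odot> y"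
    and smult_smult: "x \<in> carrier A \<Longrightarrow> c \<odot> (d \<odot> x) = (c * d) \<odot> x"
    and smult_one [simp]: "x \<in> carrier A \<Longrightarrow> 1 \<odot> x = x"
    and smult_mult_left:
      "x \<in> carrier A \<Longrightarrow> y \<in> carrier A \<Longrightarrow> (c \<odot> x) \<otimes> y = c \<odot> (x \<otimes> y)"
    and smult_mult_right:
      "x \<in> carrier A \<Longrightarrow> y \<in> carrier A \<Longrightarrow> x \<otimes> (c \<odot> y) = c \<odot> (x \<otimes> y)"
begin

lemma smult_zero_left [simp]:
  assumes "x \<in> carrier A"
  shows "0 \<odot> x = \<zero>"
proof -
  have "0 \<odot> x \<oplus> 0 \<odot> x = 0 \<odot> x"
    using smult_add_left[OF assms, of 0 0] by simp
  then show ?thesis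
    using assms by (metis add.r_cancel_one' smult_closed)
qed

lemma smult_zero_right [simp]: "c \<odot> \<zero> = \<zero>"
  using smult_smult[of \<zero> c 0] by simp

lemma smult_minus_left: "x \<in> carrier A \<Longrightarrow> (- c) \<odot> x = \<ominus> (c \<odot> x)"
  using smult_add_left[of x "- c" c] by (simp add: minus_equality)

lemma smult_finsum:
  assumes "finite X" "v \<in> X \<rightarrow> carrier A"
  shows "c \<odot> (\<Oplus>x\<in>X. v x) = (\<Oplus>x\<in>X. c \<odot> v x)"
  using assms
proof (induction X)
  case (insert x X)
  then have "v \<in> X \<rightarrow> carrier A" "v x \<in> carrier A" by auto
  with insert show ?case by (simp add: smult_add_right Pi_def)
qed simp

lemma finsum_smult:
  assumes "finite X" "v \<in> carrier A"
  shows "(\<Oplus>x\<in>X. c x \<odot> v) = (\<Sum>x\<in>X. c x) \<odot> v"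
  using assms by (induction X) (auto simp: smult_add_left)

end

lemma alg_homI:
  assumes "\<And>x. x \<in> carrier A \<Longrightarrow> h x \<in> carrier B"
    and "\<And>x y. x \<in> carrier A \<Longrightarrow> y \<in> carrier A \<Longrightarrow> h (x \<otimes>\<^bsub>A\<^esub> y) = h x \<otimes>\<^bsub>B\<^esub> h y"
    and "\<And>x y. x \<in> carrier A \<Longrightarrow> y \<in> carrier A \<Longrightarrow> h (x \<oplus>\<^bsub>A\<^esub> y) = h x \<oplus>\<^bsub>B\<^esub> h y"
    and "h \<one>\<^bsub>A\<^esub> = \<one>\<^bsub>B\<^esub>"
    and "\<And>c x. x \<in> carrier A \<Longrightarrow> h (c \<odot>\<^bsub>A\<^esub> x) = c \<odot>\<^bsub>B\<^esub> h x"
  shows "h \<in> alg_hom A B"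
  using assms by (auto simp: alg_hom_def intro!: ring_hom_memI)

lemma
  assumes "h \<in> alg_hom A B" "x \<in> carrier A"
  shows alg_hom_closed: "h x \<in> carrier B"
    and alg_hom_smult: "h (c \<odot>\<^bsub>A\<^esub> x) = c \<odot>\<^bsub>B\<^esub> h x"
    and alg_hom_mult: "y \<in> carrier A \<Longrightarrow> h (x \<otimes>\<^bsub>A\<^esub> y) = h x \<otimes>\<^bsub>B\<^esub> h y"
    and alg_hom_add: "y \<in> carrier A \<Longrightarrow> h (x \<oplus>\<^bsub>A\<^esub> y) = h x \<oplus>\<^bsub>B\<^esub> h y"
  using assms by (auto simp: alg_hom_def ring_hom_closed ring_hom_mult ring_hom_add)

lemma alg_hom_one: "h \<in> alg_hom A B \<Longrightarrow> h \<one>\<^bsub>A\<^esub> = \<one>\<^bsub>B\<^esub>"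
  by (simp add: alg_hom_def ring_hom_one)

lemma alg_hom_comp:
  assumes "g \<in> alg_hom A B" "h \<in> alg_hom B C"
  shows "h \<circ> g \<in> alg_hom A C"
  using assms
  by (intro alg_homI)
     (simp_all add: alg_hom_closed alg_hom_mult alg_hom_add alg_hom_one alg_hom_smult)

lemma alg_hom_finsum:
  assumes "assoc_algebra A" "assoc_algebra B" and h: "h \<in> alg_hom A B"
    and "finite X" "v \<in> X \<rightarrow> carrier A"
  shows "h (\<Oplus>\<^bsub>A\<^esub>x\<in>X. v x) = (\<Oplus>\<^bsub>B\<^esub>x\<in>X. h (v x))"
proof -
  interpret A: assoc_algebra A by fact
  interpret B: assoc_algebra B by fact
  have h0: "h \<zero>\<^bsub>A\<^esub> = \<zero>\<^bsub>B\<^esub>"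
    using h A.ring_axioms B.ring_axioms by (simp add: alg_hom_def ring_hom_zero)
  show ?thesis
    using assms(4,5)
  proof (induction X)
    case (insert x X)
    then have v: "v \<in> X \<rightarrow> carrier A" "v x \<in> carrier A" by auto
    then have "(\<lambda>x. h (v x)) \<in> X \<rightarrow> carrier B" "h (v x) \<in> carrier B"
      using alg_hom_closed[OF h] by auto
    with v insert show ?case by (simp add: alg_hom_add[OF h])
  qed (simp add: h0)
qed

lemma list_prod_simps [simp]:
  "list_prod G [] = \<one>\<^bsub>G\<^esub>" "list_prod G (x # xs) = x \<otimes>\<^bsub>G\<^esub> list_prod G xs"
  by (simp_all add: list_prod_def)

lemma (in monoid) list_prod_closed [simp, intro]:
  "set xs \<subseteq> carrier G \<Longrightarrow> list_prod G xs \<in> carrier G"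
  by (induction xs) auto

lemma (in monoid) list_prod_append:
  "set xs \<subseteq> carrier G \<Longrightarrow> set ys \<subseteq> carrier G
    \<Longrightarrow> list_prod G (xs @ ys) = list_prod G xs \<otimes> list_prod G ys"
  by (induction xs) (auto simp: m_assoc)

lemma alg_hom_list_prod:
  assumes "assoc_algebra A" "h \<in> alg_hom A B" "set xs \<subseteq> carrier A"
  shows "h (list_prod A xs) = list_prod B (map h xs)"
proof -
  interpret A: assoc_algebra A by fact
  show ?thesis
    using assms(3) by (induction xs) (auto simp: alg_hom_one[OF assms(2)] alg_hom_mult[OF assms(2)])
qed

section \<open>Quotient algebras\<close>

locale algebra_ideal = assoc_algebra A + ideal I A for A (structure) and I
begin

lemma smult_ideal: "x \<in> I \<Longrightarrow> c \<odot> x \<in> I"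
  using I_l_closed[of x "c \<odot> \<one>"] smult_mult_left[of \<one> x c] by simp

lemma quot_sel [simp]:
  "carrier (A AQuot I) = a_rcosets I"
  "\<one>\<^bsub>A AQuot I\<^esub> = I +> \<one>" "\<zero>\<^bsub>A AQuot I\<^esub> = I"
  by (simp_all add: alg_quot_def FactRing_def)

lemma quot_carrierE:
  assumes "X \<in> carrier (A AQuot I)"
  obtains x where "x \<in> carrier A" "X = I +> x"
  using assms by (auto simp: A_RCOSETS_defs a_r_coset_def r_coset_def)

lemma quot_add: "x \<in> carrier A \<Longrightarrow> y \<in> carrier A \<Longrightarrow> (I +> x) \<oplus>\<^bsub>A AQuot I\<^esub> (I +> y) = I +> (x \<oplus> y)"
  by (simp add: alg_quot_def FactRing_def a_rcos_sum)

lemma quot_mult: "x \<in> carrier A \<Longrightarrow> y \<in> carrier A \<Longrightarrow> (I +> x) \<otimes>\<^bsub>A AQuot I\<^esub> (I +> y) = I +> (x \<otimes> y)"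
  by (simp add: alg_quot_def FactRing_def rcoset_mult_add)

lemma quot_smult:
  assumes x: "x \<in> carrier A"
  shows "c \<odot>\<^bsub>A AQuot I\<^esub> (I +> x) = I +> (c \<odot> x)"
proof -
  have "I +> (c \<odot> y) = I +> (c \<odot> x)" if "y \<in> I +> x" for y
  proof -
    from that obtain i where i: "i \<in> I" "y = i \<oplus> x"
      by (auto simp: a_r_coset_def r_coset_def)
    then have "c \<odot> y = c \<odot> i \<oplus> c \<odot> x"
      using x by (simp add: smult_add_right a_Hcarr)
    then have "c \<odot> y \<in> I +> (c \<odot> x)"
      using smult_ideal[OF i(1)] by (auto simp: a_r_coset_def r_coset_def)
    then show ?thesis
      using x a_repr_independence'[of "c \<odot> y" "c \<odot> x"] by simp
  qed
  then have "(\<Union>y\<in>I +> x. I +> (c \<odot> y)) = (\<Union>y\<in>I +> x. I +> (c \<odot> x))"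
    by (intro SUP_cong) simp_all
  also have "\<dots> = I +> (c \<odot> x)"
    using a_rcos_self[OF x] by blast
  finally show ?thesis
    by (simp add: alg_quot_def)
qed

lemma coset_eq_ideal_iff: "x \<in> carrier A \<Longrightarrow> I +> x = I \<longleftrightarrow> x \<in> I"
  using rcos_const_imp_mem a_rcos_zero[OF is_ideal] by blast

sublocale quot: assoc_algebra "A AQuot I"
proof -
  interpret Q: ring "A Quot I" by (rule quotient_is_ring)
  have "ring (A AQuot I)"
  proof (rule ringI)
    show "abelian_group (A AQuot I)"
    proof (rule abelian_groupI)
      fix X assume "X \<in> carrier (A AQuot I)"
      then show "\<exists>Y\<in>carrier (A AQuot I). Y \<oplus>\<^bsub>A AQuot I\<^esub> X = \<zero>\<^bsub>A AQuot I\<^esub>"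
        using Q.l_neg Q.a_inv_closed by (auto simp: alg_quot_def)
    qed (simp_all add: alg_quot_def Q.add.m_ac)
    show "Group.monoid (A AQuot I)"
      by (rule monoidI) (simp_all add: alg_quot_def Q.m_assoc)
  qed (simp_all add: alg_quot_def Q.l_distr Q.r_distr)
  then interpret R: ring "A AQuot I" .
  show "assoc_algebra (A AQuot I)"
  proof
    fix X Y c d
    assume X: "X \<in> carrier (A AQuot I)"
    obtain x where x: "x \<in> carrier A" "X = I +> x" using X by (rule quot_carrierE)
    have coset: "I +> z \<in> carrier (A AQuot I)" if "z \<in> carrier A" for z
      using that by (simp add: a_rcosetsI[OF a_subset])
    show "c \<odot>\<^bsub>A AQuot I\<^esub> X \<in> carrier (A AQuot I)"
      unfolding x(2) quot_smult[OF x(1)] using x(1) by (intro coset smult_closed)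
    show "(c + d) \<odot>\<^bsub>A AQuot I\<^esub> X = c \<odot>\<^bsub>A AQuot I\<^esub> X \<oplus>\<^bsub>A AQuot I\<^esub> d \<odot>\<^bsub>A AQuot I\<^esub> X"
      using x by (simp add: quot_smult quot_add smult_add_left)
    show "c \<odot>\<^bsub>A AQuot I\<^esub> (d \<odot>\<^bsub>A AQuot I\<^esub> X) = (c * d) \<odot>\<^bsub>A AQuot I\<^esub> X"
      using x by (simp add: quot_smult smult_smult)
    show "1 \<odot>\<^bsub>A AQuot I\<^esub> X = X"
      using x by (simp add: quot_smult)
    assume Y: "Y \<in> carrier (A AQuot I)"
    obtain y where y: "y \<in> carrier A" "Y = I +> y" using Y by (rule quot_carrierE)
    show "c \<odot>\<^bsub>A AQuot I\<^esub> (X \<oplus>\<^bsub>A AQuot I\<^esub> Y) = c \<odot>\<^bsub>A AQuot I\<^esub> X \<oplus>\<^bsub>A AQuot I\<^esub> c \<odot>\<^bsub>A AQuot I\<^esub> Y"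
      using x y by (simp add: quot_smult quot_add smult_add_right)
    show "(c \<odot>\<^bsub>A AQuot I\<^esub> X) \<otimes>\<^bsub>A AQuot I\<^esub> Y = c \<odot>\<^bsub>A AQuot I\<^esub> (X \<otimes>\<^bsub>A AQuot I\<^esub> Y)"
      using x y by (simp add: quot_smult quot_mult smult_mult_left)
    show "X \<otimes>\<^bsub>A AQuot I\<^esub> (c \<odot>\<^bsub>A AQuot I\<^esub> Y) = c \<odot>\<^bsub>A AQuot I\<^esub> (X \<otimes>\<^bsub>A AQuot I\<^esub> Y)"
      using x y by (simp add: quot_smult quot_mult smult_mult_right)
  qed
qed

lemma coset_hom: "(+>) I \<in> alg_hom A (A AQuot I)"
  by (rule alg_homI) (simp_all add: quot_add quot_mult quot_smult a_rcosetsI[OF a_subset])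

lemma quot_hom_exists:
  assumes "assoc_algebra B" and h: "h \<in> alg_hom A B" and hI: "\<And>x. x \<in> I \<Longrightarrow> h x = \<zero>\<^bsub>B\<^esub>"
  shows "\<exists>h' \<in> alg_hom (A AQuot I) B. \<forall>x\<in>carrier A. h' (I +> x) = h x"
proof -
  interpret B: assoc_algebra B by fact
  (* h is constant on a coset, so the image of a coset is a singleton *)
  define h' where "h' X = the_elem (h ` X)" for X
  have h': "h' (I +> x) = h x" if x: "x \<in> carrier A" for x
  proof -
    have "h y = h x" if "y \<in> I +> x" for y
    proof -
      from that obtain i where i: "i \<in> I" "y = i \<oplus> x"
        by (auto simp: a_r_coset_def r_coset_def)
      then show ?thesis
        using x by (simp add: alg_hom_add[OF h] a_Hcarr hI alg_hom_closed[OF h])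
    qed
    moreover have "x \<in> I +> x" using x by (rule a_rcos_self)
    ultimately have "h ` (I +> x) = {h x}" by blast
    then show ?thesis by (simp add: h'_def)
  qed
  have "h' \<in> alg_hom (A AQuot I) B"
  proof (rule alg_homI)
    fix X assume "X \<in> carrier (A AQuot I)"
    then obtain x where x: "x \<in> carrier A" "X = I +> x" by (rule quot_carrierE)
    show "h' X \<in> carrier B"
      using x by (simp add: h' alg_hom_closed[OF h])
    show "h' (c \<odot>\<^bsub>A AQuot I\<^esub> X) = c \<odot>\<^bsub>B\<^esub> h' X" for c
      using x by (simp add: quot_smult h' alg_hom_smult[OF h])
    fix Y assume "Y \<in> carrier (A AQuot I)"
    then obtain y where y: "y \<in> carrier A" "Y = I +> y" by (rule quot_carrierE)
    show "h' (X \<otimes>\<^bsub>A AQuot I\<^esub> Y) = h' X \<otimes>\<^bsub>B\<^esub> h' Y"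
      using x y by (simp add: quot_mult h' alg_hom_mult[OF h])
    show "h' (X \<oplus>\<^bsub>A AQuot I\<^esub> Y) = h' X \<oplus>\<^bsub>B\<^esub> h' Y"
      using x y by (simp add: quot_add h' alg_hom_add[OF h])
  qed (simp add: h' alg_hom_one[OF h])
  with h' show ?thesis by blast
qed

text \<open>
  This is how an automorphism of an algebra descends to a quotient when its action there is taking
  images of cosets.  The ideal has to be mapped onto itself: if its image were smaller, the image of
  a coset would not be a coset.
\<close>

lemma image_coset:
  assumes h: "h \<in> alg_hom A A" and hI: "h ` I = I" and x: "x \<in> carrier A"
  shows "h ` (I +> x) = I +> h x"
proof -
  have "h ` (I +> x) = (\<lambda>i. h (i \<oplus> x)) ` I"
    by (auto simp: a_r_coset_def r_coset_def)
  also have "\<dots> = (\<lambda>i. h i \<oplus> h x) ` I"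
    using x by (intro image_cong) (simp_all add: alg_hom_add[OF h] a_Hcarr)
  also have "\<dots> = (\<lambda>i. i \<oplus> h x) ` h ` I"
    by (simp add: image_image)
  also have "\<dots> = I +> h x"
    unfolding hI by (auto simp: a_r_coset_def r_coset_def)
  finally show ?thesis .
qed

lemma image_alg_hom:
  assumes h: "h \<in> alg_hom A A" and hI: "h ` I = I"
  shows "(`) h \<in> alg_hom (A AQuot I) (A AQuot I)"
proof (rule alg_homI)
  note image = image_coset[OF h hI] and closed = alg_hom_closed[OF h]
  fix X assume "X \<in> carrier (A AQuot I)"
  then obtain x where x: "x \<in> carrier A" "X = I +> x" by (rule quot_carrierE)
  show "h ` X \<in> carrier (A AQuot I)"
    using x by (simp add: image closed a_rcosetsI[OF a_subset])
  show "h ` (c \<odot>\<^bsub>A AQuot I\<^esub> X) = c \<odot>\<^bsub>A AQuot I\<^esub> h ` X" for c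
    using x by (simp add: quot_smult image closed alg_hom_smult[OF h])
  fix Y assume "Y \<in> carrier (A AQuot I)"
  then obtain y where y: "y \<in> carrier A" "Y = I +> y" by (rule quot_carrierE)
  show "h ` (X \<otimes>\<^bsub>A AQuot I\<^esub> Y) = h ` X \<otimes>\<^bsub>A AQuot I\<^esub> h ` Y"
    using x y by (simp add: quot_mult image closed alg_hom_mult[OF h])
  show "h ` (X \<oplus>\<^bsub>A AQuot I\<^esub> Y) = h ` X \<oplus>\<^bsub>A AQuot I\<^esub> h ` Y"
    using x y by (simp add: quot_add image closed alg_hom_add[OF h])
qed (simp add: image_coset[OF h hI] alg_hom_one[OF h])

end

lemma alg_hom_kernel_ideal:
  assumes "assoc_algebra A" "assoc_algebra B" "h \<in> alg_hom A B"
  shows "ideal {x \<in> carrier A. h x = \<zero>\<^bsub>B\<^esub>} A"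
proof -
  interpret A: assoc_algebra A by fact
  interpret B: assoc_algebra B by fact
  interpret ring_hom_ring A B h
    using assms(3) by (intro ring_hom_ringI2 A.ring_axioms B.ring_axioms) (simp add: alg_hom_def)
  show ?thesis
    using kernel_is_ideal unfolding a_kernel_def' .
qed

section \<open>Monoid algebras\<close>

text \<open>
  Identities between linear or bilinear maps on a monoid algebra are checked on the basis vectors,
  one argument at a time, by this rule.
\<close>

lemma poly_mapping_on_induct [consumes 1, case_names zero single add]:
  fixes f :: "'g \<Rightarrow>\<^sub>0 'c::comm_monoid_add"
  assumes f: "Poly_Mapping.keys f \<subseteq> C" and zero: "P 0"
    and single: "\<And>u c. u \<in> C \<Longrightarrow> P (Poly_Mapping.single u c)"
    and add: "\<And>f g. Poly_Mapping.keys f \<subseteq> C \<Longrightarrow> Poly_Mapping.keys g \<subseteq> C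
      \<Longrightarrow> P f \<Longrightarrow> P g \<Longrightarrow> P (f + g)"
  shows "P f"
proof -
  let ?s = "\<lambda>K. \<Sum>k\<in>K. Poly_Mapping.single k (Poly_Mapping.lookup f k)"
  have keys: "Poly_Mapping.keys (?s K) \<subseteq> K" for K
    by (rule order_trans[OF Poly_Mapping.keys_sum]) auto
  have "P (?s K)" if "finite K" "K \<subseteq> C" for K
    using that
  proof (induction K)
    case (insert k K)
    have "P (Poly_Mapping.single k (Poly_Mapping.lookup f k) + ?s K)"
      by (rule add) (use insert keys[of K] in \<open>auto simp: single\<close>)
    then show ?case
      using insert by simp
  qed (simp add: zero)
  moreover have "f = ?s (Poly_Mapping.keys f)"
    by (rule poly_mapping_eqI)
       (simp add: lookup_sum lookup_single when_def sum.delta' in_keys_iff)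
  ultimately show ?thesis
    using f by (metis finite_keys)
qed

lemma monoid_algebra_sel [simp]:
  "carrier (monoid_algebra G) = {f. Poly_Mapping.keys f \<subseteq> carrier G}"
  "\<one>\<^bsub>monoid_algebra G\<^esub> = Poly_Mapping.single \<one>\<^bsub>G\<^esub> 1"
  "\<zero>\<^bsub>monoid_algebra G\<^esub> = 0"
  "f \<oplus>\<^bsub>monoid_algebra G\<^esub> h = f + h"
  "c \<odot>\<^bsub>monoid_algebra G\<^esub> f = Poly_Mapping.map ((*) c) f"
  by (simp_all add: monoid_algebra_def)

lemma lookup_scale [simp]:
  "Poly_Mapping.lookup (Poly_Mapping.map ((*) c) f) k = (c::'f::field) * Poly_Mapping.lookup f k"
  by (simp add: map.rep_eq when_def)

lemma scale_zero [simp]: "Poly_Mapping.map ((*) c) 0 = (0 :: 'g \<Rightarrow>\<^sub>0 'f::field)"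
  by (rule poly_mapping_eqI) simp

lemma scale_single [simp]:
  "Poly_Mapping.map ((*) c) (Poly_Mapping.single u d) = Poly_Mapping.single u ((c::'f::field) * d)"
  by (rule poly_mapping_eqI) (simp add: lookup_single when_def)

lemma scale_add:
  "Poly_Mapping.map ((*) c) (f + g)
    = Poly_Mapping.map ((*) (c::'f::field)) f + Poly_Mapping.map ((*) c) g"
  by (rule poly_mapping_eqI) (simp add: lookup_add algebra_simps)

lemma keys_scale: "Poly_Mapping.keys (Poly_Mapping.map ((*) (c::'f::field)) f) \<subseteq> Poly_Mapping.keys f"
  by (auto simp: in_keys_iff)

lemma conv_single:
  "Poly_Mapping.single u (c::'f::field) \<otimes>\<^bsub>monoid_algebra G\<^esub> Poly_Mapping.single v d
    = Poly_Mapping.single (u \<otimes>\<^bsub>G\<^esub> v) (c * d)"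
  by (simp add: monoid_algebra_def)

lemma conv_add_left:
  "(f + g) \<otimes>\<^bsub>monoid_algebra G\<^esub> h
    = f \<otimes>\<^bsub>monoid_algebra G\<^esub> h + g \<otimes>\<^bsub>monoid_algebra G\<^esub> h"
  unfolding monoid_algebra_def
  by simp (rule setsum_keys_plus_distrib,
           simp_all add: single_add sum.distrib distrib_right)

lemma conv_add_right:
  "f \<otimes>\<^bsub>monoid_algebra G\<^esub> (g + h)
    = f \<otimes>\<^bsub>monoid_algebra G\<^esub> g + f \<otimes>\<^bsub>monoid_algebra G\<^esub> h"
  unfolding monoid_algebra_def
  by (simp flip: sum.distrib)
     (rule sum.cong[OF refl], rule setsum_keys_plus_distrib, simp_all add: single_add distrib_left)

lemma conv_zero [simp]:
  "0 \<otimes>\<^bsub>monoid_algebra G\<^esub> f = 0" "f \<otimes>\<^bsub>monoid_algebra G\<^esub> 0 = 0"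
  by (simp_all add: monoid_algebra_def)

lemma keys_conv:
  assumes "Group.monoid G" "Poly_Mapping.keys f \<subseteq> carrier G" "Poly_Mapping.keys g \<subseteq> carrier G"
  shows "Poly_Mapping.keys (f \<otimes>\<^bsub>monoid_algebra G\<^esub> g) \<subseteq> carrier G"
proof -
  interpret Group.monoid G by fact
  show ?thesis
    unfolding monoid_algebra_def using assms(2,3)
    by simp ((rule order_trans[OF Poly_Mapping.keys_sum] UN_least)+,
             auto simp: subset_iff split: if_splits)
qed

lemma scale_conv_left:
  "Poly_Mapping.map ((*) c) f \<otimes>\<^bsub>monoid_algebra G\<^esub> g
    = Poly_Mapping.map ((*) (c::'f::field)) (f \<otimes>\<^bsub>monoid_algebra G\<^esub> g)"
  using subset_UNIV[of "Poly_Mapping.keys f"]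
proof (induction f rule: poly_mapping_on_induct)
  case (single u a)
  show ?case
    using subset_UNIV[of "Poly_Mapping.keys g"]
    by (induction g rule: poly_mapping_on_induct)
       (simp_all add: conv_single conv_add_right scale_add mult.assoc)
qed (simp_all add: conv_add_left scale_add)

lemma scale_conv_right:
  "f \<otimes>\<^bsub>monoid_algebra G\<^esub> Poly_Mapping.map ((*) c) g
    = Poly_Mapping.map ((*) (c::'f::field)) (f \<otimes>\<^bsub>monoid_algebra G\<^esub> g)"
  using subset_UNIV[of "Poly_Mapping.keys f"]
proof (induction f rule: poly_mapping_on_induct)
  case (single u a)
  show ?case
    using subset_UNIV[of "Poly_Mapping.keys g"]
    by (induction g rule: poly_mapping_on_induct)
       (simp_all add: conv_single conv_add_right scale_add mult.left_commute)
qed (simp_all add: conv_add_left scale_add)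

theorem assoc_algebra_monoid_algebra:
  fixes G :: "('g, 'r) monoid_scheme"
  assumes "Group.monoid G"
  shows "assoc_algebra (monoid_algebra G :: ('f::field, 'g \<Rightarrow>\<^sub>0 'f) module)"
proof -
  interpret G: Group.monoid G by fact
  let ?A = "monoid_algebra G :: ('f, 'g \<Rightarrow>\<^sub>0 'f) module"
  have assoc: "(f \<otimes>\<^bsub>?A\<^esub> g) \<otimes>\<^bsub>?A\<^esub> h = f \<otimes>\<^bsub>?A\<^esub> (g \<otimes>\<^bsub>?A\<^esub> h)"
    if "Poly_Mapping.keys f \<subseteq> carrier G" "Poly_Mapping.keys g \<subseteq> carrier G"
      "Poly_Mapping.keys h \<subseteq> carrier G" for f g h
    using that(1)
  proof (induction rule: poly_mapping_on_induct)
    case (single u a)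
    show ?case
      using that(2)
    proof (induction rule: poly_mapping_on_induct)
      case (single v b)
      show ?case
        using that(3)
        by (induction rule: poly_mapping_on_induct)
           (use \<open>u \<in> carrier G\<close> single in
             \<open>simp_all add: conv_single conv_add_right conv_add_left G.m_assoc mult.assoc\<close>)
    qed (simp_all add: conv_add_right conv_add_left)
  qed (simp_all add: conv_add_right conv_add_left)
  have one_left: "Poly_Mapping.single \<one>\<^bsub>G\<^esub> 1 \<otimes>\<^bsub>?A\<^esub> f = f"
    if "Poly_Mapping.keys f \<subseteq> carrier G" for f
    using that by (induction rule: poly_mapping_on_induct) (simp_all add: conv_single conv_add_right)
  have one_right: "f \<otimes>\<^bsub>?A\<^esub> Poly_Mapping.single \<one>\<^bsub>G\<^esub> 1 = f"
    if "Poly_Mapping.keys f \<subseteq> carrier G" for f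
    using that by (induction rule: poly_mapping_on_induct) (simp_all add: conv_single conv_add_left)
  have keys_plus: "Poly_Mapping.keys (f + g) \<subseteq> carrier G"
    if "Poly_Mapping.keys f \<subseteq> carrier G" "Poly_Mapping.keys g \<subseteq> carrier G" for f g :: "'g \<Rightarrow>\<^sub>0 'f"
    using that Poly_Mapping.keys_add[of f g] by blast
  have "ring ?A"
  proof (rule ringI)
    show "abelian_group ?A"
    proof (rule abelian_groupI)
      fix f assume "f \<in> carrier ?A"
      then show "\<exists>g\<in>carrier ?A. g \<oplus>\<^bsub>?A\<^esub> f = \<zero>\<^bsub>?A\<^esub>"
        by (intro bexI[of _ "- f"]) simp_all
    qed (simp_all add: keys_plus add_ac)
    show "Group.monoid ?A"
      by (rule monoidI) (simp_all add: keys_conv[OF assms] assoc one_left one_right)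
  qed (simp_all add: conv_add_left conv_add_right)
  then interpret ring ?A .
  show ?thesis
  proof
    fix f :: "'g \<Rightarrow>\<^sub>0 'f" and c d
    show "f \<in> carrier ?A \<Longrightarrow> c \<odot>\<^bsub>?A\<^esub> f \<in> carrier ?A"
      using keys_scale[of c f] by auto
    show "(c + d) \<odot>\<^bsub>?A\<^esub> f = c \<odot>\<^bsub>?A\<^esub> f \<oplus>\<^bsub>?A\<^esub> d \<odot>\<^bsub>?A\<^esub> f"
      by (simp, rule poly_mapping_eqI) (simp add: lookup_add distrib_right)
    show "c \<odot>\<^bsub>?A\<^esub> (d \<odot>\<^bsub>?A\<^esub> f) = (c * d) \<odot>\<^bsub>?A\<^esub> f"
      by (simp, rule poly_mapping_eqI) (simp add: mult.assoc)
    show "1 \<odot>\<^bsub>?A\<^esub> f = f"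
      by (simp, rule poly_mapping_eqI) simp
  qed (simp_all add: scale_add scale_conv_left scale_conv_right)
qed

definition linear_ext ::
    "('f::field, 'b, 's) module_scheme \<Rightarrow> ('g \<Rightarrow> 'b) \<Rightarrow> ('g \<Rightarrow>\<^sub>0 'f) \<Rightarrow> 'b" where
  "linear_ext B g f =
     (\<Oplus>\<^bsub>B\<^esub>u\<in>Poly_Mapping.keys f. Poly_Mapping.lookup f u \<odot>\<^bsub>B\<^esub> g u)"

context assoc_algebra
begin

lemma linear_ext_zero [simp]: "linear_ext A g 0 = \<zero>"
  by (simp add: linear_ext_def)

lemma linear_ext_single [simp]: "g u \<in> carrier A \<Longrightarrow> linear_ext A g (Poly_Mapping.single u c) = c \<odot> g u"
  by (cases "c = 0") (simp_all add: linear_ext_def)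

lemma linear_ext_closed:
  "g \<in> Poly_Mapping.keys f \<rightarrow> carrier A \<Longrightarrow> linear_ext A g f \<in> carrier A"
  unfolding linear_ext_def by (intro finsum_closed) auto

lemma linear_ext_add:
  assumes g: "g \<in> Poly_Mapping.keys f \<union> Poly_Mapping.keys h \<rightarrow> carrier A"
  shows "linear_ext A g (f + h) = linear_ext A g f \<oplus> linear_ext A g h"
proof -
  let ?U = "Poly_Mapping.keys f \<union> Poly_Mapping.keys h"
  have U: "linear_ext A g k = (\<Oplus>u\<in>?U. Poly_Mapping.lookup k u \<odot> g u)"
    if "Poly_Mapping.keys k \<subseteq> ?U" for k
    unfolding linear_ext_def
    by (rule add.finprod_mono_neutral_cong_left)
       (use g that in \<open>auto simp: in_keys_iff Pi_iff\<close>)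
  have "linear_ext A g (f + h)
      = (\<Oplus>u\<in>?U. Poly_Mapping.lookup f u \<odot> g u \<oplus> Poly_Mapping.lookup h u \<odot> g u)"
    unfolding U[OF Poly_Mapping.keys_add] using g
    by (intro finsum_cong') (auto simp: lookup_add smult_add_left Pi_iff)
  also have "\<dots> = linear_ext A g f \<oplus> linear_ext A g h"
    using g U[of f] U[of h] by (subst finsum_addf) auto
  finally show ?thesis .
qed

lemma linear_ext_scale:
  assumes "g \<in> C \<rightarrow> carrier A" "Poly_Mapping.keys f \<subseteq> C"
  shows "linear_ext A g (Poly_Mapping.map ((*) c) f) = c \<odot> linear_ext A g f"
  using assms(2)
proof (induction rule: poly_mapping_on_induct)
  case (add f h)
  have sub: "Poly_Mapping.keys (Poly_Mapping.map ((*) c) f) \<subseteq> C"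
    "Poly_Mapping.keys (Poly_Mapping.map ((*) c) h) \<subseteq> C"
    using add keys_scale[of c f] keys_scale[of c h] by auto
  have "g \<in> Poly_Mapping.keys f \<rightarrow> carrier A" "g \<in> Poly_Mapping.keys h \<rightarrow> carrier A"
    using assms(1) add by auto
  then show ?case
    unfolding scale_add using assms(1) add sub
    by (subst (1 2) linear_ext_add) (auto simp: smult_add_right linear_ext_closed)
qed (use assms(1) in \<open>auto simp: smult_smult Pi_iff\<close>)

lemma linear_ext_diff:
  assumes "g \<in> Poly_Mapping.keys f \<union> Poly_Mapping.keys h \<rightarrow> carrier A"
  shows "linear_ext A g (f - h) = linear_ext A g f \<ominus> linear_ext A g h"
proof -
  have sub: "Poly_Mapping.keys (f - h) \<subseteq> Poly_Mapping.keys f \<union> Poly_Mapping.keys h"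
    by (rule Poly_Mapping.keys_diff)
  have "linear_ext A g ((f - h) + h) = linear_ext A g (f - h) \<oplus> linear_ext A g h"
    using sub assms by (intro linear_ext_add) blast
  moreover have "linear_ext A g (f - h) \<in> carrier A" "linear_ext A g h \<in> carrier A"
    using sub assms by (intro linear_ext_closed; blast)+
  ultimately show ?thesis
    by (simp add: a_minus_def a_assoc r_neg)
qed

lemma linear_ext_sum:
  assumes "finite X" "\<And>x. x \<in> X \<Longrightarrow> g (u x) \<in> carrier A"
  shows "linear_ext A g (\<Sum>x\<in>X. Poly_Mapping.single (u x) (c x)) = (\<Oplus>x\<in>X. c x \<odot> g (u x))"
  using assms
proof (induction X)
  case (insert x X)
  have "Poly_Mapping.keys (\<Sum>x\<in>X. Poly_Mapping.single (u x) (c x)) \<subseteq> u ` X"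
    by (rule order_trans[OF Poly_Mapping.keys_sum]) auto
  then have "g \<in> Poly_Mapping.keys (Poly_Mapping.single (u x) (c x))
      \<union> Poly_Mapping.keys (\<Sum>x\<in>X. Poly_Mapping.single (u x) (c x)) \<rightarrow> carrier A"
    using insert.prems by (auto split: if_splits)
  with insert show ?case
    by (simp add: linear_ext_add Pi_iff)
qed simp

lemma linear_ext_alg_hom:
  fixes G :: "('g, 's) monoid_scheme"
  assumes "Group.monoid G" and g: "g \<in> carrier G \<rightarrow> carrier A"
    and g_mult: "\<And>u v. u \<in> carrier G \<Longrightarrow> v \<in> carrier G \<Longrightarrow> g (u \<otimes>\<^bsub>G\<^esub> v) = g u \<otimes> g v"
    and g_one: "g \<one>\<^bsub>G\<^esub> = \<one>"
  shows "linear_ext A g \<in> alg_hom (monoid_algebra G) A"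
proof (rule alg_homI)
  interpret G: Group.monoid G by fact
  have closed: "linear_ext A g f \<in> carrier A" if "Poly_Mapping.keys f \<subseteq> carrier G" for f
    using that g by (intro linear_ext_closed) auto
  have add: "linear_ext A g (f + h) = linear_ext A g f \<oplus> linear_ext A g h"
    if "Poly_Mapping.keys f \<subseteq> carrier G" "Poly_Mapping.keys h \<subseteq> carrier G" for f h
    using that g by (intro linear_ext_add) auto
  note keys = keys_conv[OF \<open>Group.monoid G\<close>]
  have g' [simp]: "g u \<in> carrier A" if "u \<in> carrier G" for u
    using g that by auto
  have mult: "linear_ext A g (f \<otimes>\<^bsub>monoid_algebra G\<^esub> h) = linear_ext A g f \<otimes> linear_ext A g h"
    if "Poly_Mapping.keys f \<subseteq> carrier G" "Poly_Mapping.keys h \<subseteq> carrier G" for f h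
    using that(1)
  proof (induction rule: poly_mapping_on_induct)
    case (single u a)
    show ?case
      using that(2)
    proof (induction rule: poly_mapping_on_induct)
      case (single v b)
      then show ?case
        using \<open>u \<in> carrier G\<close>
        by (simp add: conv_single g_mult smult_mult_left smult_mult_right smult_smult mult.commute)
    next
      case (add h k)
      have "Poly_Mapping.keys (Poly_Mapping.single u a) \<subseteq> carrier G"
        using \<open>u \<in> carrier G\<close> by simp
      with add show ?case
        using \<open>u \<in> carrier G\<close>
        by (simp add: conv_add_right \<open>\<And>h f. _ \<Longrightarrow> _ \<Longrightarrow> linear_ext A g (f + h) = _\<close> keys closed r_distr)
    qed (use \<open>u \<in> carrier G\<close> in simp)
  next
    case (add f k)
    then show ?case
      using that(2) by (simp add: conv_add_left \<open>\<And>h f. _ \<Longrightarrow> _ \<Longrightarrow> linear_ext A g (f + h) = _\<close>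
          keys closed l_distr)
  qed (simp add: closed that(2))
  fix f h :: "'g \<Rightarrow>\<^sub>0 'f" and c
  assume f: "f \<in> carrier (monoid_algebra G)"
  show "linear_ext A g f \<in> carrier A"
    using f by (simp add: closed)
  show "linear_ext A g (c \<odot>\<^bsub>monoid_algebra G\<^esub> f) = c \<odot> linear_ext A g f"
    using f by (simp add: linear_ext_scale[OF g])
  assume h: "h \<in> carrier (monoid_algebra G)"
  show "linear_ext A g (f \<otimes>\<^bsub>monoid_algebra G\<^esub> h) = linear_ext A g f \<otimes> linear_ext A g h"
    using f h by (simp add: mult)
  show "linear_ext A g (f \<oplus>\<^bsub>monoid_algebra G\<^esub> h) = linear_ext A g f \<oplus> linear_ext A g h"
    using f h by (simp add: add)
qed (simp add: g_one)

end

lemma alg_hom_monoid_algebra_eqI: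
  assumes h: "h \<in> alg_hom (monoid_algebra G) B" and h': "h' \<in> alg_hom (monoid_algebra G) B"
    and "assoc_algebra B"
    and eq: "\<And>u. u \<in> carrier G \<Longrightarrow> h (Poly_Mapping.single u 1) = h' (Poly_Mapping.single u 1)"
    and f: "f \<in> carrier (monoid_algebra G)"
  shows "h f = h' f"
proof -
  interpret B: assoc_algebra B by fact
  have scale: "k (Poly_Mapping.single u c) = c \<odot>\<^bsub>B\<^esub> k (Poly_Mapping.single u 1)"
    if "k \<in> alg_hom (monoid_algebra G) B" "u \<in> carrier G" for k u c
    using alg_hom_smult[OF that(1), of "Poly_Mapping.single u 1" c] that(2) by simp
  have zero: "k 0 = \<zero>\<^bsub>B\<^esub>" if "k \<in> alg_hom (monoid_algebra G) B" for k
    using alg_hom_smult[OF that, of 0 0] alg_hom_closed[OF that, of 0]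
    by simp
  have "Poly_Mapping.keys f \<subseteq> carrier G" using f by simp
  then show ?thesis
  proof (induction rule: poly_mapping_on_induct)
    case (add f g)
    then show ?case
      using alg_hom_add[OF h, of f g] alg_hom_add[OF h', of f g] by simp
  next
    case (single u c)
    then show ?case
      using eq scale[OF h] scale[OF h'] by metis
  qed (simp add: zero[OF h] zero[OF h'])
qed

section \<open>Algebras given by generators and relators\<close>

lemma monoid_word_monoid: "Group.monoid (word_monoid X)"
  by (rule monoidI) (auto simp: word_monoid_def)

lemma word_monoid_sel [simp]:
  "carrier (word_monoid X) = lists X" "u \<otimes>\<^bsub>word_monoid X\<^esub> v = u @ v" "\<one>\<^bsub>word_monoid X\<^esub> = []"
  by (simp_all add: word_monoid_def)

lemmas assoc_algebra_free = assoc_algebra_monoid_algebra[OF monoid_word_monoid]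

abbreviation word_ext ::
    "('f::field, 'b, 's) module_scheme \<Rightarrow> ('x \<Rightarrow> 'b) \<Rightarrow> ('x list \<Rightarrow>\<^sub>0 'f) \<Rightarrow> 'b" where
  "word_ext B g \<equiv> linear_ext B (\<lambda>w. list_prod B (map g w))"

lemma (in assoc_algebra) word_ext_alg_hom:
  assumes "g \<in> X \<rightarrow> carrier A"
  shows "word_ext A g \<in> alg_hom (free_algebra X) A"
proof -
  have "set (map g w) \<subseteq> carrier A" if "w \<in> lists X" for w
    using that assms by (auto simp: Pi_iff)
  then show ?thesis
    by (intro linear_ext_alg_hom monoid_word_monoid)
       (auto simp del: set_map simp add: list_prod_append)
qed

lemma alg_hom_free_eq_word_ext:
  assumes "assoc_algebra B" and h: "h \<in> alg_hom (free_algebra X) B"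
    and g: "\<And>x. x \<in> X \<Longrightarrow> h (Poly_Mapping.single [x] 1) = g x"
    and f: "f \<in> carrier (free_algebra X)"
  shows "h f = word_ext B g f"
proof -
  interpret B: assoc_algebra B by fact
  have g': "g \<in> X \<rightarrow> carrier B"
    using alg_hom_closed[OF h] by (simp flip: g)
  have word: "h (Poly_Mapping.single w 1) = list_prod B (map g w)" if "w \<in> lists X" for w
    using that
  proof (induction w)
    case Nil
    then show ?case using alg_hom_one[OF h] by simp
  next
    case (Cons x w)
    then show ?case
      using alg_hom_mult[OF h, of "Poly_Mapping.single [x] 1" "Poly_Mapping.single w 1"]
      by (simp add: conv_single g)
  qed
  have closed: "set (map g w) \<subseteq> carrier B" if "w \<in> lists X" for w
    using that g' by (auto simp: Pi_iff)
  show ?thesis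
    by (rule alg_hom_monoid_algebra_eqI[OF h B.word_ext_alg_hom[OF g'] \<open>assoc_algebra B\<close> _ f])
       (use closed in \<open>simp del: set_map add: word\<close>)
qed

locale presentation =
  fixes X :: "'x set" and R :: "('x list \<Rightarrow>\<^sub>0 'f::field) set"
  assumes relators: "R \<subseteq> carrier (free_algebra X)"
begin

sublocale free: assoc_algebra "free_algebra X :: ('f, 'x list \<Rightarrow>\<^sub>0 'f) module"
  by (rule assoc_algebra_free)

abbreviation "relator_ideal \<equiv> genideal (free_algebra X) R"

sublocale free: algebra_ideal "free_algebra X :: ('f, 'x list \<Rightarrow>\<^sub>0 'f) module" relator_ideal
  using free.genideal_ideal[OF relators]
  by (intro algebra_ideal.intro free.assoc_algebra_axioms)

lemma assoc_algebra_presented: "assoc_algebra (presented_algebra X R)"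
  unfolding presented_algebra_def by (rule free.quot.assoc_algebra_axioms)

lemma pgen_closed: "x \<in> X \<Longrightarrow> pgen X R x \<in> carrier (presented_algebra X R)"
  unfolding presented_algebra_def pgen_def
  by (rule alg_hom_closed[OF free.coset_hom]) simp

lemma coset_eq_word_ext:
  assumes "f \<in> carrier (free_algebra X)"
  shows "relator_ideal +>\<^bsub>free_algebra X\<^esub> f = word_ext (presented_algebra X R) (pgen X R) f"
  using alg_hom_free_eq_word_ext[OF assoc_algebra_presented[unfolded presented_algebra_def]
      free.coset_hom pgen_def[symmetric] assms]
  unfolding presented_algebra_def .

text \<open>
  The quotient map is evaluation of words at the classes of the generators, so every relator, being
  in the kernel, turns into a relation between these classes.
\<close>

lemma relator_vanishes:
  assumes "r \<in> R"
  shows "word_ext (presented_algebra X R) (pgen X R) r = \<zero>\<^bsub>presented_algebra X R\<^esub>"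
proof -
  have r: "r \<in> carrier (free_algebra X)" "r \<in> relator_ideal"
    using assms relators free.genideal_self[OF relators] by auto
  show ?thesis
    unfolding coset_eq_word_ext[OF r(1), symmetric]
    using free.coset_eq_ideal_iff[OF r(1)] r(2) by (simp add: presented_algebra_def)
qed

lemma presented_hom_exists:
  assumes "assoc_algebra B" and g: "g \<in> X \<rightarrow> carrier B"
    and R: "\<And>r. r \<in> R \<Longrightarrow> word_ext B g r = \<zero>\<^bsub>B\<^esub>"
  shows "\<exists>h \<in> alg_hom (presented_algebra X R) B. \<forall>x\<in>X. h (pgen X R x) = g x"
proof -
  interpret B: assoc_algebra B by fact
  have hom: "word_ext B g \<in> alg_hom (free_algebra X) B"
    using g by (rule B.word_ext_alg_hom)
  have "relator_ideal \<subseteq> {f \<in> carrier (free_algebra X). word_ext B g f = \<zero>\<^bsub>B\<^esub>}"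
    using R relators
    by (intro free.genideal_minimal alg_hom_kernel_ideal free.assoc_algebra_axioms
          B.assoc_algebra_axioms hom) auto
  then obtain h where h: "h \<in> alg_hom (presented_algebra X R) B"
      "\<And>f. f \<in> carrier (free_algebra X) \<Longrightarrow> h (relator_ideal +>\<^bsub>free_algebra X\<^esub> f) = word_ext B g f"
    using free.quot_hom_exists[OF B.assoc_algebra_axioms hom]
    unfolding presented_algebra_def by blast
  have "h (pgen X R x) = g x" if "x \<in> X" for x
    using h(2)[of "Poly_Mapping.single [x] 1"] that g by (simp add: pgen_def Pi_iff)
  with h(1) show ?thesis by blast
qed

lemma presented_hom_unique:
  assumes "assoc_algebra B" and h: "h \<in> alg_hom (presented_algebra X R) B"
    and h': "h' \<in> alg_hom (presented_algebra X R) B"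
    and eq: "\<And>x. x \<in> X \<Longrightarrow> h (pgen X R x) = h' (pgen X R x)"
    and a: "a \<in> carrier (presented_algebra X R)"
  shows "h a = h' a"
proof -
  interpret B: assoc_algebra B by fact
  let ?\<pi> = "(+>\<^bsub>free_algebra X\<^esub>) relator_ideal"
  obtain f where f: "f \<in> carrier (free_algebra X)" "a = ?\<pi> f"
    using a free.quot_carrierE unfolding presented_algebra_def by metis
  have hom: "k \<circ> ?\<pi> \<in> alg_hom (free_algebra X) B" if "k \<in> alg_hom (presented_algebra X R) B" for k
    using free.coset_hom that unfolding presented_algebra_def by (rule alg_hom_comp)
  have "(h \<circ> ?\<pi>) f = word_ext B (\<lambda>x. h' (pgen X R x)) f"
    by (rule alg_hom_free_eq_word_ext[OF B.assoc_algebra_axioms hom[OF h] _ f(1)])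
       (use eq in \<open>simp add: pgen_def\<close>)
  also have "\<dots> = (h' \<circ> ?\<pi>) f"
    by (rule alg_hom_free_eq_word_ext[OF B.assoc_algebra_axioms hom[OF h'] _ f(1), symmetric])
       (simp add: pgen_def)
  finally have "(h \<circ> ?\<pi>) f = (h' \<circ> ?\<pi>) f" .
  then show ?thesis
    using f(2) by simp
qed

end

section \<open>Tensor powers\<close>

(* index sets such as {1..m} then keep the form in which they are given *)
declare One_nat_def [simp del]

lemma monoid_tuple_monoid:
  assumes "Group.monoid A"
  shows "Group.monoid (tuple_monoid A m)"
proof -
  interpret Group.monoid A by fact
  show ?thesis
    by (rule monoidI) (auto simp: PiE_iff m_assoc fun_eq_iff extensional_def)
qed

lemma (in abelian_monoid) finsum_Sigma:
  assumes "finite X" "\<And>x. x \<in> X \<Longrightarrow> finite (Y x)"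
    and "\<And>x y. x \<in> X \<Longrightarrow> y \<in> Y x \<Longrightarrow> v x y \<in> carrier G"
  shows "(\<Oplus>x\<in>X. \<Oplus>y\<in>Y x. v x y) = (\<Oplus>z\<in>Sigma X Y. v (fst z) (snd z))"
  using assms
proof (induction X)
  case (insert x X)
  have eq: "Sigma (insert x X) Y = Pair x ` Y x \<union> Sigma X Y" by auto
  have "(\<Oplus>z\<in>Sigma (insert x X) Y. v (fst z) (snd z))
      = (\<Oplus>z\<in>Pair x ` Y x. v (fst z) (snd z)) \<oplus> (\<Oplus>z\<in>Sigma X Y. v (fst z) (snd z))"
    unfolding eq using insert by (intro finsum_Un_disjoint) auto
  also have "(\<Oplus>z\<in>Pair x ` Y x. v (fst z) (snd z)) = (\<Oplus>y\<in>Y x. v x y)"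
    using insert by (subst finsum_reindex) (auto simp: inj_on_def)
  finally show ?case
    using insert by (subst finsum_insert) (auto intro!: finsum_closed)
qed simp

lemma (in abelian_monoid) finsum_PiE_insert:
  assumes k: "k \<notin> S" and fin: "finite S" "\<And>s. s \<in> insert k S \<Longrightarrow> finite (X s)"
    and h: "\<And>\<phi>. \<phi> \<in> Pi\<^sub>E (insert k S) X \<Longrightarrow> h \<phi> \<in> carrier G"
  shows "(\<Oplus>\<phi>\<in>Pi\<^sub>E (insert k S) X. h \<phi>) = (\<Oplus>y\<in>X k. \<Oplus>\<phi>\<in>Pi\<^sub>E S X. h (\<phi>(k := y)))"
proof -
  have upd: "\<phi>(k := y) \<in> Pi\<^sub>E (insert k S) X" if "y \<in> X k" "\<phi> \<in> Pi\<^sub>E S X" for y \<phi>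
    using that by (auto simp: PiE_iff extensional_def)
  have "(\<Oplus>\<phi>\<in>Pi\<^sub>E (insert k S) X. h \<phi>)
      = (\<Oplus>z\<in>X k \<times> Pi\<^sub>E S X. h ((\<lambda>(y, g). g(k := y)) z))"
    using h unfolding PiE_insert_eq by (intro finsum_reindex inj_combinator k) auto
  also have "\<dots> = (\<Oplus>z\<in>X k \<times> Pi\<^sub>E S X. h ((snd z)(k := fst z)))"
    using h upd by (intro finsum_cong') auto
  also have "\<dots> = (\<Oplus>y\<in>X k. \<Oplus>\<phi>\<in>Pi\<^sub>E S X. h (\<phi>(k := y)))"
    using fin h upd by (intro finsum_Sigma[symmetric]) (auto intro!: finite_PiE)
  finally show ?thesis .
qed

text \<open>
  This distributes the positions \<open>S\<close> of a multi-index over the factors \<open>T\<close> of a tensor power: \<open>b\<close>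
  gives the factor that a position belongs to.
\<close>

lemma bij_betw_PiE_blocks:
  assumes b: "b \<in> S \<rightarrow> T"
  shows "bij_betw (\<lambda>f. \<lambda>t\<in>T. restrict f {s\<in>S. b s = t})
    (Pi\<^sub>E S X) (Pi\<^sub>E T (\<lambda>t. Pi\<^sub>E {s\<in>S. b s = t} X))"
proof (rule bij_betw_byWitness[where f' = "\<lambda>F. \<lambda>s\<in>S. F (b s) s"])
  show "\<forall>f\<in>Pi\<^sub>E S X. (\<lambda>s\<in>S. (\<lambda>t\<in>T. restrict f {s\<in>S. b s = t}) (b s) s) = f"
    using b by (auto simp: fun_eq_iff PiE_iff extensional_def)
  show "\<forall>F\<in>Pi\<^sub>E T (\<lambda>t. Pi\<^sub>E {s\<in>S. b s = t} X).
      (\<lambda>t\<in>T. restrict (\<lambda>s\<in>S. F (b s) s) {s\<in>S. b s = t}) = F"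
  proof
    fix F assume F: "F \<in> Pi\<^sub>E T (\<lambda>t. Pi\<^sub>E {s\<in>S. b s = t} X)"
    have "F t s = undefined" if "t \<in> T" "\<not> (s \<in> S \<and> b s = t)" for s t
    proof -
      from F that(1) have "F t \<in> Pi\<^sub>E {s\<in>S. b s = t} X" by auto
      then show ?thesis using that(2) by (intro PiE_arb) auto
    qed
    moreover have "F t = undefined" if "t \<notin> T" for t
      using F that by (rule PiE_arb)
    ultimately show "(\<lambda>t\<in>T. restrict (\<lambda>s\<in>S. F (b s) s) {s\<in>S. b s = t}) = F"
      by (auto simp: fun_eq_iff restrict_def)
  qed
  show "(\<lambda>f. \<lambda>t\<in>T. restrict f {s\<in>S. b s = t}) ` Pi\<^sub>E S X \<subseteq> Pi\<^sub>E T (\<lambda>t. Pi\<^sub>E {s\<in>S. b s = t} X)"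
    by (auto simp: restrict_def PiE_iff extensional_def split: if_splits)
  show "(\<lambda>F. \<lambda>s\<in>S. F (b s) s) ` Pi\<^sub>E T (\<lambda>t. Pi\<^sub>E {s\<in>S. b s = t} X) \<subseteq> Pi\<^sub>E S X"
    using b by (fastforce simp: PiE_iff Pi_iff)
qed

locale tensor_power_algebra = assoc_algebra A for A (structure) and m :: nat
begin

abbreviation "T \<equiv> tensor_power A m"
abbreviation "tensor \<equiv> pure_tensor A m"

sublocale tuples: assoc_algebra "monoid_algebra (tuple_monoid A m)"
  by (rule assoc_algebra_monoid_algebra[OF monoid_tuple_monoid[OF monoid_axioms]])

lemma tensor_relators_closed:
  "tensor_relators A m \<subseteq> carrier (monoid_algebra (tuple_monoid A m))"
proof -
  have upd: "x(s := u) \<in> carrier (tuple_monoid A m)"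
    if "x \<in> carrier (tuple_monoid A m)" "s \<in> {1..m}" "u \<in> carrier A" for x s u
    using that by (auto simp: PiE_iff extensional_def)
  have single: "Poly_Mapping.single y c \<in> carrier (monoid_algebra (tuple_monoid A m))"
    if "y \<in> carrier (tuple_monoid A m)" for y c
    using that by (simp del: carrier_product_group)
  have diff: "f - g \<in> carrier (monoid_algebra (tuple_monoid A m))"
    if "f \<in> carrier (monoid_algebra (tuple_monoid A m))"
      "g \<in> carrier (monoid_algebra (tuple_monoid A m))" for f g
    using that Poly_Mapping.keys_diff[of f g] by auto
  show ?thesis
    unfolding tensor_relators_def
    by (auto simp del: monoid_algebra_sel carrier_product_group intro!: diff single upd)
qed

sublocale tuples: algebra_ideal "monoid_algebra (tuple_monoid A m)" "tensor_ideal A m"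
  using tuples.genideal_ideal[OF tensor_relators_closed]
  by (intro algebra_ideal.intro tuples.assoc_algebra_axioms) (simp add: tensor_ideal_def)

sublocale T: assoc_algebra T
  unfolding tensor_power_def by (rule tuples.quot.assoc_algebra_axioms)

lemma relator_in_tensor_ideal: "r \<in> tensor_relators A m \<Longrightarrow> r \<in> tensor_ideal A m"
  unfolding tensor_ideal_def using tuples.genideal_self[OF tensor_relators_closed] by blast

lemma tensor_coset_eqI:
  assumes "f - g \<in> tensor_ideal A m" "g \<in> carrier (monoid_algebra (tuple_monoid A m))"
  shows "tensor_ideal A m +>\<^bsub>monoid_algebra (tuple_monoid A m)\<^esub> f
       = tensor_ideal A m +>\<^bsub>monoid_algebra (tuple_monoid A m)\<^esub> g"
proof -
  have "f = (f - g) + g" by simp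
  then have "f \<in> tensor_ideal A m +>\<^bsub>monoid_algebra (tuple_monoid A m)\<^esub> g"
    using assms(1) unfolding a_r_coset_def r_coset_def by (simp, blast)
  then show ?thesis
    using assms(2) by (metis tuples.a_repr_independence')
qed

lemma restrict_tuple:
  "x \<in> {1..m} \<rightarrow> carrier A \<Longrightarrow> restrict x {1..m} \<in> carrier (tuple_monoid A m)"
  by auto

lemma tensor_closed [simp, intro]:
  assumes "x \<in> {1..m} \<rightarrow> carrier A"
  shows "tensor x \<in> carrier T"
  unfolding pure_tensor_def tensor_power_def
  using restrict_tuple[OF assms]
  by (intro alg_hom_closed[OF tuples.coset_hom]) (simp del: carrier_product_group)

lemma tensor_cong: "(\<And>s. s \<in> {1..m} \<Longrightarrow> x s = y s) \<Longrightarrow> tensor x = tensor y"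
  unfolding pure_tensor_def using restrict_ext[of "{1..m}" x y] by metis

lemma tensor_mult:
  assumes "x \<in> {1..m} \<rightarrow> carrier A" "y \<in> {1..m} \<rightarrow> carrier A"
  shows "tensor x \<otimes>\<^bsub>T\<^esub> tensor y = tensor (\<lambda>s. x s \<otimes> y s)"
proof -
  have "restrict (\<lambda>s. x s \<otimes> y s) {1..m}
      = restrict x {1..m} \<otimes>\<^bsub>tuple_monoid A m\<^esub> restrict y {1..m}"
    by (auto simp: fun_eq_iff)
  then show ?thesis
    unfolding pure_tensor_def tensor_power_def
    using restrict_tuple[OF assms(1)] restrict_tuple[OF assms(2)]
    by (subst tuples.quot_mult)
       (simp_all add: conv_single del: carrier_product_group mult_product_group)
qed

lemma tensor_one: "\<one>\<^bsub>T\<^esub> = tensor (\<lambda>s. \<one>)"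
  unfolding pure_tensor_def tensor_power_def tuples.quot_sel(2) by simp

lemma tensor_list_prod:
  assumes "\<And>i s. i \<in> set is \<Longrightarrow> s \<in> {1..m} \<Longrightarrow> x i s \<in> carrier A"
  shows "list_prod T (map (\<lambda>i. tensor (x i)) is) = tensor (\<lambda>s. list_prod A (map (\<lambda>i. x i s) is))"
  using assms
proof (induction "is")
  case (Cons i "is")
  then have "(\<lambda>s. list_prod A (map (\<lambda>i. x i s) is)) \<in> {1..m} \<rightarrow> carrier A"
    by (auto intro!: list_prod_closed)
  with Cons show ?case
    by (simp add: tensor_mult Pi_iff)
qed (simp add: tensor_one)

lemma restrict_upd:
  "s \<in> {1..m} \<Longrightarrow> restrict (x(s := u)) {1..m} = (restrict x {1..m})(s := u)"
  by auto

lemma upd_closed: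
  "x \<in> {1..m} \<rightarrow> carrier A \<Longrightarrow> u \<in> carrier A \<Longrightarrow> x(s := u) \<in> {1..m} \<rightarrow> carrier A"
  by auto

lemma tensor_add_slot:
  assumes x: "x \<in> {1..m} \<rightarrow> carrier A" and s: "s \<in> {1..m}" and u: "u \<in> carrier A" and v: "v \<in> carrier A"
  shows "tensor (x(s := u \<oplus> v)) = tensor (x(s := u)) \<oplus>\<^bsub>T\<^esub> tensor (x(s := v))"
proof -
  let ?e = "\<lambda>u. Poly_Mapping.single ((restrict x {1..m})(s := u)) 1"
  have e: "?e u \<in> carrier (monoid_algebra (tuple_monoid A m))" if "u \<in> carrier A" for u
    using restrict_tuple[OF upd_closed[OF x that, of s]] restrict_upd[OF s, of x u]
    by (simp del: carrier_product_group)
  have "?e (u \<oplus> v) - (?e u + ?e v) \<in> tensor_ideal A m"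
    unfolding diff_diff_eq[symmetric] using restrict_tuple[OF x] s u v
    by (intro relator_in_tensor_ideal) (unfold tensor_relators_def, blast)
  moreover have "?e u + ?e v \<in> carrier (monoid_algebra (tuple_monoid A m))"
    using tuples.add.m_closed[OF e[OF u] e[OF v]] by simp
  ultimately show ?thesis
    unfolding pure_tensor_def tensor_power_def restrict_upd[OF s] tuples.quot_add[OF e[OF u] e[OF v]]
      monoid_algebra_sel(4)
    by (rule tensor_coset_eqI)
qed

lemma tensor_smult_slot:
  assumes x: "x \<in> {1..m} \<rightarrow> carrier A" and s: "s \<in> {1..m}" and u: "u \<in> carrier A"
  shows "tensor (x(s := c \<odot> u)) = c \<odot>\<^bsub>T\<^esub> tensor (x(s := u))"
proof -
  let ?e = "\<lambda>u. Poly_Mapping.single ((restrict x {1..m})(s := u))"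
  have e: "?e u d \<in> carrier (monoid_algebra (tuple_monoid A m))" for d
    using restrict_tuple[OF upd_closed[OF x u, of s]] restrict_upd[OF s, of x u]
    by (simp del: carrier_product_group)
  have "?e (c \<odot> u) 1 - ?e u c \<in> tensor_ideal A m"
    using restrict_tuple[OF x] s u
    by (intro relator_in_tensor_ideal) (unfold tensor_relators_def, blast)
  then show ?thesis
    unfolding pure_tensor_def tensor_power_def restrict_upd[OF s] tuples.quot_smult[OF e]
    using e[of c] by (simp add: tensor_coset_eqI del: monoid_algebra_sel(1))
qed

lemma tensor_zero_slot:
  assumes "x \<in> {1..m} \<rightarrow> carrier A" "s \<in> {1..m}" "x s = \<zero>"
  shows "tensor x = \<zero>\<^bsub>T\<^esub>"
  using tensor_smult_slot[OF assms(1,2) zero_closed, of 0] assms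
  by (metis T.smult_zero_left fun_upd_triv smult_zero_right tensor_closed)

lemma tensor_finsum_slot:
  assumes x: "x \<in> {1..m} \<rightarrow> carrier A" and s: "s \<in> {1..m}"
    and "finite Y" "v \<in> Y \<rightarrow> carrier A"
  shows "tensor (x(s := \<Oplus>y\<in>Y. v y)) = (\<Oplus>\<^bsub>T\<^esub>y\<in>Y. tensor (x(s := v y)))"
  using assms(3,4)
proof (induction Y)
  case empty
  show ?case
    using tensor_zero_slot[OF upd_closed[OF x zero_closed, of s] s] by (simp add: fun_upd_def)
next
  case (insert y Y)
  then have v: "v \<in> Y \<rightarrow> carrier A" "v y \<in> carrier A" by auto
  have closed: "tensor (x(s := u)) \<in> carrier T" if "u \<in> carrier A" for u
    using upd_closed[OF x that] by (rule tensor_closed)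
  have "tensor (x(s := \<Oplus>y\<in>insert y Y. v y))
      = tensor (x(s := v y)) \<oplus>\<^bsub>T\<^esub> tensor (x(s := \<Oplus>y\<in>Y. v y))"
    using tensor_add_slot[OF x s v(2) finsum_closed[OF v(1)]] finsum_insert[OF insert.hyps v]
    by argo
  also have "\<dots> = (\<Oplus>\<^bsub>T\<^esub>y\<in>insert y Y. tensor (x(s := v y)))"
    unfolding insert.IH[OF v(1)] using insert.hyps v closed
    by (intro T.finsum_insert[symmetric]) auto
  finally show ?case .
qed

lemma tensor_smult:
  assumes x: "x \<in> {1..m} \<rightarrow> carrier A"
  shows "tensor (\<lambda>s. c s \<odot> x s) = (\<Prod>s\<in>{1..m}. c s) \<odot>\<^bsub>T\<^esub> tensor x"
proof -
  have "tensor (\<lambda>s. if s \<in> S then c s \<odot> x s else x s) = (\<Prod>s\<in>S. c s) \<odot>\<^bsub>T\<^esub> tensor x"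
    if "finite S" "S \<subseteq> {1..m}" for S
    using that
  proof (induction S)
    case (insert s S)
    let ?y = "\<lambda>s. if s \<in> S then c s \<odot> x s else x s"
    have y: "?y \<in> {1..m} \<rightarrow> carrier A" and xs: "x s \<in> carrier A" and s: "s \<in> {1..m}"
      using x insert by (auto simp: Pi_iff)
    have "(\<lambda>t. if t \<in> insert s S then c t \<odot> x t else x t) = ?y(s := c s \<odot> x s)"
      by auto
    then have "tensor (\<lambda>t. if t \<in> insert s S then c t \<odot> x t else x t)
        = c s \<odot>\<^bsub>T\<^esub> tensor (?y(s := x s))"
      using tensor_smult_slot[OF y s xs] by simp
    also have "?y(s := x s) = ?y"
      using insert by auto
    finally show ?case
      using insert x by (simp add: T.smult_smult)
  qed (use x in simp)
  from this[of "{1..m}"] show ?thesis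
    using tensor_cong[of "\<lambda>s. if s \<in> {1..m} then c s \<odot> x s else x s" "\<lambda>s. c s \<odot> x s"] by simp
qed

text \<open>
  The factors are expanded one at a time, by induction on the set \<open>S\<close> of expanded factors.  The
  entries \<open>x\<close> of the remaining factors must stay arbitrary, because expanding one more factor turns
  its entry into one of the summands.
\<close>

lemma tensor_finsum:
  assumes fin: "\<And>s. s \<in> {1..m} \<Longrightarrow> finite (Y s)"
    and v: "\<And>s y. s \<in> {1..m} \<Longrightarrow> y \<in> Y s \<Longrightarrow> v s y \<in> carrier A"
  shows "tensor (\<lambda>s. \<Oplus>y\<in>Y s. v s y) = (\<Oplus>\<^bsub>T\<^esub>f\<in>Pi\<^sub>E {1..m} Y. tensor (\<lambda>s. v s (f s)))"
proof -
  have "tensor (\<lambda>s. if s \<in> S then \<Oplus>y\<in>Y s. v s y else x s)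
      = (\<Oplus>\<^bsub>T\<^esub>f\<in>Pi\<^sub>E S Y. tensor (\<lambda>s. if s \<in> S then v s (f s) else x s))"
    if "finite S" "S \<subseteq> {1..m}" "x \<in> {1..m} \<rightarrow> carrier A" for S x
    using that
  proof (induction S arbitrary: x)
    case (insert s S)
    have s: "s \<in> {1..m}" and vs: "v s \<in> Y s \<rightarrow> carrier A" and finY: "finite (Y s)"
      and S: "S \<subseteq> {1..m}" and finPi: "finite (Pi\<^sub>E S Y)"
      using insert fin v by (auto intro!: finite_PiE)
    let ?y = "\<lambda>t. if t \<in> S then \<Oplus>y\<in>Y t. v t y else x t"
    have y: "?y \<in> {1..m} \<rightarrow> carrier A"
      using insert v by (auto intro!: finsum_closed)
    let ?t = "\<lambda>y f. tensor (\<lambda>t. if t \<in> S then v t (f t) else (x(s := v s y)) t)"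
    let ?h = "\<lambda>f. tensor (\<lambda>t. if t \<in> insert s S then v t (f t) else x t)"
    have t: "?t y f \<in> carrier T" if "y \<in> Y s" "f \<in> Pi\<^sub>E S Y" for y f
      using that insert.prems s S v by (intro tensor_closed) (auto simp: PiE_iff)
    have "tensor (\<lambda>t. if t \<in> insert s S then \<Oplus>y\<in>Y t. v t y else x t)
        = tensor (?y(s := \<Oplus>y\<in>Y s. v s y))"
      by (intro arg_cong[of _ _ tensor]) auto
    also have "\<dots> = (\<Oplus>\<^bsub>T\<^esub>y\<in>Y s. tensor (?y(s := v s y)))"
      using y s finY vs by (rule tensor_finsum_slot)
    also have "\<dots> = (\<Oplus>\<^bsub>T\<^esub>y\<in>Y s. \<Oplus>\<^bsub>T\<^esub>f\<in>Pi\<^sub>E S Y. ?t y f)"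
    proof (rule T.finsum_cong'[OF refl])
      fix y' assume y': "y' \<in> Y s"
      have "?y(s := v s y') = (\<lambda>t. if t \<in> S then \<Oplus>y\<in>Y t. v t y else (x(s := v s y')) t)"
        using insert by auto
      moreover have "x(s := v s y') \<in> {1..m} \<rightarrow> carrier A"
        using insert.prems vs y' by (auto simp: Pi_iff)
      ultimately show "tensor (?y(s := v s y')) = (\<Oplus>\<^bsub>T\<^esub>f\<in>Pi\<^sub>E S Y. ?t y' f)"
        using insert.IH[OF S] by presburger
    qed (use t in \<open>auto intro!: T.finsum_closed\<close>)
    also have "\<dots> = (\<Oplus>\<^bsub>T\<^esub>y\<in>Y s. \<Oplus>\<^bsub>T\<^esub>f\<in>Pi\<^sub>E S Y. ?h (f(s := y)))"
    proof -
      have "?t y f = ?h (f(s := y))" for y f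
        using insert.hyps by (intro arg_cong[of _ _ tensor]) auto
      then show ?thesis by presburger
    qed
    also have "\<dots> = (\<Oplus>\<^bsub>T\<^esub>f\<in>Pi\<^sub>E (insert s S) Y. ?h f)"
      using insert.hyps insert.prems fin v
      by (intro T.finsum_PiE_insert[symmetric] tensor_closed) (auto simp: PiE_iff Pi_iff)
    finally show ?case .
  qed simp
  from this[of "{1..m}" "\<lambda>_. \<one>"] have
    "tensor (\<lambda>s. if s \<in> {1..m} then \<Oplus>y\<in>Y s. v s y else \<one>)
      = (\<Oplus>\<^bsub>T\<^esub>f\<in>Pi\<^sub>E {1..m} Y. tensor (\<lambda>s. if s \<in> {1..m} then v s (f s) else \<one>))"
    by simp
  moreover have "tensor (\<lambda>s. if s \<in> {1..m} then \<Oplus>y\<in>Y s. v s y else \<one>) = tensor (\<lambda>s. \<Oplus>y\<in>Y s. v s y)"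
    by (rule tensor_cong) simp
  moreover have "tensor (\<lambda>s. if s \<in> {1..m} then v s (f s) else \<one>) = tensor (\<lambda>s. v s (f s))" for f
    by (rule tensor_cong) simp
  ultimately show ?thesis by simp
qed

lemma tensor_linear_combinations:
  assumes "\<And>s. s \<in> {1..m} \<Longrightarrow> finite (Y s)"
    and v: "\<And>s y. s \<in> {1..m} \<Longrightarrow> y \<in> Y s \<Longrightarrow> v s y \<in> carrier A"
  shows "tensor (\<lambda>s. \<Oplus>y\<in>Y s. c s y \<odot> v s y)
    = (\<Oplus>\<^bsub>T\<^esub>f\<in>Pi\<^sub>E {1..m} Y. (\<Prod>s\<in>{1..m}. c s (f s)) \<odot>\<^bsub>T\<^esub> tensor (\<lambda>s. v s (f s)))"
proof -
  have v': "(\<lambda>s. v s (f s)) \<in> {1..m} \<rightarrow> carrier A" if "f \<in> Pi\<^sub>E {1..m} Y" for f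
    using that v by (auto simp: PiE_iff)
  have "tensor (\<lambda>s. \<Oplus>y\<in>Y s. c s y \<odot> v s y)
      = (\<Oplus>\<^bsub>T\<^esub>f\<in>Pi\<^sub>E {1..m} Y. tensor (\<lambda>s. c s (f s) \<odot> v s (f s)))"
    using assms by (intro tensor_finsum) auto
  also have "\<dots> = (\<Oplus>\<^bsub>T\<^esub>f\<in>Pi\<^sub>E {1..m} Y. (\<Prod>s\<in>{1..m}. c s (f s)) \<odot>\<^bsub>T\<^esub> tensor (\<lambda>s. v s (f s)))"
    using v' by (intro T.finsum_cong') (auto simp: tensor_smult)
  finally show ?thesis .
qed

text \<open>
  Both the sums in the relations of the hypermatrix algebra and the hyperdeterminant run over
  choices made independently at each position of a multi-index, with a weight that is a product over
  the positions.  As every position is read by exactly one tensor factor, such a sum of pure tensors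
  is a pure tensor of sums.
\<close>

lemma tensor_block_sums:
  assumes S: "finite S" and b: "b \<in> S \<rightarrow> {1..m}" and X: "\<And>s. s \<in> S \<Longrightarrow> finite (X s)"
    and v: "\<And>t \<phi>. t \<in> {1..m} \<Longrightarrow> \<phi> \<in> Pi\<^sub>E {s\<in>S. b s = t} X \<Longrightarrow> v t \<phi> \<in> carrier A"
  shows "tensor (\<lambda>t. \<Oplus>\<phi>\<in>Pi\<^sub>E {s\<in>S. b s = t} X. (\<Prod>s | s \<in> S \<and> b s = t. w (\<phi> s)) \<odot> v t \<phi>)
    = (\<Oplus>\<^bsub>T\<^esub>f\<in>Pi\<^sub>E S X. (\<Prod>s\<in>S. w (f s)) \<odot>\<^bsub>T\<^esub> tensor (\<lambda>t. v t (restrict f {s\<in>S. b s = t})))"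
proof -
  let ?B = "\<lambda>t. {s\<in>S. b s = t}"
  let ?r = "\<lambda>f. \<lambda>t\<in>{1..m}. restrict f (?B t)"
  let ?h = "\<lambda>F. (\<Prod>t\<in>{1..m}. \<Prod>s\<in>?B t. w (F t s)) \<odot>\<^bsub>T\<^esub> tensor (\<lambda>t. v t (F t))"
  note bij = bij_betw_PiE_blocks[OF b, of X]
  have h: "?h F \<in> carrier T" if "F \<in> Pi\<^sub>E {1..m} (\<lambda>t. Pi\<^sub>E (?B t) X)" for F
    using PiE_mem[OF that] v by (intro T.smult_closed tensor_closed Pi_I) blast
  have "tensor (\<lambda>t. \<Oplus>\<phi>\<in>Pi\<^sub>E (?B t) X. (\<Prod>s\<in>?B t. w (\<phi> s)) \<odot> v t \<phi>)
      = (\<Oplus>\<^bsub>T\<^esub>F\<in>Pi\<^sub>E {1..m} (\<lambda>t. Pi\<^sub>E (?B t) X). ?h F)"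
    using S X v by (intro tensor_linear_combinations) (auto intro!: finite_PiE)
  also have "\<dots> = (\<Oplus>\<^bsub>T\<^esub>f\<in>Pi\<^sub>E S X. ?h (?r f))"
    unfolding bij_betw_imp_surj_on[OF bij, symmetric]
    using h bij_betw_imp_surj_on[OF bij]
    by (intro T.finsum_reindex bij_betw_imp_inj_on[OF bij]) (simp del: restrict_apply add: Pi_iff)
  also have "\<dots> = (\<Oplus>\<^bsub>T\<^esub>f\<in>Pi\<^sub>E S X. (\<Prod>s\<in>S. w (f s)) \<odot>\<^bsub>T\<^esub> tensor (\<lambda>t. v t (restrict f (?B t))))"
  proof (intro T.finsum_cong'[OF refl] Pi_I)
    fix f assume f: "f \<in> Pi\<^sub>E S X"
    have "(\<Prod>t\<in>{1..m}. \<Prod>s\<in>?B t. w (?r f t s)) = (\<Prod>t\<in>{1..m}. \<Prod>s\<in>?B t. w (f s))"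
      by (intro prod.cong) auto
    also have "\<dots> = (\<Prod>s\<in>S. w (f s))"
      using S b by (intro prod.group) auto
    finally have "(\<Prod>t\<in>{1..m}. \<Prod>s\<in>?B t. w (?r f t s)) = (\<Prod>s\<in>S. w (f s))" .
    moreover have "tensor (\<lambda>t. v t (?r f t)) = tensor (\<lambda>t. v t (restrict f (?B t)))"
      by (rule tensor_cong) simp
    ultimately show "?h (?r f) = (\<Prod>s\<in>S. w (f s)) \<odot>\<^bsub>T\<^esub> tensor (\<lambda>t. v t (restrict f (?B t)))"
      by presburger
    show "(\<Prod>s\<in>S. w (f s)) \<odot>\<^bsub>T\<^esub> tensor (\<lambda>t. v t (restrict f (?B t))) \<in> carrier T"
      using f v by (intro T.smult_closed tensor_closed) (auto simp: restrict_PiE_iff PiE_iff[of f])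
  qed
  finally show ?thesis .
qed

end

section \<open>Inversions of permutations\<close>

lemma transpose_Suc_less:
  "a < b \<Longrightarrow> (a, b) \<noteq> (i, Suc i) \<Longrightarrow> transpose i (Suc i) a < transpose i (Suc i) b"
  by (auto simp: transpose_def)

lemma transpose_Suc_bounds:
  assumes "1 \<le> i" "i < n"
  shows "1 \<le> transpose i (Suc i) a \<longleftrightarrow> 1 \<le> a" "transpose i (Suc i) a \<le> n \<longleftrightarrow> a \<le> n"
  using assms by (auto simp: transpose_def)

lemma permutes_transpose_Suc:
  assumes "\<sigma> permutes {1..n}" "1 \<le> i" "i < n"
  shows "\<sigma> \<circ> transpose i (Suc i) permutes {1..n}"
  using assms by (intro permutes_compose permutes_swap_id) auto

lemma perm_inv_id: "perm_inv n id = 0"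
proof -
  have "{(i, j). 1 \<le> i \<and> i < j \<and> j \<le> n \<and> id i > id j} = {}" by auto
  then show ?thesis unfolding perm_inv_def by (metis card.empty)
qed

text \<open>
  The transposition \<open>(i i+1)\<close> preserves the order of every pair of places except \<open>(i, i+1)\<close>.  It
  therefore carries the old inversions to inversions, and \<open>(i, i+1)\<close> is the only new one.
\<close>

lemma perm_inv_transpose_Suc:
  assumes i: "1 \<le> i" "i < n" and asc: "\<sigma> i < \<sigma> (Suc i)"
  shows "perm_inv n (\<sigma> \<circ> transpose i (Suc i)) = Suc (perm_inv n \<sigma>)"
proof -
  let ?s = "transpose i (Suc i)"
  let ?I = "\<lambda>\<sigma>. {(a, b). 1 \<le> a \<and> a < b \<and> b \<le> n \<and> \<sigma> a > \<sigma> b}"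
  have fin: "finite (?I \<sigma>)" for \<sigma> :: "nat \<Rightarrow> nat"
    by (rule finite_subset[of _ "{1..n} \<times> {1..n}"]) auto
  have "?I (\<sigma> \<circ> ?s) = insert (i, Suc i) (map_prod ?s ?s ` ?I \<sigma>)"
  proof (intro equalityI subsetI)
    fix z assume z: "z \<in> ?I (\<sigma> \<circ> ?s)"
    obtain a b where ab: "z = (a, b)" by fastforce
    show "z \<in> insert (i, Suc i) (map_prod ?s ?s ` ?I \<sigma>)"
    proof (cases "z = (i, Suc i)")
      case False
      then have "(?s a, ?s b) \<in> ?I \<sigma>"
        using z ab transpose_Suc_less[of a b i] by (simp add: transpose_Suc_bounds[OF i])
      then have "map_prod ?s ?s (?s a, ?s b) \<in> map_prod ?s ?s ` ?I \<sigma>"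
        by (rule imageI)
      with ab show ?thesis by simp
    qed simp
  next
    fix z assume "z \<in> insert (i, Suc i) (map_prod ?s ?s ` ?I \<sigma>)"
    then consider "z = (i, Suc i)" | c d where "z = (?s c, ?s d)" "(c, d) \<in> ?I \<sigma>"
      by auto
    then show "z \<in> ?I (\<sigma> \<circ> ?s)"
    proof cases
      case 1
      then show ?thesis using i asc by simp
    next
      case 2
      then have "(c, d) \<noteq> (i, Suc i)" using asc by auto
      then show ?thesis
        using 2 transpose_Suc_less[of c d i] by (simp add: transpose_Suc_bounds[OF i])
    qed
  qed
  moreover have "(i, Suc i) \<notin> map_prod ?s ?s ` ?I \<sigma>"
    by (auto simp: transpose_def split: if_splits)
  moreover have "card (map_prod ?s ?s ` ?I \<sigma>) = card (?I \<sigma>)"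
    by (rule card_image) (auto simp: inj_on_def dest: transpose_eq_imp_eq)
  ultimately show ?thesis
    using fin[of \<sigma>] by (simp add: perm_inv_def)
qed

lemma permutes_no_descent_id:
  assumes \<sigma>: "\<sigma> permutes {1..n}" and asc: "\<And>i. 1 \<le> i \<Longrightarrow> i < n \<Longrightarrow> \<sigma> i < \<sigma> (Suc i)"
  shows "\<sigma> = id"
proof (rule permutes_natset_ge[OF \<sigma>], rule ballI)
  fix i assume "i \<in> {1..n}"
  then have "1 \<le> i" "i \<le> n" by auto
  then show "i \<le> \<sigma> i"
  proof (induction i rule: dec_induct)
    case base
    then show ?case using permutes_in_image[OF \<sigma>, of 1] by simp
  next
    case (step i)
    then show ?case using asc[of i] by simp
  qed
qed

text \<open>
  Bubble sort: a permutation other than the identity has a descent at two adjacent places, and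
  exchanging their values lowers the number of inversions.
\<close>

lemma permutes_ascent_induct [consumes 1, case_names id ascent]:
  assumes "\<sigma> permutes {1..n}" and id: "P id"
    and step: "\<And>\<sigma> i. \<sigma> permutes {1..n} \<Longrightarrow> 1 \<le> i \<Longrightarrow> i < n \<Longrightarrow> \<sigma> i < \<sigma> (Suc i) \<Longrightarrow> P \<sigma>
      \<Longrightarrow> P (\<sigma> \<circ> transpose i (Suc i))"
  shows "P \<sigma>"
  using assms(1)
proof (induction "perm_inv n \<sigma>" arbitrary: \<sigma> rule: less_induct)
  case less
  show ?case
  proof (cases "\<sigma> = id")
    case False
    then obtain i where i: "1 \<le> i" "i < n" "\<not> \<sigma> i < \<sigma> (Suc i)"
      using permutes_no_descent_id[OF less.prems] by blast
    define \<rho> where "\<rho> = \<sigma> \<circ> transpose i (Suc i)"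
    have \<sigma>: "\<sigma> = \<rho> \<circ> transpose i (Suc i)"
      unfolding \<rho>_def comp_assoc by simp
    have \<rho>: "\<rho> permutes {1..n}"
      unfolding \<rho>_def using less.prems i by (intro permutes_transpose_Suc)
    have "\<sigma> i \<noteq> \<sigma> (Suc i)"
      using inj_eq[OF permutes_inj[OF less.prems], of i "Suc i"] by simp
    then have asc: "\<rho> i < \<rho> (Suc i)"
      using i(3) by (simp add: \<rho>_def)
    have "perm_inv n \<rho> < perm_inv n \<sigma>"
      unfolding \<sigma> using perm_inv_transpose_Suc[OF i(1,2) asc] by simp
    then have "P \<rho>" using \<rho> by (rule less.hyps)
    then show ?thesis
      unfolding \<sigma> using \<rho> i asc by (intro step)
  qed (simp add: id)
qed

text \<open>
  The cycle on \<open>{1..N}\<close> after which the value \<open>N\<close> stands at place \<open>N - k\<close>, while the other values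
  keep their order.
\<close>

fun back_cycle :: "nat \<Rightarrow> nat \<Rightarrow> nat \<Rightarrow> nat" where
  "back_cycle N 0 = id"
| "back_cycle N (Suc k) = back_cycle N k \<circ> transpose (N - Suc k) (Suc (N - Suc k))"

text \<open>
  Each transposition in the cycle moves the largest value past a smaller one, which creates exactly
  one inversion.
\<close>

lemma back_cycle_props:
  assumes "k \<le> n"
  shows "back_cycle (Suc n) k permutes {1..Suc n}" (is ?perm)
    and "back_cycle (Suc n) k (Suc n - k) = Suc n" (is ?last)
    and "\<sigma> permutes {1..n} \<Longrightarrow> perm_inv (Suc n) (\<sigma> \<circ> back_cycle (Suc n) k) = perm_inv n \<sigma> + k"
proof -
  have "?perm \<and> ?last \<and> (\<forall>i<Suc n - k. back_cycle (Suc n) k i = i)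
    \<and> (\<forall>\<sigma>. \<sigma> permutes {1..n} \<longrightarrow> perm_inv (Suc n) (\<sigma> \<circ> back_cycle (Suc n) k) = perm_inv n \<sigma> + k)"
    using assms
  proof (induction k)
    case 0
    have "perm_inv (Suc n) \<sigma> = perm_inv n \<sigma>" if \<sigma>: "\<sigma> permutes {1..n}" for \<sigma>
    proof -
      have "\<sigma> (Suc n) = Suc n" using \<sigma> by (simp add: permutes_not_in)
      moreover have "\<sigma> i \<le> n" if "1 \<le> i" "i \<le> n" for i
        using permutes_in_image[OF \<sigma>, of i] that by simp
      ultimately have "{(i, j). 1 \<le> i \<and> i < j \<and> j \<le> Suc n \<and> \<sigma> i > \<sigma> j}
          = {(i, j). 1 \<le> i \<and> i < j \<and> j \<le> n \<and> \<sigma> i > \<sigma> j}"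
        by (auto simp: le_Suc_eq) fastforce
      then show ?thesis by (simp add: perm_inv_def)
    qed
    then have "back_cycle (Suc n) 0 permutes {1..Suc n} \<and> back_cycle (Suc n) 0 (Suc n - 0) = Suc n
      \<and> (\<forall>i<Suc n - 0. back_cycle (Suc n) 0 i = i)
      \<and> (\<forall>\<sigma>. \<sigma> permutes {1..n} \<longrightarrow> perm_inv (Suc n) (\<sigma> \<circ> back_cycle (Suc n) 0) = perm_inv n \<sigma> + 0)"
      by (simp add: permutes_id)
    then show ?case .
  next
    case (Suc k)
    let ?c = "back_cycle (Suc n) k" and ?i = "Suc n - Suc k"
    have i: "1 \<le> ?i" "?i < Suc n" "Suc ?i = Suc n - k" using Suc.prems by auto
    from Suc have IH: "?c permutes {1..Suc n}" "?c (Suc ?i) = Suc n" "\<And>i. i < Suc ?i \<Longrightarrow> ?c i = i"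
      "\<And>\<sigma>. \<sigma> permutes {1..n} \<Longrightarrow> perm_inv (Suc n) (\<sigma> \<circ> ?c) = perm_inv n \<sigma> + k"
      unfolding i(3) by (simp_all only: Suc_leD simp_thms)
    have "perm_inv (Suc n) ((\<sigma> \<circ> ?c) \<circ> transpose ?i (Suc ?i)) = perm_inv n \<sigma> + Suc k"
      if \<sigma>: "\<sigma> permutes {1..n}" for \<sigma>
    proof -
      have "(\<sigma> \<circ> ?c) ?i \<le> n"
        using IH(3)[of ?i] permutes_in_image[OF \<sigma>, of ?i] i by auto
      moreover have "(\<sigma> \<circ> ?c) (Suc ?i) = Suc n"
        using IH(2) \<sigma> by (simp add: permutes_not_in)
      ultimately show ?thesis
        using perm_inv_transpose_Suc[OF i(1,2), of "\<sigma> \<circ> ?c"] IH(4)[OF \<sigma>] by simp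
    qed
    moreover have "(?c \<circ> transpose ?i (Suc ?i)) permutes {1..Suc n}"
      using IH(1) i(1,2) by (rule permutes_transpose_Suc)
    moreover have "(?c \<circ> transpose ?i (Suc ?i)) ?i = Suc n"
      using IH(2) by simp
    moreover have "\<forall>j<?i. (?c \<circ> transpose ?i (Suc ?i)) j = j"
      using IH(3) by (simp add: transpose_def)
    ultimately show ?case
      unfolding back_cycle.simps comp_assoc by blast
  qed
  then show ?perm ?last
    "\<sigma> permutes {1..n} \<Longrightarrow> perm_inv (Suc n) (\<sigma> \<circ> back_cycle (Suc n) k) = perm_inv n \<sigma> + k"
    by auto
qed

lemma bij_betw_back_cycle:
  "bij_betw (\<lambda>(\<sigma>, k). \<sigma> \<circ> back_cycle (Suc n) k)
     ({\<sigma>. \<sigma> permutes {1..n}} \<times> {..n}) {\<sigma>. \<sigma> permutes {1..Suc n}}"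
proof -
  let ?f = "\<lambda>(\<sigma>, k). \<sigma> \<circ> back_cycle (Suc n) k"
  let ?D = "{\<sigma>. \<sigma> permutes {1..n}} \<times> {..n}"
  have inj: "inj_on ?f ?D"
  proof (rule inj_onI)
    fix y z :: "(nat \<Rightarrow> nat) \<times> nat" assume "y \<in> ?D" "z \<in> ?D" "?f y = ?f z"
    then obtain \<sigma> k \<tau> l where yz: "y = (\<sigma>, k)" "z = (\<tau>, l)" and \<sigma>: "\<sigma> permutes {1..n}" and k: "k \<le> n" and \<tau>: "\<tau> permutes {1..n}" and l: "l \<le> n"
      and eq: "\<sigma> \<circ> back_cycle (Suc n) k = \<tau> \<circ> back_cycle (Suc n) l"
      by auto
    have "(\<sigma> \<circ> back_cycle (Suc n) k) (Suc n - k) = Suc n"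
      "(\<tau> \<circ> back_cycle (Suc n) l) (Suc n - l) = Suc n"
      using back_cycle_props(2)[OF k] back_cycle_props(2)[OF l] \<sigma> \<tau> by (simp_all add: permutes_not_in)
    moreover have "inj (\<tau> \<circ> back_cycle (Suc n) l)"
      using permutes_inj[OF \<tau>] permutes_inj[OF back_cycle_props(1)[OF l]] by (rule inj_compose)
    ultimately have "Suc n - k = Suc n - l"
      unfolding eq by (metis injD)
    then have kl: "k = l" using k l by simp
    have "surj (back_cycle (Suc n) k)"
      using permutes_surj[OF back_cycle_props(1)[OF k]] .
    then have "\<sigma> = \<tau>"
      using eq unfolding kl by (metis surj_fun_eq)
    with kl show "y = z" by (simp add: yz)
  qed
  have "?f ` ?D \<subseteq> {\<sigma>. \<sigma> permutes {1..Suc n}}"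
  proof
    fix \<rho> assume "\<rho> \<in> ?f ` ?D"
    then obtain \<sigma> k where \<rho>: "\<rho> = \<sigma> \<circ> back_cycle (Suc n) k" and \<sigma>: "\<sigma> permutes {1..n}"
      and k: "k \<in> {..n}" by auto
    have "\<sigma> permutes {1..Suc n}" using \<sigma> by (rule permutes_subset) auto
    then show "\<rho> \<in> {\<sigma>. \<sigma> permutes {1..Suc n}}"
      unfolding \<rho> using back_cycle_props(1)[of k n] k by (simp add: permutes_compose)
  qed
  moreover have "card (?f ` ?D) = card {\<sigma>. \<sigma> permutes {1..Suc n}}"
    unfolding card_image[OF inj] card_cartesian_product
    by (subst (1 2) card_permutations[OF refl]) auto
  ultimately have "?f ` ?D = {\<sigma>. \<sigma> permutes {1..Suc n}}"
    by (intro card_subset_eq finite_permutations) auto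
  with inj show ?thesis by (simp add: bij_betw_def)
qed

text \<open>
  A permutation of \<open>{1..n+1}\<close> is determined by the place of its largest value and by the arrangement
  of the other values, and the two contributions to the number of inversions add up.  So the
  generating function acquires the factor \<open>[n+1]\<^sub>p = 1 + p + \<dots> + p\<^sup>n\<close>.
\<close>

theorem sum_perm_inv_eq_qfact:
  fixes p :: "'a::comm_semiring_1"
  shows "(\<Sum>\<sigma> | \<sigma> permutes {1..n}. p ^ perm_inv n \<sigma>) = qfact p n"
proof (induction n)
  case 0
  show ?case by (simp add: qfact_def perm_inv_id[unfolded id_def])
next
  case (Suc n)
  have "(\<Sum>\<sigma> | \<sigma> permutes {1..Suc n}. p ^ perm_inv (Suc n) \<sigma>)
      = (\<Sum>(\<sigma>, k)\<in>{\<sigma>. \<sigma> permutes {1..n}} \<times> {..n}. p ^ perm_inv (Suc n) (\<sigma> \<circ> back_cycle (Suc n) k))"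
    unfolding sum.reindex_bij_betw[OF bij_betw_back_cycle, symmetric] by (simp add: case_prod_unfold)
  also have "\<dots> = (\<Sum>(\<sigma>, k)\<in>{\<sigma>. \<sigma> permutes {1..n}} \<times> {..n}. p ^ perm_inv n \<sigma> * p ^ k)"
    by (intro sum.cong) (auto simp: back_cycle_props(3) power_add)
  also have "\<dots> = (\<Sum>\<sigma> | \<sigma> permutes {1..n}. p ^ perm_inv n \<sigma>) * (\<Sum>k\<le>n. p ^ k)"
    by (simp add: sum_product sum.cartesian_product)
  also have "\<dots> = qfact p (Suc n)"
    unfolding Suc by (simp add: qfact_def qint_def lessThan_Suc_atMost)
  finally show ?case .
qed

section \<open>Quantum matrices\<close>

text \<open>
  The determinant identities are formal consequences of the relations of \<open>Mat\<^sub>q(n)\<close>, so they are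
  proved for arbitrary elements \<open>x i k\<close> that satisfy these relations.
\<close>

locale quantum_matrix = assoc_algebra B
  for B :: "('f::field, 'a, 'r) module_scheme" (structure) +
  fixes x :: "nat \<Rightarrow> nat \<Rightarrow> 'a" and q :: 'f and n :: nat
  assumes entry_closed: "i \<in> {1..n} \<Longrightarrow> k \<in> {1..n} \<Longrightarrow> x i k \<in> carrier B"
    and row: "i \<in> {1..n} \<Longrightarrow> k \<in> {1..n} \<Longrightarrow> l \<in> {1..n} \<Longrightarrow> k < l
      \<Longrightarrow> x i k \<otimes> x i l = q \<odot> (x i l \<otimes> x i k)"
    and col: "i \<in> {1..n} \<Longrightarrow> j \<in> {1..n} \<Longrightarrow> k \<in> {1..n} \<Longrightarrow> i < j
      \<Longrightarrow> x i k \<otimes> x j k = q \<odot> (x j k \<otimes> x i k)"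
    and antidiag: "i \<in> {1..n} \<Longrightarrow> j \<in> {1..n} \<Longrightarrow> k \<in> {1..n} \<Longrightarrow> l \<in> {1..n} \<Longrightarrow> i < j \<Longrightarrow> k < l
      \<Longrightarrow> x j k \<otimes> x i l = x i l \<otimes> x j k"
    and diag: "i \<in> {1..n} \<Longrightarrow> j \<in> {1..n} \<Longrightarrow> k \<in> {1..n} \<Longrightarrow> l \<in> {1..n} \<Longrightarrow> i < j \<Longrightarrow> k < l
      \<Longrightarrow> x i k \<otimes> x j l = x j l \<otimes> x i k \<oplus> (q - inverse q) \<odot> (x i l \<otimes> x j k)"
    and q_nonzero: "q \<noteq> 0"
begin

definition row_minor :: "nat \<Rightarrow> nat \<Rightarrow> nat \<Rightarrow> nat \<Rightarrow> 'a" where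
  "row_minor i j k l = x i k \<otimes> x j l \<oplus> (- q) \<odot> (x i l \<otimes> x j k)"

definition col_minor :: "nat \<Rightarrow> nat \<Rightarrow> nat \<Rightarrow> nat \<Rightarrow> 'a" where
  "col_minor i j k l = x k i \<otimes> x l j \<oplus> (- q) \<odot> (x l i \<otimes> x k j)"

lemma row_minor_closed [simp, intro]:
  "i \<in> {1..n} \<Longrightarrow> j \<in> {1..n} \<Longrightarrow> k \<in> {1..n} \<Longrightarrow> l \<in> {1..n} \<Longrightarrow> row_minor i j k l \<in> carrier B"
  unfolding row_minor_def by (intro a_closed smult_closed m_closed entry_closed)

lemma row_minor_same:
  assumes "i \<in> {1..n}" "k \<in> {1..n}" "l \<in> {1..n}" "k < l"
  shows "row_minor i i k l = \<zero>"
  using assms unfolding row_minor_def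
  by (simp add: row entry_closed smult_minus_left r_neg)

lemma col_minor_same:
  assumes "i \<in> {1..n}" "k \<in> {1..n}" "l \<in> {1..n}" "k < l"
  shows "col_minor i i k l = \<zero>"
  using assms unfolding col_minor_def
  by (simp add: col entry_closed smult_minus_left r_neg)

text \<open>
  Eliminating \<open>x i k \<otimes> x j l\<close> by the relation \<open>diag\<close> leaves a combination of two products, and the
  coefficients agree because \<open>- q * (q - inverse q - q) = 1\<close>.
\<close>

lemma diag_minor:
  assumes "i \<in> {1..n}" "j \<in> {1..n}" "k \<in> {1..n}" "l \<in> {1..n}" "i < j" "k < l"
  shows "(- q) \<odot> (x i k \<otimes> x j l \<oplus> (- q) \<odot> (x i l \<otimes> x j k))
    = x i l \<otimes> x j k \<oplus> (- q) \<odot> (x j l \<otimes> x i k)"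
proof -
  define u w where "u = x j l \<otimes> x i k" and "w = x i l \<otimes> x j k"
  have uw: "u \<in> carrier B" "w \<in> carrier B"
    using assms by (auto simp: u_def w_def entry_closed)
  have "(- q) \<odot> (x i k \<otimes> x j l \<oplus> (- q) \<odot> w)
      = (- q) \<odot> ((u \<oplus> (q - inverse q) \<odot> w) \<oplus> (- q) \<odot> w)"
    using diag[OF assms] by (simp add: u_def w_def)
  also have "\<dots> = (- q) \<odot> (u \<oplus> ((q - inverse q) + (- q)) \<odot> w)"
    unfolding smult_add_left[OF uw(2)] using uw by (simp add: a_assoc)
  also have "\<dots> = (- q) \<odot> u \<oplus> ((- q) * ((q - inverse q) + (- q))) \<odot> w"
    using uw by (simp add: smult_add_right smult_smult)
  also have "(- q) * ((q - inverse q) + (- q)) = 1"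
    using q_nonzero by (simp add: field_simps)
  finally show ?thesis
    using uw by (simp add: a_comm flip: u_def w_def)
qed

lemma row_minor_swap:
  assumes "i \<in> {1..n}" "j \<in> {1..n}" "k \<in> {1..n}" "l \<in> {1..n}" "i < j" "k < l"
  shows "row_minor j i k l = (- q) \<odot> row_minor i j k l"
  unfolding row_minor_def using diag_minor[OF assms] antidiag[OF assms] by simp

lemma col_minor_swap:
  assumes "i \<in> {1..n}" "j \<in> {1..n}" "k \<in> {1..n}" "l \<in> {1..n}" "i < j" "k < l"
  shows "col_minor j i k l = (- q) \<odot> col_minor i j k l"
  unfolding col_minor_def
  using diag_minor[OF assms(3,4,1,2,6,5)] antidiag[OF assms(3,4,1,2,6,5)] by simp

text \<open>
  The determinant of the matrix whose \<open>i\<close>-th row is row \<open>f i\<close> of \<open>x\<close>.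
\<close>

definition row_det :: "(nat \<Rightarrow> nat) \<Rightarrow> 'a" where
  "row_det f = (\<Oplus>\<tau>\<in>{\<tau>. \<tau> permutes {1..n}}.
     (- q) ^ perm_inv n \<tau> \<odot> list_prod B (map (\<lambda>i. x (f i) (\<tau> i)) [1..<Suc n]))"

lemma word_closed:
  assumes "f \<in> {1..n} \<rightarrow> {1..n}" "\<tau> permutes {1..n}" "set is \<subseteq> {1..n}"
  shows "list_prod B (map (\<lambda>i. x (f i) (\<tau> i)) is) \<in> carrier B"
proof -
  have "x (f i) (\<tau> i) \<in> carrier B" if "i \<in> {1..n}" for i
    using that assms(1) permutes_in_image[OF assms(2), of i] by (intro entry_closed) auto
  with assms(3) show ?thesis by (intro list_prod_closed) auto
qed

lemma row_det_closed:
  assumes "f \<in> {1..n} \<rightarrow> {1..n}"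
  shows "row_det f \<in> carrier B"
  unfolding row_det_def using assms
  by (intro finsum_closed Pi_I smult_closed word_closed) auto

text \<open>
  Laplace expansion along the adjacent rows \<open>i\<close> and \<open>i+1\<close>: the terms of \<open>\<tau>\<close> and of
  \<open>\<tau> \<circ> (i i+1)\<close> differ by a factor \<open>- q\<close> and by the order of two column indices, so together they
  contain a two-by-two minor.
\<close>

lemma row_det_adjacent:
  assumes f: "f \<in> {1..n} \<rightarrow> {1..n}" and i: "1 \<le> i" "i < n"
  defines "ascending \<equiv> {\<tau>. \<tau> permutes {1..n} \<and> \<tau> i < \<tau> (Suc i)}"
  defines "rest \<equiv> \<lambda>\<tau> is. list_prod B (map (\<lambda>i. x (f i) (\<tau> i)) is)"
  shows "row_det f = (\<Oplus>\<tau>\<in>ascending. (- q) ^ perm_inv n \<tau> \<odot>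
    (rest \<tau> [1..<i] \<otimes> (row_minor (f i) (f (Suc i)) (\<tau> i) (\<tau> (Suc i)) \<otimes> rest \<tau> [Suc (Suc i)..<Suc n])))"
proof -
  let ?s = "transpose i (Suc i)"
  let ?w = "\<lambda>\<tau>. list_prod B (map (\<lambda>i. x (f i) (\<tau> i)) [1..<Suc n])"
  let ?c = "\<lambda>\<tau>. (- q) ^ perm_inv n \<tau>"
  let ?g = "\<lambda>\<tau>. \<tau> \<circ> ?s"
  have ij: "i \<in> {1..n}" "Suc i \<in> {1..n}" using i by auto
  have fin: "finite ascending"
    unfolding ascending_def using finite_permutations[of "{1..n}"] by (auto intro: finite_subset)
  have perm: "\<tau> permutes {1..n}" if "\<tau> \<in> ascending" for \<tau>
    using that by (simp add: ascending_def)
  have perm': "?g \<tau> permutes {1..n}" if "\<tau> \<in> ascending" for \<tau>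
    using perm[OF that] i by (intro permutes_transpose_Suc)
  have inj: "inj_on ?g ascending"
    by (rule inj_onI) (metis comp_assoc comp_id transpose_comp_involutory)
  have split: "{\<tau>. \<tau> permutes {1..n}} = ascending \<union> ?g ` ascending"
  proof (intro equalityI subsetI)
    fix \<tau> assume "\<tau> \<in> {\<tau>. \<tau> permutes {1..n}}"
    then have \<tau>: "\<tau> permutes {1..n}" by simp
    have "\<tau> i \<noteq> \<tau> (Suc i)" using inj_eq[OF permutes_inj[OF \<tau>], of i "Suc i"] by simp
    then consider "\<tau> i < \<tau> (Suc i)" | "(?g \<tau>) i < (?g \<tau>) (Suc i)" by fastforce
    then show "\<tau> \<in> ascending \<union> ?g ` ascending"
    proof cases
      case 2
      then have "?g \<tau> \<in> ascending"
        using permutes_transpose_Suc[OF \<tau> i] by (simp add: ascending_def)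
      then have "?g (?g \<tau>) \<in> ?g ` ascending" by (rule imageI)
      then show ?thesis by (simp add: comp_assoc)
    qed (use \<tau> in \<open>simp add: ascending_def\<close>)
  qed (use perm perm' in auto)
  have disjoint: "ascending \<inter> ?g ` ascending = {}"
    by (auto simp: ascending_def)
  have w: "?w \<tau> \<in> carrier B" if "\<tau> permutes {1..n}" for \<tau>
    using f that by (rule word_closed) auto
  have upt: "[1..<Suc n] = [1..<i] @ [i, Suc i] @ [Suc (Suc i)..<Suc n]"
  proof -
    have "[1..<Suc n] = [1..<i] @ [i..<Suc n]"
      using i upt_add_eq_append[of 1 i "Suc n - i"] by simp
    then show ?thesis using i by (simp add: upt_conv_Cons)
  qed
  have rest: "rest \<tau> [1..<i] \<in> carrier B" "rest \<tau> [Suc (Suc i)..<Suc n] \<in> carrier B"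
    if "\<tau> permutes {1..n}" for \<tau>
    unfolding rest_def using f that i by (auto intro!: word_closed simp del: upt_Suc)
  have entry: "x (f k) (\<tau> l) \<in> carrier B" if "\<tau> permutes {1..n}" "k \<in> {1..n}" "l \<in> {1..n}" for \<tau> k l
    using f that permutes_in_image[OF that(1), of l] by (intro entry_closed) auto
  have w_eq: "?w \<tau> = rest \<tau> [1..<i] \<otimes>
      ((x (f i) (\<tau> i) \<otimes> x (f (Suc i)) (\<tau> (Suc i))) \<otimes> rest \<tau> [Suc (Suc i)..<Suc n])"
    if \<tau>: "\<tau> permutes {1..n}" for \<tau>
  proof -
    have entry': "x (f k) (\<tau> k) \<in> carrier B" if "k \<in> {1..n}" for k
      using \<tau> that that by (rule entry)
    then show ?thesis
      unfolding upt rest_def map_append using i entry'[OF ij(1)] entry'[OF ij(2)]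
        rest[OF \<tau>, unfolded rest_def]
      by (subst list_prod_append) (auto simp: m_assoc simp del: upt_Suc)
  qed
  have rest_swap: "rest (?g \<tau>) [1..<i] = rest \<tau> [1..<i]"
    "rest (?g \<tau>) [Suc (Suc i)..<Suc n] = rest \<tau> [Suc (Suc i)..<Suc n]" for \<tau>
    unfolding rest_def by (intro arg_cong[of _ _ "list_prod B"] map_cong; simp add: transpose_def del: upt_Suc)+
  have pair: "?c \<tau> \<odot> ?w \<tau> \<oplus> ?c (?g \<tau>) \<odot> ?w (?g \<tau>) = ?c \<tau> \<odot>
      (rest \<tau> [1..<i] \<otimes> (row_minor (f i) (f (Suc i)) (\<tau> i) (\<tau> (Suc i)) \<otimes> rest \<tau> [Suc (Suc i)..<Suc n]))"
    if \<tau>: "\<tau> \<in> ascending" for \<tau>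
  proof -
    let ?u = "x (f i) (\<tau> i) \<otimes> x (f (Suc i)) (\<tau> (Suc i))"
      and ?v = "x (f i) (\<tau> (Suc i)) \<otimes> x (f (Suc i)) (\<tau> i)"
    note p = perm[OF \<tau>]
    have uv: "?u \<in> carrier B" "?v \<in> carrier B"
      using entry[OF p] ij by auto
    have c: "?c (?g \<tau>) = ?c \<tau> * (- q)"
      using \<tau> i by (simp add: ascending_def perm_inv_transpose_Suc)
    have "?w (?g \<tau>) = rest \<tau> [1..<i] \<otimes> (?v \<otimes> rest \<tau> [Suc (Suc i)..<Suc n])"
      using w_eq[OF perm'[OF \<tau>]] by (simp add: rest_swap del: upt_Suc)
    then show ?thesis
      unfolding c w_eq[OF p] row_minor_def using uv rest[OF p]
      by (simp add: l_distr r_distr smult_add_right smult_mult_left smult_mult_right smult_smult)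
  qed
  have "row_det f = (\<Oplus>\<tau>\<in>ascending. ?c \<tau> \<odot> ?w \<tau>) \<oplus> (\<Oplus>\<tau>\<in>?g ` ascending. ?c \<tau> \<odot> ?w \<tau>)"
    unfolding row_det_def split using fin disjoint w perm perm'
    by (intro finsum_Un_disjoint) (auto simp del: upt_Suc o_apply)
  also have "(\<Oplus>\<tau>\<in>?g ` ascending. ?c \<tau> \<odot> ?w \<tau>) = (\<Oplus>\<tau>\<in>ascending. ?c (?g \<tau>) \<odot> ?w (?g \<tau>))"
    using inj w perm' by (intro finsum_reindex) (auto simp del: upt_Suc o_apply)
  also have "(\<Oplus>\<tau>\<in>ascending. ?c \<tau> \<odot> ?w \<tau>) \<oplus> \<dots>
      = (\<Oplus>\<tau>\<in>ascending. ?c \<tau> \<odot> ?w \<tau> \<oplus> ?c (?g \<tau>) \<odot> ?w (?g \<tau>))"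
    using w perm perm' by (intro finsum_addf[symmetric]) (auto simp del: upt_Suc o_apply)
  also have "\<dots> = (\<Oplus>\<tau>\<in>ascending. ?c \<tau> \<odot>
      (rest \<tau> [1..<i] \<otimes> (row_minor (f i) (f (Suc i)) (\<tau> i) (\<tau> (Suc i)) \<otimes> rest \<tau> [Suc (Suc i)..<Suc n])))"
  proof (intro finsum_cong'[OF refl] Pi_I)
    fix \<tau> assume \<tau>: "\<tau> \<in> ascending"
    show "?c \<tau> \<odot> ?w \<tau> \<oplus> ?c (?g \<tau>) \<odot> ?w (?g \<tau>) = ?c \<tau> \<odot>
      (rest \<tau> [1..<i] \<otimes> (row_minor (f i) (f (Suc i)) (\<tau> i) (\<tau> (Suc i)) \<otimes> rest \<tau> [Suc (Suc i)..<Suc n]))"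
      using \<tau> by (rule pair)
    show "?c \<tau> \<odot> (rest \<tau> [1..<i] \<otimes>
        (row_minor (f i) (f (Suc i)) (\<tau> i) (\<tau> (Suc i)) \<otimes> rest \<tau> [Suc (Suc i)..<Suc n])) \<in> carrier B"
      unfolding pair[OF \<tau>, symmetric] using w perm[OF \<tau>] perm'[OF \<tau>] by (auto simp del: upt_Suc o_apply)
  qed
  finally show ?thesis .
qed

text \<open>
  In the expansion along rows \<open>i\<close> and \<open>i+1\<close> only the minors depend on the order of these two rows.
\<close>

lemma row_det_swap:
  assumes f: "f \<in> {1..n} \<rightarrow> {1..n}" and i: "1 \<le> i" "i < n" and asc: "f i < f (Suc i)"
  shows "row_det (f \<circ> transpose i (Suc i)) = (- q) \<odot> row_det f"
proof -
  let ?s = "transpose i (Suc i)"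
  let ?U = "{\<tau>. \<tau> permutes {1..n} \<and> \<tau> i < \<tau> (Suc i)}"
  let ?r = "\<lambda>f \<tau> is. list_prod B (map (\<lambda>i. x (f i) (\<tau> i)) is)"
  let ?t = "\<lambda>f \<tau>. (- q) ^ perm_inv n \<tau> \<odot> (?r f \<tau> [1..<i] \<otimes>
    (row_minor (f i) (f (Suc i)) (\<tau> i) (\<tau> (Suc i)) \<otimes> ?r f \<tau> [Suc (Suc i)..<Suc n]))"
  have fs: "f \<circ> ?s \<in> {1..n} \<rightarrow> {1..n}"
    using f transpose_Suc_bounds[OF i] by (auto simp: Pi_iff)
  have ij: "i \<in> {1..n}" "Suc i \<in> {1..n}" using i by auto
  have fin: "finite ?U"
    using finite_permutations[of "{1..n}"] by (auto intro: finite_subset)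
  have parts: "?r f \<tau> [1..<i] \<in> carrier B" "?r f \<tau> [Suc (Suc i)..<Suc n] \<in> carrier B"
      "row_minor (f i) (f (Suc i)) (\<tau> i) (\<tau> (Suc i)) \<in> carrier B"
    if "\<tau> \<in> ?U" for \<tau>
    using f that i permutes_in_image[of \<tau> "{1..n}" i] permutes_in_image[of \<tau> "{1..n}" "Suc i"]
    by (auto intro!: word_closed row_minor_closed simp del: upt_Suc simp: Pi_iff)
  have "row_det (f \<circ> ?s) = (\<Oplus>\<tau>\<in>?U. ?t (f \<circ> ?s) \<tau>)"
    using fs i by (rule row_det_adjacent)
  also have "\<dots> = (\<Oplus>\<tau>\<in>?U. (- q) \<odot> ?t f \<tau>)"
  proof (intro finsum_cong'[OF refl] Pi_I)
    fix \<tau> assume \<tau>: "\<tau> \<in> ?U"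
    show "(- q) \<odot> ?t f \<tau> \<in> carrier B"
      using parts[OF \<tau>] by simp
    have rest: "?r (f \<circ> ?s) \<tau> [1..<i] = ?r f \<tau> [1..<i]"
      "?r (f \<circ> ?s) \<tau> [Suc (Suc i)..<Suc n] = ?r f \<tau> [Suc (Suc i)..<Suc n]"
      by (intro arg_cong[of _ _ "list_prod B"] map_cong; simp add: transpose_def del: upt_Suc)+
    have "row_minor (f (Suc i)) (f i) (\<tau> i) (\<tau> (Suc i))
        = (- q) \<odot> row_minor (f i) (f (Suc i)) (\<tau> i) (\<tau> (Suc i))"
      using f ij asc \<tau> permutes_in_image[of \<tau> "{1..n}"] by (intro row_minor_swap) blast+
    then show "?t (f \<circ> ?s) \<tau> = (- q) \<odot> ?t f \<tau>"
      using parts[OF \<tau>] unfolding rest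
      by (simp add: smult_mult_left smult_mult_right smult_smult mult.commute)
  qed
  also have "\<dots> = (- q) \<odot> (\<Oplus>\<tau>\<in>?U. ?t f \<tau>)"
    using fin parts by (intro smult_finsum[symmetric]) auto
  also have "(\<Oplus>\<tau>\<in>?U. ?t f \<tau>) = row_det f"
    using f i by (rule row_det_adjacent[symmetric])
  finally show ?thesis .
qed

lemma row_det_permuted:
  assumes "\<sigma> permutes {1..n}"
  shows "row_det \<sigma> = (- q) ^ perm_inv n \<sigma> \<odot> row_det id"
  using assms
proof (induction rule: permutes_ascent_induct)
  case id
  have "row_det id \<in> carrier B" by (rule row_det_closed) auto
  then have "1 \<odot> row_det id = row_det id" by (rule smult_one)
  then show ?case unfolding perm_inv_id power_0 by (rule sym)
next
  case (ascent \<sigma> i)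
  have "\<sigma> \<in> {1..n} \<rightarrow> {1..n}" using permutes_in_image[OF ascent(1)] by auto
  then have "row_det (\<sigma> \<circ> transpose i (Suc i)) = (- q) \<odot> row_det \<sigma>"
    using ascent(2-4) by (rule row_det_swap)
  moreover have "row_det id \<in> carrier B" by (rule row_det_closed) auto
  ultimately show ?case
    unfolding perm_inv_transpose_Suc[OF ascent(2-4)] ascent.IH by (simp only: smult_smult power_Suc)
qed

text \<open>
  Restoring the order of the rows costs a second factor \<open>(- q)\<^bsup>\<ell>(\<sigma>)\<^esup>\<close>, so the determinant appears
  with the coefficient \<open>\<Sum> q\<^bsup>2\<ell>(\<sigma>)\<^esup>\<close>.
\<close>

theorem double_sum_det:
  "(\<Oplus>\<sigma>\<in>{\<sigma>. \<sigma> permutes {1..n}}. (- q) ^ perm_inv n \<sigma> \<odot> row_det \<sigma>) = qfact (q ^ 2) n \<odot> row_det id"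
proof -
  have closed: "row_det id \<in> carrier B" by (rule row_det_closed) auto
  have sq: "(- q) ^ k * (- q) ^ k = (q ^ 2) ^ k" for k
    by (metis minus_mult_minus power2_eq_square power_mult_distrib)
  have "(\<Oplus>\<sigma>\<in>{\<sigma>. \<sigma> permutes {1..n}}. (- q) ^ perm_inv n \<sigma> \<odot> row_det \<sigma>)
      = (\<Oplus>\<sigma>\<in>{\<sigma>. \<sigma> permutes {1..n}}. (q ^ 2) ^ perm_inv n \<sigma> \<odot> row_det id)"
  proof (intro finsum_cong'[OF refl] Pi_I)
    fix \<sigma> assume "\<sigma> \<in> {\<sigma>. \<sigma> permutes {1..n}}"
    then show "(- q) ^ perm_inv n \<sigma> \<odot> row_det \<sigma> = (q ^ 2) ^ perm_inv n \<sigma> \<odot> row_det id"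
      using row_det_permuted[of \<sigma>] closed by (simp only: mem_Collect_eq smult_smult sq)
  qed (use closed in simp)
  also have "\<dots> = (\<Sum>\<sigma> | \<sigma> permutes {1..n}. (q ^ 2) ^ perm_inv n \<sigma>) \<odot> row_det id"
    using closed by (intro finsum_smult finite_permutations) auto
  finally show ?thesis by (simp add: sum_perm_inv_eq_qfact)
qed

end

section \<open>Tensor powers of quantum matrices\<close>

text \<open>
  The possible pairs \<open>(\<alpha>\<^sub>s, \<beta>\<^sub>s)\<close> at a position with \<open>I\<^sub>s = K\<close>.  A splitting is an independent choice
  of such a pair at every position.
\<close>

definition splits :: "nat set \<Rightarrow> (nat \<times> nat) set" where
  "splits K = {(a, b). {a, b} = K}"

lemma splits_doubleton: "splits {c, d} = {(c, d), (d, c)}"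
  by (auto simp: splits_def doubleton_eq_iff)

lemma bij_betw_splittings:
  "bij_betw (\<lambda>\<gamma>. (\<lambda>s\<in>S. fst (\<gamma> s), \<lambda>s\<in>S. snd (\<gamma> s))) (Pi\<^sub>E S (\<lambda>s. splits (I s))) (splittings S I)"
proof (rule bij_betw_byWitness[where f' = "\<lambda>(\<alpha>, \<beta>). \<lambda>s\<in>S. (\<alpha> s, \<beta> s)"])
  show "\<forall>\<gamma>\<in>Pi\<^sub>E S (\<lambda>s. splits (I s)).
      (\<lambda>(\<alpha>, \<beta>). \<lambda>s\<in>S. (\<alpha> s, \<beta> s)) (\<lambda>s\<in>S. fst (\<gamma> s), \<lambda>s\<in>S. snd (\<gamma> s)) = \<gamma>"
    by (auto simp: fun_eq_iff PiE_iff extensional_def)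
  show "\<forall>z\<in>splittings S I. (\<lambda>s\<in>S. fst ((\<lambda>(\<alpha>, \<beta>). \<lambda>s\<in>S. (\<alpha> s, \<beta> s)) z s),
      \<lambda>s\<in>S. snd ((\<lambda>(\<alpha>, \<beta>). \<lambda>s\<in>S. (\<alpha> s, \<beta> s)) z s)) = z"
    by (auto simp: fun_eq_iff splittings_def extensional_def)
  show "(\<lambda>\<gamma>. (\<lambda>s\<in>S. fst (\<gamma> s), \<lambda>s\<in>S. snd (\<gamma> s))) ` Pi\<^sub>E S (\<lambda>s. splits (I s)) \<subseteq> splittings S I"
    by (rule image_subsetI) (simp add: splittings_def splits_def PiE_iff case_prod_unfold)
  show "(\<lambda>(\<alpha>, \<beta>). \<lambda>s\<in>S. (\<alpha> s, \<beta> s)) ` splittings S I \<subseteq> Pi\<^sub>E S (\<lambda>s. splits (I s))"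
    by (rule image_subsetI) (simp add: splittings_def splits_def case_prod_unfold)
qed

lemma finite_splits: "card K = 2 \<Longrightarrow> finite (splits K)"
  by (auto simp: card_2_iff splits_doubleton)

lemma splits_bounded: "(a, b) \<in> splits K \<Longrightarrow> a \<in> K \<and> b \<in> K"
  by (auto simp: splits_def)

lemma finite_splittings:
  assumes "finite S" "\<And>s. s \<in> S \<Longrightarrow> card (I s) = 2"
  shows "finite (splittings S I)"
  using bij_betw_finite[OF bij_betw_splittings, of S I] assms finite_splits
  by (metis finite_PiE)

lemma splittings_bounded:
  assumes "(\<alpha>, \<beta>) \<in> splittings S I" "s \<in> S"
  shows "\<alpha> s \<in> I s" "\<beta> s \<in> I s"
  using assms by (auto simp: splittings_def)

text \<open>The factor \<open>t\<close> reads the indices at the positions \<open>2t-1\<close> and \<open>2t\<close>.\<close>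

definition factor_of :: "nat \<Rightarrow> nat" where
  "factor_of s = Suc s div 2"

lemma factor_of_bounds: "factor_of \<in> {1..2 * m} \<rightarrow> {1..m}"
  by (auto simp: factor_of_def)

lemma factor_positions:
  assumes "t \<in> {1..m}"
  shows "{s \<in> {1..2 * m}. factor_of s = t} = {2 * t - 1, 2 * t}"
proof -
  have "s = 2 * t - 1 \<or> s = 2 * t" if "Suc s div 2 = t" "1 \<le> s" for s
    using that by presburger
  then show ?thesis using assms by (auto simp: factor_of_def)
qed

lemma splitting_index:
  assumes I: "\<And>s. s \<in> {1..M} - {k} \<Longrightarrow> I s \<subseteq> {1..n} \<and> card (I s) = 2" and k: "k \<in> {1..M}"
    and z: "(\<alpha>, \<beta>) \<in> splittings ({1..M} - {k}) I" and ij: "i \<in> {1..n}" "j \<in> {1..n}"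
  shows "\<alpha>(k := i) \<in> hyper_indices M n" "\<beta>(k := j) \<in> hyper_indices M n"
proof -
  have "\<alpha> s \<in> {1..n}" "\<beta> s \<in> {1..n}" if "s \<in> {1..M} - {k}" for s
    using splittings_bounded[OF z that] I[OF that] by auto
  moreover have "\<alpha> \<in> extensional ({1..M} - {k})" "\<beta> \<in> extensional ({1..M} - {k})"
    using z by (auto simp: splittings_def)
  ultimately show "\<alpha>(k := i) \<in> hyper_indices M n" "\<beta>(k := j) \<in> hyper_indices M n"
    using ij k unfolding hyper_indices_def PiE_iff extensional_def
    by (auto simp del: atLeastAtMost_iff)
qed

lemma keys_split_sum:
  assumes "\<And>s. s \<in> {1..M} - {k} \<Longrightarrow> I s \<subseteq> {1..n} \<and> card (I s) = 2" and "k \<in> {1..M}"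
    and "i \<in> {1..n}" "j \<in> {1..n}"
  shows "Poly_Mapping.keys (split_sum q M k I i j) \<subseteq> lists (hyper_indices M n)"
  unfolding split_sum_def case_prod_unfold
  using splitting_index[OF assms(1,2) _ assms(3,4)]
  by (intro order_trans[OF Poly_Mapping.keys_sum] UN_least) auto

locale quantum_matrix_tensor = quantum_matrix B x q n
  for B :: "('f::field, 'a, 'r) module_scheme" (structure) and x q n + fixes m :: nat
begin

sublocale tensor_power_algebra B m ..

definition hyper_image :: "(nat \<Rightarrow> nat) \<Rightarrow> ((nat \<Rightarrow> 'a) \<Rightarrow>\<^sub>0 'f) set" where
  "hyper_image i = tensor (\<lambda>t. x (i (2 * t - 1)) (i (2 * t)))"

lemma hyper_index_bounds:
  assumes "i \<in> hyper_indices (2 * m) n" "t \<in> {1..m}"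
  shows "i (2 * t - 1) \<in> {1..n}" "i (2 * t) \<in> {1..n}"
proof -
  have "2 * t - 1 \<in> {1..2 * m}" "2 * t \<in> {1..2 * m}" using assms(2) by auto
  then show "i (2 * t - 1) \<in> {1..n}" "i (2 * t) \<in> {1..n}"
    using assms(1) unfolding hyper_indices_def by (auto dest: PiE_mem simp del: atLeastAtMost_iff)
qed

lemma hyper_image_entries:
  assumes "i \<in> hyper_indices (2 * m) n"
  shows "(\<lambda>t. x (i (2 * t - 1)) (i (2 * t))) \<in> {1..m} \<rightarrow> carrier B"
  using hyper_index_bounds[OF assms] by (intro Pi_I entry_closed)

lemma hyper_image_closed: "i \<in> hyper_indices (2 * m) n \<Longrightarrow> hyper_image i \<in> carrier T"
  unfolding hyper_image_def by (intro tensor_closed hyper_image_entries)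

text \<open>
  What the factor \<open>t\<close> sees of one term of a splitting sum, where \<open>\<phi>\<close> splits the positions of this
  factor.  The update at \<open>k\<close> has an effect only in the factor that reads the direction \<open>k\<close>.
\<close>

definition local_term :: "nat \<Rightarrow> nat \<Rightarrow> nat \<Rightarrow> nat \<Rightarrow> (nat \<Rightarrow> nat \<times> nat) \<Rightarrow> 'a" where
  "local_term k i j t \<phi> =
     (let \<alpha> = (fst \<circ> \<phi>)(k := i); \<beta> = (snd \<circ> \<phi>)(k := j)
      in x (\<alpha> (2 * t - 1)) (\<alpha> (2 * t)) \<otimes> x (\<beta> (2 * t - 1)) (\<beta> (2 * t)))"

abbreviation positions :: "nat \<Rightarrow> nat \<Rightarrow> nat set" where
  "positions k t \<equiv> {s \<in> {1..2 * m} - {k}. factor_of s = t}"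

abbreviation sign :: "nat \<times> nat \<Rightarrow> 'f" where
  "sign p \<equiv> (if fst p > snd p then - q else 1)"

text \<open>
  The image of a splitting sum is the pure tensor of these elements, and all its dependence on \<open>i\<close>
  and \<open>j\<close> sits in the factor that reads the direction \<open>k\<close>.
\<close>

definition local_sum :: "nat \<Rightarrow> (nat \<Rightarrow> nat set) \<Rightarrow> nat \<Rightarrow> nat \<Rightarrow> nat \<Rightarrow> 'a" where
  "local_sum k I i j t =
     (\<Oplus>\<phi>\<in>Pi\<^sub>E (positions k t) (\<lambda>s. splits (I s)).
        (\<Prod>s\<in>positions k t. sign (\<phi> s)) \<odot> local_term k i j t \<phi>)"

context
  fixes k :: nat and I :: "nat \<Rightarrow> nat set"
  assumes k: "k \<in> {1..2 * m}"
    and I: "\<And>s. s \<in> {1..2 * m} - {k} \<Longrightarrow> I s \<subseteq> {1..n} \<and> card (I s) = 2"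
begin

lemma positions_eq: "t \<in> {1..m} \<Longrightarrow> positions k t = {2 * t - 1, 2 * t} - {k}"
  using factor_positions[of t m] by blast

lemma local_term_closed:
  assumes "t \<in> {1..m}" "\<phi> \<in> Pi\<^sub>E (positions k t) (\<lambda>s. splits (I s))" "i \<in> {1..n}" "j \<in> {1..n}"
  shows "local_term k i j t \<phi> \<in> carrier B"
proof -
  have "fst (\<phi> s) \<in> {1..n} \<and> snd (\<phi> s) \<in> {1..n}" if "s \<in> positions k t" for s
    using PiE_mem[OF assms(2) that] I[of s] splits_bounded[of "fst (\<phi> s)" "snd (\<phi> s)" "I s"] that
    by (auto simp del: atLeastAtMost_iff)
  then have bound: "((fst \<circ> \<phi>)(k := i)) s \<in> {1..n} \<and> ((snd \<circ> \<phi>)(k := j)) s \<in> {1..n}"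
    if "s \<in> {2 * t - 1, 2 * t}" for s
    using that assms(3,4) unfolding positions_eq[OF assms(1)]
    by (cases "s = k") (simp_all del: atLeastAtMost_iff)
  show ?thesis
    unfolding local_term_def Let_def using bound by (intro m_closed entry_closed) blast+
qed

lemma local_sum_closed:
  assumes "t \<in> {1..m}" "i \<in> {1..n}" "j \<in> {1..n}"
  shows "local_sum k I i j t \<in> carrier B"
  unfolding local_sum_def using local_term_closed[OF assms(1) _ assms(2,3)]
  by (intro finsum_closed Pi_I smult_closed)

lemma local_sum_other_factor:
  assumes "t \<in> {1..m}" "t \<noteq> factor_of k"
  shows "local_sum k I i j t = local_sum k I i' j' t"
proof -
  have "2 * t - 1 \<noteq> k" "2 * t \<noteq> k"
    using assms by (auto simp: factor_of_def)
  then show ?thesis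
    by (simp add: local_sum_def local_term_def)
qed

text \<open>
  Besides \<open>k\<close>, this factor reads one more position \<open>k'\<close>, whose two splittings give the two terms of a
  minor.  In odd directions the prescribed indices are row indices, in even directions column
  indices.  That \<open>c\<close> and \<open>d\<close> do not depend on \<open>i\<close> and \<open>j\<close> is what allows the minors for \<open>(i, j)\<close> and
  \<open>(j, i)\<close> to be compared.
\<close>

lemma local_sum_own_factor:
  obtains c d where "c \<in> {1..n}" "d \<in> {1..n}" "c < d"
    and "\<And>i j. i \<in> {1..n} \<Longrightarrow> j \<in> {1..n} \<Longrightarrow>
      local_sum k I i j (factor_of k) = (if odd k then row_minor i j c d else col_minor i j c d)"
proof -
  define t where "t = factor_of k"
  (* the factor t reads the positions 2t-1 and 2t; k' is the one of them that is not k *)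
  define k' where "k' = (if odd k then Suc k else k - 1)"
  have t: "t \<in> {1..m}"
    using factor_of_bounds k unfolding t_def by (rule funcset_mem)
  have pos: "2 * t - 1 = (if odd k then k else k')" "2 * t = (if odd k then k' else k)"
    using k by (auto simp: t_def k'_def factor_of_def elim!: oddE evenE)
  have neq: "k' \<noteq> k" using k by (auto simp: k'_def)
  have P: "positions k t = {k'}"
    unfolding positions_eq[OF t] pos(1) unfolding pos(2) using neq by auto
  then have "k' \<in> {1..2 * m} - {k}" by blast
  then obtain c d where cd: "c < d" "I k' = {c, d}"
    using I[of k'] by (metis card_2_iff insert_commute nat_neq_iff)
  with I[OF \<open>k' \<in> _\<close>] have cd_bounds: "c \<in> {1..n}" "d \<in> {1..n}" by auto
  show thesis
  proof (rule that[OF cd_bounds cd(1)])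
    fix i j assume ij: "i \<in> {1..n}" "j \<in> {1..n}"
    let ?\<phi> = "\<lambda>p. (\<lambda>_. undefined)(k' := p)"
    let ?h = "\<lambda>\<phi>. sign (\<phi> k') \<odot> local_term k i j t \<phi>"
    have closed: "?h \<phi> \<in> carrier B" if "\<phi> \<in> Pi\<^sub>E {k'} (\<lambda>s. splits (I s))" for \<phi>
      using local_term_closed[OF t _ ij, of \<phi>] that unfolding P by (intro smult_closed)
    have closed': "?h (?\<phi> p) \<in> carrier B" if "p \<in> {(c, d), (d, c)}" for p
      using that by (intro closed) (auto simp: cd(2) splits_doubleton split: if_splits)
    have "local_sum k I i j t = (\<Oplus>\<phi>\<in>Pi\<^sub>E {k'} (\<lambda>s. splits (I s)). ?h \<phi>)"
      unfolding local_sum_def P by simp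
    also have "\<dots> = (\<Oplus>p\<in>splits (I k'). \<Oplus>\<phi>\<in>Pi\<^sub>E {} (\<lambda>s. splits (I s)). ?h (\<phi>(k' := p)))"
      using closed by (intro finsum_PiE_insert) (auto simp: cd(2) splits_doubleton)
    also have "\<dots> = (\<Oplus>p\<in>{(c, d), (d, c)}. ?h (?\<phi> p))"
      unfolding cd(2) splits_doubleton PiE_empty_domain
    proof (intro finsum_cong'[OF refl] Pi_I)
      fix p assume p: "p \<in> {(c, d), (d, c)}"
      show "?h (?\<phi> p) \<in> carrier B" using p by (rule closed')
      then show "(\<Oplus>\<phi>\<in>{\<lambda>_. undefined}. ?h (\<phi>(k' := p))) = ?h (?\<phi> p)"
        by (simp del: fun_upd_apply)
    qed
    also have "\<dots> = ?h (?\<phi> (c, d)) \<oplus> ?h (?\<phi> (d, c))"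
      using cd(1) closed'[of "(c, d)"] closed'[of "(d, c)"] by (simp del: fun_upd_apply)
    also have "\<dots> = (if odd k then row_minor i j c d else col_minor i j c d)"
      using cd(1) neq ij cd_bounds pos
      by (simp add: local_term_def Let_def row_minor_def col_minor_def entry_closed split: if_splits)
    finally show "local_sum k I i j (factor_of k)
        = (if odd k then row_minor i j c d else col_minor i j c d)"
      unfolding t_def .
  qed
qed

text \<open>
  Splittings are rewritten as choice functions on the positions, for which sign and product of
  generators both factor over the tensor factors.
\<close>

lemma word_ext_split_sum:
  assumes i: "i \<in> {1..n}" and j: "j \<in> {1..n}"
  shows "word_ext T hyper_image (split_sum q (2 * m) k I i j) = tensor (local_sum k I i j)"
proof -
  let ?S = "{1..2 * m} - {k}"
  let ?X = "\<lambda>s. splits (I s)"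
  let ?\<alpha> = "\<lambda>\<gamma>. (\<lambda>s\<in>?S. fst (\<gamma> s))(k := i)" and ?\<beta> = "\<lambda>\<gamma>. (\<lambda>s\<in>?S. snd (\<gamma> s))(k := j)"
  let ?g = "\<lambda>\<alpha> \<beta>. (- q) ^ index_inv ?S \<alpha> \<beta>
      \<odot>\<^bsub>T\<^esub> (hyper_image (\<alpha>(k := i)) \<otimes>\<^bsub>T\<^esub> hyper_image (\<beta>(k := j)))"
  have index: "\<alpha>(k := i) \<in> hyper_indices (2 * m) n" "\<beta>(k := j) \<in> hyper_indices (2 * m) n"
    if "(\<alpha>, \<beta>) \<in> splittings ?S I" for \<alpha> \<beta>
    using splitting_index[OF I k that i j] by blast+
  have fin: "finite (splittings ?S I)"
    using I by (intro finite_splittings) auto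
  have "word_ext T hyper_image (split_sum q (2 * m) k I i j)
      = (\<Oplus>\<^bsub>T\<^esub>z\<in>splittings ?S I. ?g (fst z) (snd z))"
  proof -
    have closed: "hyper_image (\<alpha>(k := i)) \<in> carrier T" "hyper_image (\<beta>(k := j)) \<in> carrier T"
      if "(\<alpha>, \<beta>) \<in> splittings ?S I" for \<alpha> \<beta>
      using index[OF that] hyper_image_closed by auto
    have "word_ext T hyper_image (split_sum q (2 * m) k I i j)
        = (\<Oplus>\<^bsub>T\<^esub>z\<in>splittings ?S I. (- q) ^ index_inv ?S (fst z) (snd z)
            \<odot>\<^bsub>T\<^esub> list_prod T (map hyper_image [(fst z)(k := i), (snd z)(k := j)]))"
      unfolding split_sum_def case_prod_unfold using fin closed
      by (intro T.linear_ext_sum) auto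
    also have "\<dots> = (\<Oplus>\<^bsub>T\<^esub>z\<in>splittings ?S I. ?g (fst z) (snd z))"
      using closed by (intro T.finsum_cong') auto
    finally show ?thesis .
  qed
  also have "\<dots> = (\<Oplus>\<^bsub>T\<^esub>\<gamma>\<in>Pi\<^sub>E ?S ?X. ?g (\<lambda>s\<in>?S. fst (\<gamma> s)) (\<lambda>s\<in>?S. snd (\<gamma> s)))"
    unfolding bij_betw_imp_surj_on[OF bij_betw_splittings, symmetric]
    using index hyper_image_closed
    by (subst T.finsum_reindex[OF _ bij_betw_imp_inj_on[OF bij_betw_splittings]])
       (auto simp: bij_betw_imp_surj_on[OF bij_betw_splittings])
  also have "\<dots> = (\<Oplus>\<^bsub>T\<^esub>\<gamma>\<in>Pi\<^sub>E ?S ?X. (\<Prod>s\<in>?S. sign (\<gamma> s))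
      \<odot>\<^bsub>T\<^esub> tensor (\<lambda>t. local_term k i j t (restrict \<gamma> (positions k t))))"
  proof (intro T.finsum_cong'[OF refl] Pi_I)
    fix \<gamma> assume \<gamma>: "\<gamma> \<in> Pi\<^sub>E ?S ?X"
    have local: "local_term k i j t (restrict \<gamma> (positions k t)) \<in> carrier B" if "t \<in> {1..m}" for t
      using \<gamma> that i j by (intro local_term_closed) (auto simp: PiE_iff restrict_PiE_iff)
    then show "(\<Prod>s\<in>?S. sign (\<gamma> s))
        \<odot>\<^bsub>T\<^esub> tensor (\<lambda>t. local_term k i j t (restrict \<gamma> (positions k t))) \<in> carrier T"
      by (intro T.smult_closed tensor_closed Pi_I)
    have "(\<Prod>s\<in>?S. sign (\<gamma> s)) = (- q) ^ card {s \<in> ?S. fst (\<gamma> s) > snd (\<gamma> s)}"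
      by (simp add: prod.If_cases Int_def)
    also have "{s \<in> ?S. fst (\<gamma> s) > snd (\<gamma> s)}
        = {s \<in> ?S. (\<lambda>s\<in>?S. fst (\<gamma> s)) s > (\<lambda>s\<in>?S. snd (\<gamma> s)) s}"
      by auto
    finally have sign: "(- q) ^ index_inv ?S (\<lambda>s\<in>?S. fst (\<gamma> s)) (\<lambda>s\<in>?S. snd (\<gamma> s))
        = (\<Prod>s\<in>?S. sign (\<gamma> s))"
      unfolding index_inv_def by (rule sym)
    have split: "(\<lambda>s\<in>?S. fst (\<gamma> s), \<lambda>s\<in>?S. snd (\<gamma> s)) \<in> splittings ?S I"
      using bij_betw_apply[OF bij_betw_splittings \<gamma>] .
    have "hyper_image (?\<alpha> \<gamma>) \<otimes>\<^bsub>T\<^esub> hyper_image (?\<beta> \<gamma>)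
        = tensor (\<lambda>t. x (?\<alpha> \<gamma> (2 * t - 1)) (?\<alpha> \<gamma> (2 * t)) \<otimes> x (?\<beta> \<gamma> (2 * t - 1)) (?\<beta> \<gamma> (2 * t)))"
      unfolding hyper_image_def using index[OF split] by (intro tensor_mult hyper_image_entries)
    also have "\<dots> = tensor (\<lambda>t. local_term k i j t (restrict \<gamma> (positions k t)))"
    proof (rule tensor_cong)
      fix t assume t: "t \<in> {1..m}"
      have "?\<alpha> \<gamma> s = ((fst \<circ> restrict \<gamma> (positions k t))(k := i)) s"
        "?\<beta> \<gamma> s = ((snd \<circ> restrict \<gamma> (positions k t))(k := j)) s"
        if "s \<in> {2 * t - 1, 2 * t}" for s
        using that t factor_positions[OF t] by auto
      then show "x (?\<alpha> \<gamma> (2 * t - 1)) (?\<alpha> \<gamma> (2 * t)) \<otimes> x (?\<beta> \<gamma> (2 * t - 1)) (?\<beta> \<gamma> (2 * t))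
          = local_term k i j t (restrict \<gamma> (positions k t))"
        unfolding local_term_def Let_def by (simp only: insert_iff simp_thms)
    qed
    finally show "?g (\<lambda>s\<in>?S. fst (\<gamma> s)) (\<lambda>s\<in>?S. snd (\<gamma> s)) = (\<Prod>s\<in>?S. sign (\<gamma> s))
        \<odot>\<^bsub>T\<^esub> tensor (\<lambda>t. local_term k i j t (restrict \<gamma> (positions k t)))"
      unfolding sign by (rule arg_cong)
  qed
  also have "\<dots> = tensor (local_sum k I i j)"
    unfolding local_sum_def
    using I factor_of_bounds[of m] i j
    by (intro tensor_block_sums[symmetric] local_term_closed) (auto simp: finite_splits)
  finally show ?thesis .
qed

lemma word_ext_split_sum_same:
  assumes i: "i \<in> {1..n}"
  shows "word_ext T hyper_image (split_sum q (2 * m) k I i i) = \<zero>\<^bsub>T\<^esub>"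
proof -
  obtain c d where cd: "c \<in> {1..n}" "d \<in> {1..n}" "c < d"
    and own: "local_sum k I i i (factor_of k) = (if odd k then row_minor i i c d else col_minor i i c d)"
    using local_sum_own_factor i by metis
  have "local_sum k I i i (factor_of k) = \<zero>"
    unfolding own using i cd by (simp add: row_minor_same col_minor_same)
  then show ?thesis
    unfolding word_ext_split_sum[OF i i]
    using local_sum_closed i funcset_mem[OF factor_of_bounds k]
    by (intro tensor_zero_slot[of _ "factor_of k"]) auto
qed

lemma word_ext_split_sum_swap:
  assumes i: "i \<in> {1..n}" and j: "j \<in> {1..n}" and ij: "i < j"
  shows "word_ext T hyper_image (split_sum q (2 * m) k I j i)
    = (- q) \<odot>\<^bsub>T\<^esub> word_ext T hyper_image (split_sum q (2 * m) k I i j)"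
proof -
  let ?t = "factor_of k"
  obtain c d where cd: "c \<in> {1..n}" "d \<in> {1..n}" "c < d"
    and own: "\<And>i j. i \<in> {1..n} \<Longrightarrow> j \<in> {1..n} \<Longrightarrow>
      local_sum k I i j ?t = (if odd k then row_minor i j c d else col_minor i j c d)"
    using local_sum_own_factor by metis
  have t: "?t \<in> {1..m}" using factor_of_bounds k by (rule funcset_mem)
  have closed: "local_sum k I i j \<in> {1..m} \<rightarrow> carrier B"
    using local_sum_closed i j by blast
  have "local_sum k I j i ?t = (- q) \<odot> local_sum k I i j ?t"
    unfolding own[OF i j] own[OF j i] using i j ij cd by (simp add: row_minor_swap col_minor_swap)
  then have "tensor (local_sum k I j i)
      = tensor ((local_sum k I i j)(?t := (- q) \<odot> local_sum k I i j ?t))"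
    using local_sum_other_factor[of _ j i i j] by (intro tensor_cong) auto
  also have "\<dots> = (- q) \<odot>\<^bsub>T\<^esub> tensor (local_sum k I i j)"
    using tensor_smult_slot[OF closed t local_sum_closed[OF t i j]] by simp
  finally show ?thesis
    unfolding word_ext_split_sum[OF i j] word_ext_split_sum[OF j i] .
qed

end
lemma word_ext_hyper_relator:
  assumes "r \<in> hyper_relators q (2 * m) n"
  shows "word_ext T hyper_image r = \<zero>\<^bsub>T\<^esub>"
proof -
  from assms consider
    (same) k I i where "r = split_sum q (2 * m) k I i i" "k \<in> {1..2 * m}" "i \<in> {1..n}"
      "\<forall>s\<in>{1..2 * m} - {k}. I s \<subseteq> {1..n} \<and> card (I s) = 2"
  | (swap) k I i j where
      "r = split_sum q (2 * m) k I j i - Poly_Mapping.map ((*) (- q)) (split_sum q (2 * m) k I i j)"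
      "k \<in> {1..2 * m}" "i \<in> {1..n}" "j \<in> {1..n}" "i < j"
      "\<forall>s\<in>{1..2 * m} - {k}. I s \<subseteq> {1..n} \<and> card (I s) = 2"
    unfolding hyper_relators_def by blast
  then show ?thesis
  proof cases
    case same
    then show ?thesis using word_ext_split_sum_same[of k I i] by blast
  next
    case swap
    let ?C = "lists (hyper_indices (2 * m) n)"
    let ?g = "\<lambda>w. list_prod T (map hyper_image w)"
    have g: "?g \<in> ?C \<rightarrow> carrier T"
      using hyper_image_closed by (intro Pi_I T.list_prod_closed) auto
    have keys: "Poly_Mapping.keys (split_sum q (2 * m) k I i j) \<subseteq> ?C" if "i \<in> {1..n}" "j \<in> {1..n}" for i j
      using swap that by (intro keys_split_sum) auto
    let ?u = "split_sum q (2 * m) k I j i" and ?v = "split_sum q (2 * m) k I i j"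
    have "Poly_Mapping.keys (Poly_Mapping.map ((*) (- q)) ?v) \<subseteq> ?C"
      using keys_scale keys[OF swap(3,4)] by (rule order_trans)
    then have "word_ext T hyper_image r
        = word_ext T hyper_image ?u \<ominus>\<^bsub>T\<^esub> word_ext T hyper_image (Poly_Mapping.map ((*) (- q)) ?v)"
      unfolding swap(1) using g keys[OF swap(4,3)] by (intro T.linear_ext_diff) blast
    also have "word_ext T hyper_image (Poly_Mapping.map ((*) (- q)) ?v) = word_ext T hyper_image ?u"
      using word_ext_split_sum_swap[of k I i j] swap T.linear_ext_scale[OF g keys[OF swap(3,4)]] by simp
    also have "word_ext T hyper_image ?u \<ominus>\<^bsub>T\<^esub> word_ext T hyper_image ?u = \<zero>\<^bsub>T\<^esub>"
      unfolding a_minus_def using g keys[OF swap(4,3)] by (intro T.r_neg T.linear_ext_closed) blast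
    finally show ?thesis .
  qed
qed

text \<open>
  The factor \<open>t\<close> reads the permutations \<open>\<tau>\<^bsub>2t-1\<^esub>\<close> of the rows and \<open>\<tau>\<^bsub>2t\<^esub>\<close> of the columns, so each
  factor contributes one double sum over row and column permutations.
\<close>

theorem tensor_double_sum_det:
  "(\<Oplus>\<^bsub>T\<^esub>\<tau>\<in>({1..2 * m} \<rightarrow>\<^sub>E {\<sigma>. \<sigma> permutes {1..n}}).
      (- q) ^ (\<Sum>s=1..2 * m. perm_inv n (\<tau> s)) \<odot>\<^bsub>T\<^esub>
        list_prod T (map (\<lambda>i. hyper_image (\<lambda>s\<in>{1..2 * m}. \<tau> s i)) [1..<Suc n]))
    = qfact (q ^ 2) n ^ m \<odot>\<^bsub>T\<^esub> tensor (\<lambda>_. row_det id)"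
proof -
  let ?S = "{1..2 * m}" and ?P = "{\<sigma>. \<sigma> permutes {1..n}}"
  let ?B = "\<lambda>t. {s \<in> ?S. factor_of s = t}"
  let ?w = "\<lambda>\<sigma>. (- q) ^ perm_inv n \<sigma>"
  let ?v = "\<lambda>t \<phi>. list_prod B (map (\<lambda>i. x (\<phi> (2 * t - 1) i) (\<phi> (2 * t) i)) [1..<Suc n])"
  have finP: "finite ?P" by (intro finite_permutations) simp
  have word: "list_prod B (map (\<lambda>i. x (\<sigma> i) (\<tau> i)) [1..<Suc n]) \<in> carrier B"
    if "\<sigma> \<in> ?P" "\<tau> \<in> ?P" for \<sigma> \<tau>
    using that permutes_in_image[of \<sigma> "{1..n}"] by (intro word_closed) auto
  have positions: "2 * t - 1 \<in> ?B t" "2 * t \<in> ?B t" if "t \<in> {1..m}" for t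
    using factor_positions[OF that] by blast+
  have v: "?v t \<phi> \<in> carrier B" if "t \<in> {1..m}" "\<phi> \<in> ?B t \<rightarrow>\<^sub>E ?P" for t \<phi>
    using PiE_mem[OF that(2) positions(1)[OF that(1)]] PiE_mem[OF that(2) positions(2)[OF that(1)]]
    by (rule word)
  have factor: "(\<Oplus>\<phi>\<in>?B t \<rightarrow>\<^sub>E ?P. (\<Prod>s\<in>?B t. ?w (\<phi> s)) \<odot> ?v t \<phi>) = qfact (q ^ 2) n \<odot> row_det id"
    if t: "t \<in> {1..m}" for t
  proof -
    let ?a = "2 * t - 1" and ?b = "2 * t"
    have ab: "?a \<noteq> ?b" and B: "?B t = {?a, ?b}"
      using t factor_positions[OF t] by auto
    let ?h = "\<lambda>\<phi>. (\<Prod>s\<in>{?a, ?b}. ?w (\<phi> s)) \<odot> ?v t \<phi>"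
    let ?u = "\<lambda>_::nat. undefined :: nat \<Rightarrow> nat"
    have h: "?h \<phi> \<in> carrier B" if "\<phi> \<in> {?a, ?b} \<rightarrow>\<^sub>E ?P" for \<phi>
      using v[OF t] that unfolding B by (intro smult_closed) blast
    have h': "?h (?u(?b := \<tau>, ?a := \<sigma>)) = ?w \<sigma> \<odot> (?w \<tau> \<odot> list_prod B (map (\<lambda>i. x (\<sigma> i) (\<tau> i)) [1..<Suc n]))"
      if "\<sigma> \<in> ?P" "\<tau> \<in> ?P" for \<sigma> \<tau>
      using ab word[OF that] by (simp add: smult_smult del: upt_Suc)
    have "(\<Oplus>\<phi>\<in>{?a, ?b} \<rightarrow>\<^sub>E ?P. ?h \<phi>) = (\<Oplus>\<sigma>\<in>?P. \<Oplus>\<phi>\<in>{?b} \<rightarrow>\<^sub>E ?P. ?h (\<phi>(?a := \<sigma>)))"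
      using ab finP h by (intro finsum_PiE_insert) auto
    also have "\<dots> = (\<Oplus>\<sigma>\<in>?P. ?w \<sigma> \<odot> row_det \<sigma>)"
    proof (intro finsum_cong'[OF refl] Pi_I)
      fix \<sigma> assume \<sigma>: "\<sigma> \<in> ?P"
      then have "\<sigma> \<in> {1..n} \<rightarrow> {1..n}" using permutes_in_image[of \<sigma> "{1..n}"] by auto
      then show "?w \<sigma> \<odot> row_det \<sigma> \<in> carrier B" by (intro smult_closed row_det_closed)
      have upd: "\<phi>(?a := \<sigma>) \<in> {?a, ?b} \<rightarrow>\<^sub>E ?P" if "\<phi> \<in> {?b} \<rightarrow>\<^sub>E ?P" for \<phi>
        using that \<sigma> by (auto simp: PiE_iff extensional_def)
      have upd': "?u(?b := \<tau>, ?a := \<sigma>) \<in> {?a, ?b} \<rightarrow>\<^sub>E ?P" if "\<tau> \<in> ?P" for \<tau>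
        using that \<sigma> by (auto simp: PiE_iff extensional_def)
      have "(\<Oplus>\<phi>\<in>{?b} \<rightarrow>\<^sub>E ?P. ?h (\<phi>(?a := \<sigma>)))
          = (\<Oplus>\<tau>\<in>?P. \<Oplus>\<phi>\<in>{} \<rightarrow>\<^sub>E ?P. ?h (\<phi>(?b := \<tau>, ?a := \<sigma>)))"
        by (rule finsum_PiE_insert[where h = "\<lambda>\<phi>. ?h (\<phi>(?a := \<sigma>))"])
           (simp, simp, rule finP, erule h[OF upd])
      also have "\<dots> = (\<Oplus>\<tau>\<in>?P. ?h (?u(?b := \<tau>, ?a := \<sigma>)))"
        unfolding PiE_empty_domain using h[OF upd']
        by (intro finsum_cong'[OF refl] Pi_I) (simp_all add: smult_smult del: upt_Suc fun_upd_apply)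
      also have "\<dots> = (\<Oplus>\<tau>\<in>?P. ?w \<sigma> \<odot> (?w \<tau> \<odot> list_prod B (map (\<lambda>i. x (\<sigma> i) (\<tau> i)) [1..<Suc n])))"
        using word \<sigma> by (intro finsum_cong' Pi_I smult_closed h') auto
      also have "\<dots> = ?w \<sigma> \<odot> row_det \<sigma>"
        unfolding row_det_def using finP word[OF \<sigma>] by (intro smult_finsum[symmetric] Pi_I smult_closed)
      finally show "(\<Oplus>\<phi>\<in>{?b} \<rightarrow>\<^sub>E ?P. ?h (\<phi>(?a := \<sigma>))) = ?w \<sigma> \<odot> row_det \<sigma>" .
    qed
    also have "\<dots> = qfact (q ^ 2) n \<odot> row_det id"
      by (rule double_sum_det)
    finally show ?thesis unfolding B .
  qed
  have det: "row_det id \<in> carrier B" by (rule row_det_closed) auto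
  have "(\<Oplus>\<^bsub>T\<^esub>\<tau>\<in>(?S \<rightarrow>\<^sub>E ?P). (- q) ^ (\<Sum>s=1..2 * m. perm_inv n (\<tau> s)) \<odot>\<^bsub>T\<^esub>
        list_prod T (map (\<lambda>i. hyper_image (\<lambda>s\<in>?S. \<tau> s i)) [1..<Suc n]))
      = (\<Oplus>\<^bsub>T\<^esub>\<tau>\<in>(?S \<rightarrow>\<^sub>E ?P). (\<Prod>s\<in>?S. ?w (\<tau> s)) \<odot>\<^bsub>T\<^esub> tensor (\<lambda>t. ?v t (restrict \<tau> (?B t))))"
  proof (intro T.finsum_cong'[OF refl] Pi_I)
    fix \<tau> assume \<tau>: "\<tau> \<in> ?S \<rightarrow>\<^sub>E ?P"
    have v\<tau>: "?v t (restrict \<tau> (?B t)) \<in> carrier B" if "t \<in> {1..m}" for t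
      using that \<tau> by (intro v) (auto simp: restrict_PiE_iff PiE_iff[of \<tau>])
    then show "(\<Prod>s\<in>?S. ?w (\<tau> s)) \<odot>\<^bsub>T\<^esub> tensor (\<lambda>t. ?v t (restrict \<tau> (?B t))) \<in> carrier T"
      by (intro T.smult_closed tensor_closed Pi_I)
    have index: "(\<lambda>s\<in>?S. \<tau> s i) \<in> hyper_indices (2 * m) n" if "i \<in> {1..n}" for i
      using that \<tau> permutes_in_image[of _ "{1..n}" i]
      by (auto simp: hyper_indices_def restrict_PiE_iff PiE_iff simp del: atLeastAtMost_iff)
    have "list_prod T (map (\<lambda>i. hyper_image (\<lambda>s\<in>?S. \<tau> s i)) [1..<Suc n])
        = tensor (\<lambda>t. list_prod B (map (\<lambda>i. x ((\<lambda>s\<in>?S. \<tau> s i) (2 * t - 1)) ((\<lambda>s\<in>?S. \<tau> s i) (2 * t))) [1..<Suc n]))"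
      unfolding hyper_image_def
      by (rule tensor_list_prod) (rule funcset_mem[OF hyper_image_entries[OF index]], auto)
    also have "\<dots> = tensor (\<lambda>t. ?v t (restrict \<tau> (?B t)))"
    proof (rule tensor_cong)
      fix t assume "t \<in> {1..m}"
      then show "list_prod B (map (\<lambda>i. x ((\<lambda>s\<in>?S. \<tau> s i) (2 * t - 1)) ((\<lambda>s\<in>?S. \<tau> s i) (2 * t))) [1..<Suc n])
          = ?v t (restrict \<tau> (?B t))"
        using positions[of t] by (simp del: upt_Suc)
    qed
    finally show "(- q) ^ (\<Sum>s=1..2 * m. perm_inv n (\<tau> s)) \<odot>\<^bsub>T\<^esub>
        list_prod T (map (\<lambda>i. hyper_image (\<lambda>s\<in>?S. \<tau> s i)) [1..<Suc n])
      = (\<Prod>s\<in>?S. ?w (\<tau> s)) \<odot>\<^bsub>T\<^esub> tensor (\<lambda>t. ?v t (restrict \<tau> (?B t)))"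
      by (simp only: power_sum)
  qed
  also have "\<dots> = tensor (\<lambda>t. \<Oplus>\<phi>\<in>?B t \<rightarrow>\<^sub>E ?P. (\<Prod>s\<in>?B t. ?w (\<phi> s)) \<odot> ?v t \<phi>)"
    using finP factor_of_bounds[of m] v by (intro tensor_block_sums[symmetric]) auto
  also have "\<dots> = tensor (\<lambda>t. qfact (q ^ 2) n \<odot> row_det id)"
    using factor by (rule tensor_cong)
  also have "\<dots> = qfact (q ^ 2) n ^ m \<odot>\<^bsub>T\<^esub> tensor (\<lambda>_. row_det id)"
    using det by (subst tensor_smult) auto
  finally show ?thesis .
qed

end

section \<open>The quantum matrix algebra\<close>

context presentation
begin

lemma word_ext_pair:
  assumes "a \<in> X" "b \<in> X"
  shows "word_ext (presented_algebra X R) (pgen X R) (Poly_Mapping.single [a, b] c)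
    = c \<odot>\<^bsub>presented_algebra X R\<^esub> (pgen X R a \<otimes>\<^bsub>presented_algebra X R\<^esub> pgen X R b)"
proof -
  interpret P: assoc_algebra "presented_algebra X R" by (rule assoc_algebra_presented)
  show ?thesis using assms pgen_closed by simp
qed

lemma word_ext_relator_diff:
  assumes "f - g \<in> R" "f \<in> carrier (free_algebra X)" "g \<in> carrier (free_algebra X)"
  shows "word_ext (presented_algebra X R) (pgen X R) f = word_ext (presented_algebra X R) (pgen X R) g"
proof -
  interpret P: assoc_algebra "presented_algebra X R" by (rule assoc_algebra_presented)
  let ?h = "\<lambda>w. list_prod (presented_algebra X R) (map (pgen X R) w)"
  have h: "?h \<in> lists X \<rightarrow> carrier (presented_algebra X R)"
    using pgen_closed by (intro Pi_I P.list_prod_closed) auto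
  have keys: "Poly_Mapping.keys f \<subseteq> lists X" "Poly_Mapping.keys g \<subseteq> lists X"
    using assms(2,3) by auto
  have closed: "word_ext (presented_algebra X R) (pgen X R) f \<in> carrier (presented_algebra X R)"
    "word_ext (presented_algebra X R) (pgen X R) g \<in> carrier (presented_algebra X R)"
    using h keys by (intro P.linear_ext_closed; blast)+
  have "word_ext (presented_algebra X R) (pgen X R) f
      \<ominus>\<^bsub>presented_algebra X R\<^esub> word_ext (presented_algebra X R) (pgen X R) g
      = word_ext (presented_algebra X R) (pgen X R) (f - g)"
    using h keys by (intro P.linear_ext_diff[symmetric]) blast
  also have "\<dots> = \<zero>\<^bsub>presented_algebra X R\<^esub>"
    by (rule relator_vanishes[OF assms(1)])
  finally show ?thesis
    using closed unfolding a_minus_def by (metis P.a_inv_closed P.minus_equality P.minus_minus)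
qed

end

lemma presentation_mat: "presentation ({1..n} \<times> {1..n}) (mat_relators q n)"
proof
  show "mat_relators q n \<subseteq> carrier (free_algebra ({1..n} \<times> {1..n}))"
    unfolding mat_relators_def
    by (auto simp del: atLeastAtMost_iff dest!: subsetD[OF Poly_Mapping.keys_diff] split: if_splits)
qed

lemma quantum_matrix_mat_algebra:
  assumes "q \<noteq> 0"
  shows "quantum_matrix (mat_algebra q n) (mat_gen q n) q n"
proof -
  let ?X = "{1..n} \<times> {1..n}"
  let ?W = "word_ext (mat_algebra q n) (pgen ?X (mat_relators q n))"
  interpret P: presentation ?X "mat_relators q n" by (rule presentation_mat)
  interpret A: assoc_algebra "mat_algebra q n"
    unfolding mat_algebra_def by (rule P.assoc_algebra_presented)
  note pair = P.word_ext_pair[folded mat_algebra_def]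
  note relator = P.word_ext_relator_diff[folded mat_algebra_def]
  have gen: "mat_gen q n i k \<in> carrier (mat_algebra q n)" if "i \<in> {1..n}" "k \<in> {1..n}" for i k
    using P.pgen_closed that unfolding mat_gen_def mat_algebra_def by blast
  have mono: "Poly_Mapping.single [a, b] c \<in> carrier (free_algebra ?X)"
    if "a \<in> ?X" "b \<in> ?X" for a b and c :: 'a
    using that by (simp del: mem_Sigma_iff)
  have gens: "(i, k) \<in> ?X" if "i \<in> {1..n}" "k \<in> {1..n}" for i k
    using that by blast
  show ?thesis
  proof (unfold_locales)
    show "mat_gen q n i k \<in> carrier (mat_algebra q n)" if "i \<in> {1..n}" "k \<in> {1..n}" for i k
      using that by (rule gen)
    show "mat_gen q n i k \<otimes>\<^bsub>mat_algebra q n\<^esub> mat_gen q n i l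
        = q \<odot>\<^bsub>mat_algebra q n\<^esub> (mat_gen q n i l \<otimes>\<^bsub>mat_algebra q n\<^esub> mat_gen q n i k)"
      if "i \<in> {1..n}" "k \<in> {1..n}" "l \<in> {1..n}" "k < l" for i k l
    proof -
      have "Poly_Mapping.single [(i, k), (i, l)] 1 - Poly_Mapping.single [(i, l), (i, k)] q
          \<in> mat_relators q n"
        unfolding mat_relators_def using that by blast
      then have "?W (Poly_Mapping.single [(i, k), (i, l)] 1) = ?W (Poly_Mapping.single [(i, l), (i, k)] q)"
        using that by (intro relator mono gens)
      then show ?thesis
        unfolding pair[OF gens[OF that(1,2)] gens[OF that(1,3)]] pair[OF gens[OF that(1,3)] gens[OF that(1,2)]]
        using that gen by (simp flip: mat_gen_def)
    qed
    show "mat_gen q n i k \<otimes>\<^bsub>mat_algebra q n\<^esub> mat_gen q n j k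
        = q \<odot>\<^bsub>mat_algebra q n\<^esub> (mat_gen q n j k \<otimes>\<^bsub>mat_algebra q n\<^esub> mat_gen q n i k)"
      if "i \<in> {1..n}" "j \<in> {1..n}" "k \<in> {1..n}" "i < j" for i j k
    proof -
      have "Poly_Mapping.single [(i, k), (j, k)] 1 - Poly_Mapping.single [(j, k), (i, k)] q
          \<in> mat_relators q n"
        unfolding mat_relators_def using that by blast
      then have "?W (Poly_Mapping.single [(i, k), (j, k)] 1) = ?W (Poly_Mapping.single [(j, k), (i, k)] q)"
        using that by (intro relator mono gens)
      then show ?thesis
        unfolding pair[OF gens[OF that(1,3)] gens[OF that(2,3)]] pair[OF gens[OF that(2,3)] gens[OF that(1,3)]]
        using that gen by (simp flip: mat_gen_def)
    qed
    fix i j k l assume b: "i \<in> {1..n}" "j \<in> {1..n}" "k \<in> {1..n}" "l \<in> {1..n}" and less: "i < j" "k < l"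
    note pairs = pair[OF gens[OF b(1,3)] gens[OF b(2,4)]] pair[OF gens[OF b(2,4)] gens[OF b(1,3)]]
      pair[OF gens[OF b(1,4)] gens[OF b(2,3)]] pair[OF gens[OF b(2,3)] gens[OF b(1,4)]]
    show "mat_gen q n j k \<otimes>\<^bsub>mat_algebra q n\<^esub> mat_gen q n i l
        = mat_gen q n i l \<otimes>\<^bsub>mat_algebra q n\<^esub> mat_gen q n j k"
    proof -
      have "Poly_Mapping.single [(j, k), (i, l)] 1 - Poly_Mapping.single [(i, l), (j, k)] 1
          \<in> mat_relators q n"
        unfolding mat_relators_def using b less by blast
      then have "?W (Poly_Mapping.single [(j, k), (i, l)] 1) = ?W (Poly_Mapping.single [(i, l), (j, k)] 1)"
        using b by (intro relator mono gens)
      then show ?thesis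
        unfolding pairs using b gen by (simp flip: mat_gen_def)
    qed
    show "mat_gen q n i k \<otimes>\<^bsub>mat_algebra q n\<^esub> mat_gen q n j l
        = mat_gen q n j l \<otimes>\<^bsub>mat_algebra q n\<^esub> mat_gen q n i k \<oplus>\<^bsub>mat_algebra q n\<^esub>
          (q - inverse q) \<odot>\<^bsub>mat_algebra q n\<^esub>
            (mat_gen q n i l \<otimes>\<^bsub>mat_algebra q n\<^esub> mat_gen q n j k)"
    proof -
      let ?u = "Poly_Mapping.single [(j, l), (i, k)] (1 :: 'a)"
        and ?v = "Poly_Mapping.single [(i, l), (j, k)] (q - inverse q)"
      have "Poly_Mapping.single [(i, k), (j, l)] 1 - ?u - ?v \<in> mat_relators q n"
        unfolding mat_relators_def using b less by blast
      then have "Poly_Mapping.single [(i, k), (j, l)] 1 - (?u + ?v) \<in> mat_relators q n"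
        by (simp add: diff_diff_eq)
      moreover have uv: "?u \<in> carrier (free_algebra ?X)" "?v \<in> carrier (free_algebra ?X)"
        using b by (auto intro!: mono gens simp del: monoid_algebra_sel)
      ultimately have "?W (Poly_Mapping.single [(i, k), (j, l)] 1) = ?W (?u + ?v)"
        using P.free.add.m_closed[OF uv] b by (intro relator mono gens) simp_all
      also have "\<dots> = ?W ?u \<oplus>\<^bsub>mat_algebra q n\<^esub> ?W ?v"
        using P.pgen_closed uv unfolding mat_algebra_def[symmetric]
        by (intro A.linear_ext_add Pi_I A.list_prod_closed) (auto split: if_splits)
      finally show ?thesis
        unfolding pairs using b gen by (simp flip: mat_gen_def)
    qed
  qed (rule assms)
qed

lemma mat_qdet_eq_row_det:
  assumes "q \<noteq> 0"
  shows "mat_qdet q n = quantum_matrix.row_det (mat_algebra q n) (mat_gen q n) q n id"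
  unfolding quantum_matrix.row_det_def[OF quantum_matrix_mat_algebra[OF assms]] mat_qdet_def by simp

section \<open>Permuting the directions of a hypermatrix\<close>

lemma free_perm_act_zero [simp]: "free_perm_act \<sigma> 0 = 0"
  by (simp add: free_perm_act_def)

lemma free_perm_act_single [simp]:
  "free_perm_act \<sigma> (Poly_Mapping.single w c)
    = Poly_Mapping.single (map (\<lambda>i. i \<circ> Hilbert_Choice.inv \<sigma>) w) c"
  by (simp add: free_perm_act_def)

lemma free_perm_act_add:
  "free_perm_act \<sigma> (f + g) = free_perm_act \<sigma> f + free_perm_act \<sigma> g"
  unfolding free_perm_act_def by (rule setsum_keys_plus_distrib) (simp_all add: single_add)

lemma free_perm_act_scale:
  "free_perm_act \<sigma> (Poly_Mapping.map ((*) c) f) = Poly_Mapping.map ((*) (c :: 'f::field)) (free_perm_act \<sigma> f)"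
  using subset_UNIV[of "Poly_Mapping.keys f"]
  by (induction f rule: poly_mapping_on_induct) (simp_all add: scale_add free_perm_act_add)

lemma free_perm_act_diff:
  "free_perm_act \<sigma> (f - g) = free_perm_act \<sigma> f - free_perm_act \<sigma> g"
  using free_perm_act_add[of \<sigma> "f - g" g] by simp

lemma free_perm_act_sum:
  "free_perm_act \<sigma> (\<Sum>x\<in>X. f x) = (\<Sum>x\<in>X. free_perm_act \<sigma> (f x))"
  by (induction X rule: infinite_finite_induct) (simp_all add: free_perm_act_add)

lemma hyper_index_permute:
  assumes "\<sigma> permutes {1..M}" "i \<in> hyper_indices M n"
  shows "i \<circ> \<sigma> \<in> hyper_indices M n"
proof -
  have "\<sigma> s \<in> {1..M} \<longleftrightarrow> s \<in> {1..M}" for s using assms(1) by (rule permutes_in_image)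
  then show ?thesis
    using assms(2) unfolding hyper_indices_def PiE_iff extensional_def
    by (simp del: atLeastAtMost_iff)
qed

lemma free_perm_act_alg_hom:
  assumes \<sigma>: "\<sigma> permutes {1..M}"
  shows "free_perm_act \<sigma> \<in> alg_hom (free_algebra (hyper_indices M n)) (free_algebra (hyper_indices M n))"
proof (rule alg_homI)
  let ?A = "free_algebra (hyper_indices M n)"
  fix f g :: "(nat \<Rightarrow> nat) list \<Rightarrow>\<^sub>0 'f::field" and c
  show "free_perm_act \<sigma> (f \<otimes>\<^bsub>?A\<^esub> g) = free_perm_act \<sigma> f \<otimes>\<^bsub>?A\<^esub> free_perm_act \<sigma> g"
    using subset_UNIV[of "Poly_Mapping.keys f"]
  proof (induction f rule: poly_mapping_on_induct)
    case (single u a)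
    show ?case
      using subset_UNIV[of "Poly_Mapping.keys g"]
      by (induction g rule: poly_mapping_on_induct)
         (simp_all add: conv_single conv_add_right free_perm_act_add)
  qed (simp_all add: conv_add_left free_perm_act_add)
  assume "f \<in> carrier ?A"
  then have "Poly_Mapping.keys f \<subseteq> lists (hyper_indices M n)" by simp
  then have "map (\<lambda>i. i \<circ> Hilbert_Choice.inv \<sigma>) w \<in> lists (hyper_indices M n)"
    if "w \<in> Poly_Mapping.keys f" for w
    using that hyper_index_permute[OF permutes_inv[OF \<sigma>]] by fastforce
  then have "Poly_Mapping.keys (free_perm_act \<sigma> f) \<subseteq> lists (hyper_indices M n)"
    unfolding free_perm_act_def
    by (intro order_trans[OF Poly_Mapping.keys_sum] UN_least) simp
  then show "free_perm_act \<sigma> f \<in> carrier ?A" by simp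
qed (simp_all add: free_perm_act_add free_perm_act_scale)

lemma free_perm_act_inverse:
  assumes "\<sigma> permutes {1..M}"
  shows "free_perm_act \<sigma> (free_perm_act (Hilbert_Choice.inv \<sigma>) f) = f"
  using subset_UNIV[of "Poly_Mapping.keys f"]
proof (induction f rule: poly_mapping_on_induct)
  case (single w c)
  have "i \<circ> Hilbert_Choice.inv (Hilbert_Choice.inv \<sigma>) \<circ> Hilbert_Choice.inv \<sigma> = i" for i :: "nat \<Rightarrow> nat"
    using permutes_inv_o[OF assms] permutes_inv_inv[OF assms] by (simp add: comp_assoc)
  then have "map ((\<lambda>i. i \<circ> Hilbert_Choice.inv \<sigma>) \<circ> (\<lambda>i. i \<circ> Hilbert_Choice.inv (Hilbert_Choice.inv \<sigma>))) w = w"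
    by (intro map_idI) simp
  then show ?case by (simp only: free_perm_act_single map_map)
qed (simp_all add: free_perm_act_add)

text \<open>
  Permuting the positions only renames the direction and the positions of a splitting, since the
  number of inversions is counted without regard to the order of the positions.
\<close>

lemma free_perm_act_split_sum:
  assumes \<sigma>: "\<sigma> permutes {1..M}"
  shows "free_perm_act \<sigma> (split_sum q M k I i j)
    = split_sum q M (\<sigma> k) (I \<circ> Hilbert_Choice.inv \<sigma>) i j"
proof -
  let ?\<rho> = "Hilbert_Choice.inv \<sigma>"
  let ?S = "{1..M} - {k}" and ?S' = "{1..M} - {\<sigma> k}"
  have \<rho>: "?\<rho> (\<sigma> s) = s" "\<sigma> (?\<rho> s) = s" for s
    using permutes_inverses[OF \<sigma>] by auto
  have S: "\<sigma> s \<in> ?S' \<longleftrightarrow> s \<in> ?S" "?\<rho> s \<in> ?S \<longleftrightarrow> s \<in> ?S'" for s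
    using permutes_in_image[OF \<sigma>, of s] permutes_in_image[OF permutes_inv[OF \<sigma>], of s] \<rho>
    by (metis Diff_iff singletonD singletonI)+
  have "free_perm_act \<sigma> (split_sum q M k I i j) = (\<Sum>z\<in>splittings ?S I.
      Poly_Mapping.single [(fst z)(k := i) \<circ> ?\<rho>, (snd z)(k := j) \<circ> ?\<rho>]
        ((- q) ^ index_inv ?S (fst z) (snd z)))"
    unfolding split_sum_def case_prod_unfold free_perm_act_sum by simp
  also have "\<dots> = (\<Sum>z\<in>splittings ?S' (I \<circ> ?\<rho>).
      Poly_Mapping.single [(fst z)(\<sigma> k := i), (snd z)(\<sigma> k := j)]
        ((- q) ^ index_inv ?S' (fst z) (snd z)))"
  proof (rule sum.reindex_bij_witness[where i = "\<lambda>z. (fst z \<circ> \<sigma>, snd z \<circ> \<sigma>)"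
        and j = "\<lambda>z. (fst z \<circ> ?\<rho>, snd z \<circ> ?\<rho>)"])
    fix z assume "z \<in> splittings ?S I"
    then show "(fst z \<circ> ?\<rho>, snd z \<circ> ?\<rho>) \<in> splittings ?S' (I \<circ> ?\<rho>)"
      using S(2) unfolding splittings_def extensional_def case_prod_unfold
      by (simp del: Diff_iff)
    have "index_inv ?S' (fst z \<circ> ?\<rho>) (snd z \<circ> ?\<rho>) = index_inv ?S (fst z) (snd z)"
      unfolding index_inv_def
    proof (rule bij_betw_same_card[OF bij_betw_byWitness[where f' = \<sigma>]])
      show "?\<rho> ` {s \<in> ?S'. (fst z \<circ> ?\<rho>) s > (snd z \<circ> ?\<rho>) s} \<subseteq> {s \<in> ?S. fst z s > snd z s}"
        using S(2) by (intro image_subsetI) (simp del: Diff_iff)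
      show "\<sigma> ` {s \<in> ?S. fst z s > snd z s} \<subseteq> {s \<in> ?S'. (fst z \<circ> ?\<rho>) s > (snd z \<circ> ?\<rho>) s}"
        using S(1) \<rho>(1) by (intro image_subsetI) (simp del: Diff_iff)
    qed (simp_all add: \<rho>)
    moreover have "(u \<circ> ?\<rho>)(\<sigma> k := l) = u(k := l) \<circ> ?\<rho>" for u :: "nat \<Rightarrow> nat" and l
      using \<rho> by (auto simp: fun_eq_iff)
    ultimately show "Poly_Mapping.single [(fst (fst z \<circ> ?\<rho>, snd z \<circ> ?\<rho>))(\<sigma> k := i),
          (snd (fst z \<circ> ?\<rho>, snd z \<circ> ?\<rho>))(\<sigma> k := j)]
        ((- q) ^ index_inv ?S' (fst (fst z \<circ> ?\<rho>, snd z \<circ> ?\<rho>)) (snd (fst z \<circ> ?\<rho>, snd z \<circ> ?\<rho>)))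
      = Poly_Mapping.single [(fst z)(k := i) \<circ> ?\<rho>, (snd z)(k := j) \<circ> ?\<rho>]
        ((- q) ^ index_inv ?S (fst z) (snd z))"
      by simp
  next
    fix z assume "z \<in> splittings ?S' (I \<circ> ?\<rho>)"
    then show "(fst z \<circ> \<sigma>, snd z \<circ> \<sigma>) \<in> splittings ?S I"
      using S(1) \<rho>(1) unfolding splittings_def extensional_def case_prod_unfold
      by (simp del: Diff_iff)
  qed (simp_all add: comp_assoc permutes_inv_o[OF \<sigma>])
  also have "\<dots> = split_sum q M (\<sigma> k) (I \<circ> ?\<rho>) i j"
    by (simp add: split_sum_def case_prod_unfold)
  finally show ?thesis .
qed

lemma free_perm_act_relators:
  assumes \<sigma>: "\<sigma> permutes {1..M}" and r: "r \<in> hyper_relators q M n"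
  shows "free_perm_act \<sigma> r \<in> hyper_relators q M n"
proof -
  let ?\<rho> = "Hilbert_Choice.inv \<sigma>"
  have k': "\<sigma> k \<in> {1..M}" if "k \<in> {1..M}" for k
    using permutes_in_image[OF \<sigma>, of k] that by simp
  have I': "\<forall>s\<in>{1..M} - {\<sigma> k}. (I \<circ> ?\<rho>) s \<subseteq> {1..n} \<and> card ((I \<circ> ?\<rho>) s) = 2"
    if "\<forall>s\<in>{1..M} - {k}. I s \<subseteq> {1..n} \<and> card (I s) = 2" for k and I :: "nat \<Rightarrow> nat set"
  proof
    fix s assume "s \<in> {1..M} - {\<sigma> k}"
    then have "?\<rho> s \<in> {1..M} - {k}"
      using permutes_in_image[OF permutes_inv[OF \<sigma>], of s] permutes_inverses[OF \<sigma>] by auto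
    with that show "(I \<circ> ?\<rho>) s \<subseteq> {1..n} \<and> card ((I \<circ> ?\<rho>) s) = 2" by simp
  qed
  from r consider
    (same) k I i where "r = split_sum q M k I i i" "k \<in> {1..M}"
      "\<forall>s\<in>{1..M} - {k}. I s \<subseteq> {1..n} \<and> card (I s) = 2" "i \<in> {1..n}"
  | (swap) k I i j where
      "r = split_sum q M k I j i - Poly_Mapping.map ((*) (- q)) (split_sum q M k I i j)"
      "k \<in> {1..M}" "\<forall>s\<in>{1..M} - {k}. I s \<subseteq> {1..n} \<and> card (I s) = 2"
      "i \<in> {1..n}" "j \<in> {1..n}" "i < j"
    unfolding hyper_relators_def by blast
  then show ?thesis
  proof cases
    case same
    have "free_perm_act \<sigma> r = split_sum q M (\<sigma> k) (I \<circ> ?\<rho>) i i"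
      unfolding same(1) by (rule free_perm_act_split_sum[OF \<sigma>])
    then show ?thesis
      using k'[OF same(2)] I'[OF same(3)] same(4) unfolding hyper_relators_def by blast
  next
    case swap
    have "free_perm_act \<sigma> r = split_sum q M (\<sigma> k) (I \<circ> ?\<rho>) j i
        - Poly_Mapping.map ((*) (- q)) (split_sum q M (\<sigma> k) (I \<circ> ?\<rho>) i j)"
      unfolding swap(1) free_perm_act_diff free_perm_act_scale free_perm_act_split_sum[OF \<sigma>] ..
    then show ?thesis
      using k'[OF swap(2)] I'[OF swap(3)] swap(4-6) unfolding hyper_relators_def by blast
  qed
qed

lemma presentation_hyper: "presentation (hyper_indices M n) (hyper_relators q M n)"
proof
  show "hyper_relators q M n \<subseteq> carrier (free_algebra (hyper_indices M n))"
  proof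
    fix r assume "r \<in> hyper_relators q M n"
    then obtain k I i j c where r:
        "r = split_sum q M k I i j \<or> r = split_sum q M k I j i - Poly_Mapping.map ((*) c) (split_sum q M k I i j)"
      and I: "\<And>s. s \<in> {1..M} - {k} \<Longrightarrow> I s \<subseteq> {1..n} \<and> card (I s) = 2"
      and k: "k \<in> {1..M}" and i: "i \<in> {1..n}" and j: "j \<in> {1..n}"
      unfolding hyper_relators_def by blast
    have keys: "Poly_Mapping.keys (split_sum q M k I i j) \<subseteq> lists (hyper_indices M n)"
      if "i \<in> {1..n}" "j \<in> {1..n}" for i j
      using I k that by (rule keys_split_sum)
    show "r \<in> carrier (free_algebra (hyper_indices M n))"
      using r keys[OF i j] keys[OF j i]
        keys_scale[of c "split_sum q M k I i j"]
        Poly_Mapping.keys_diff[of "split_sum q M k I j i" "Poly_Mapping.map ((*) c) (split_sum q M k I i j)"]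
      unfolding monoid_algebra_sel word_monoid_sel mem_Collect_eq by blast
  qed
qed

lemma hyper_act_eq_image: "hyper_act \<sigma> = (`) (free_perm_act \<sigma>)"
  by (simp add: hyper_act_def fun_eq_iff)

text \<open>
  The action of \<open>\<sigma>\<close> and that of its inverse both map the relators into the relators, hence the ideal
  into itself; so the ideal is mapped onto itself and images of cosets are cosets.
\<close>

lemma hyper_act_alg_hom:
  assumes \<sigma>: "\<sigma> permutes {1..M}"
  shows "hyper_act \<sigma> \<in> alg_hom (hyper_algebra q M n) (hyper_algebra q M n)"
proof -
  interpret P: presentation "hyper_indices M n" "hyper_relators q M n" by (rule presentation_hyper)
  let ?A = "free_algebra (hyper_indices M n)" and ?I = "genideal (free_algebra (hyper_indices M n)) (hyper_relators q M n)"
  have sub: "free_perm_act \<tau> ` ?I \<subseteq> ?I" if \<tau>: "\<tau> permutes {1..M}" for \<tau>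
  proof -
    let ?h = "(+>\<^bsub>?A\<^esub>) ?I \<circ> free_perm_act \<tau>"
    note act = free_perm_act_alg_hom[OF \<tau>, of n]
    have h: "?h \<in> alg_hom ?A (?A AQuot ?I)"
      using act P.free.coset_hom by (rule alg_hom_comp)
    have h0: "?h f = \<zero>\<^bsub>?A AQuot ?I\<^esub> \<longleftrightarrow> free_perm_act \<tau> f \<in> ?I" if "f \<in> carrier ?A" for f
      using P.free.coset_eq_ideal_iff[OF alg_hom_closed[OF act that]] by simp
    have "hyper_relators q M n \<subseteq> ?I"
      using P.relators by (rule P.free.genideal_self)
    then have "?I \<subseteq> {f \<in> carrier ?A. ?h f = \<zero>\<^bsub>?A AQuot ?I\<^esub>}"
      using free_perm_act_relators[OF \<tau>] P.relators h0
      by (intro P.free.genideal_minimal alg_hom_kernel_ideal[OF P.free.assoc_algebra_axioms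
            P.free.quot.assoc_algebra_axioms h]) blast
    then show ?thesis using h0 by blast
  qed
  have "?I \<subseteq> free_perm_act \<sigma> ` ?I"
  proof
    fix f assume "f \<in> ?I"
    then have "free_perm_act (Hilbert_Choice.inv \<sigma>) f \<in> ?I"
      using sub[OF permutes_inv[OF \<sigma>]] by blast
    then have "free_perm_act \<sigma> (free_perm_act (Hilbert_Choice.inv \<sigma>) f) \<in> free_perm_act \<sigma> ` ?I"
      by (rule imageI)
    then show "f \<in> free_perm_act \<sigma> ` ?I"
      by (simp only: free_perm_act_inverse[OF \<sigma>])
  qed
  with sub[OF \<sigma>] have "free_perm_act \<sigma> ` ?I = ?I" by blast
  then show ?thesis
    unfolding hyper_algebra_def presented_algebra_def hyper_act_eq_image
    by (rule P.free.image_alg_hom[OF free_perm_act_alg_hom[OF \<sigma>]])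
qed

section \<open>The homomorphism into the tensor power\<close>

lemma field_embedding_nonzero:
  fixes \<iota> :: "'a::field \<Rightarrow> 'b::field"
  assumes "\<And>x y. \<iota> (x * y) = \<iota> x * \<iota> y" "\<iota> 1 = 1" "a \<noteq> 0"
  shows "\<iota> a \<noteq> 0"
  using assms(1)[of a "inverse a"] assms(2,3) by auto

lemma qfact_embedding:
  fixes \<iota> :: "'a::field \<Rightarrow> 'b::field"
  assumes add: "\<And>x y. \<iota> (x + y) = \<iota> x + \<iota> y" and mult: "\<And>x y. \<iota> (x * y) = \<iota> x * \<iota> y"
    and one: "\<iota> 1 = 1"
  shows "qfact (\<iota> p) r = \<iota> (qfact p r)"
proof -
  have zero: "\<iota> 0 = 0" using add[of 0 0] by (metis add_0 add_cancel_left_left)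
  have power: "\<iota> p ^ k = \<iota> (p ^ k)" for k by (induction k) (simp_all add: mult one)
  have "qint (\<iota> p) k = \<iota> (qint p k)" for k
    unfolding qint_def by (induction k) (simp_all add: add zero power)
  then show ?thesis
    unfolding qfact_def by (induction r) (simp_all add: mult one)
qed

theorem proposition3p2:
  fixes \<iota> :: "complex \<Rightarrow> 'f::field" and q :: complex and m n :: nat
  assumes \<iota>_add: "\<And>x y. \<iota> (x + y) = \<iota> x + \<iota> y"
    and \<iota>_mult: "\<And>x y. \<iota> (x * y) = \<iota> x * \<iota> y"
    and \<iota>_one: "\<iota> 1 = 1"
    and q_nonzero: "q \<noteq> 0"
    and q_generic: "qfact (q ^ 2) n \<noteq> 0"
    and m_pos: "m \<ge> 1" and n_pos: "n \<ge> 1"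
  shows "\<exists>\<phi> \<in> alg_hom (hyper_algebra (\<iota> q) (2 * m) n) (tensor_power (mat_algebra (\<iota> q) n) m).
      (\<forall>i \<in> hyper_indices (2 * m) n.
         \<phi> (hyper_gen (\<iota> q) (2 * m) n i) =
           pure_tensor (mat_algebra (\<iota> q) n) m (\<lambda>s. mat_gen (\<iota> q) n (i (2 * s - 1)) (i (2 * s)))) \<and>
      (\<forall>\<psi> \<in> alg_hom (hyper_algebra (\<iota> q) (2 * m) n) (tensor_power (mat_algebra (\<iota> q) n) m).
         (\<forall>i \<in> hyper_indices (2 * m) n.
            \<psi> (hyper_gen (\<iota> q) (2 * m) n i) = \<phi> (hyper_gen (\<iota> q) (2 * m) n i)) \<longrightarrow>
         (\<forall>x \<in> carrier (hyper_algebra (\<iota> q) (2 * m) n). \<psi> x = \<phi> x)) \<and>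
      \<phi> (hyper_det (\<iota> q) (2 * m) n) =
        qfact ((\<iota> q) ^ 2) n ^ (m - 1) \<odot>\<^bsub>tensor_power (mat_algebra (\<iota> q) n) m\<^esub>
          pure_tensor (mat_algebra (\<iota> q) n) m (\<lambda>s. mat_qdet (\<iota> q) n) \<and>
      (\<forall>\<sigma>. \<sigma> permutes {1..2 * m} \<longrightarrow>
         \<phi> \<circ> hyper_act \<sigma> \<in>
           alg_hom (hyper_algebra (\<iota> q) (2 * m) n) (tensor_power (mat_algebra (\<iota> q) n) m))"
proof -
  let ?q = "\<iota> q" and ?H = "hyper_algebra (\<iota> q) (2 * m) n" and ?A = "mat_algebra (\<iota> q) n"
  let ?T = "tensor_power ?A m"
  have q: "?q \<noteq> 0"
    using \<iota>_mult \<iota>_one q_nonzero by (rule field_embedding_nonzero)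
  have "qfact (?q ^ 2) n = \<iota> (qfact (q ^ 2) n)"
    using qfact_embedding[of \<iota> "q ^ 2" n, OF \<iota>_add \<iota>_mult \<iota>_one] by (simp add: power2_eq_square \<iota>_mult)
  then have generic: "qfact (?q ^ 2) n \<noteq> 0"
    using field_embedding_nonzero[of \<iota>, OF \<iota>_mult \<iota>_one q_generic] by simp
  interpret A: quantum_matrix ?A "mat_gen ?q n" ?q n
    using q by (rule quantum_matrix_mat_algebra)
  interpret A: quantum_matrix_tensor ?A "mat_gen ?q n" ?q n m ..
  interpret H: presentation "hyper_indices (2 * m) n" "hyper_relators ?q (2 * m) n"
    by (rule presentation_hyper)
  have H: "assoc_algebra ?H"
    unfolding hyper_algebra_def by (rule H.assoc_algebra_presented)
  interpret H': assoc_algebra ?H by (rule H)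
  have gen: "hyper_gen ?q (2 * m) n i \<in> carrier ?H" if "i \<in> hyper_indices (2 * m) n" for i
    using H.pgen_closed[OF that] by (simp add: hyper_gen_def hyper_algebra_def)
  have "A.hyper_image \<in> hyper_indices (2 * m) n \<rightarrow> carrier ?T"
    using A.hyper_image_closed by blast
  then obtain \<phi> where \<phi>: "\<phi> \<in> alg_hom ?H ?T"
    and \<phi>_gen: "\<And>i. i \<in> hyper_indices (2 * m) n \<Longrightarrow> \<phi> (hyper_gen ?q (2 * m) n i) = A.hyper_image i"
    using H.presented_hom_exists[OF A.T.assoc_algebra_axioms _ A.word_ext_hyper_relator]
    unfolding hyper_algebra_def hyper_gen_def by metis
  have unique: "\<psi> y = \<phi> y"
    if "\<psi> \<in> alg_hom ?H ?T" "y \<in> carrier ?H"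
      "\<forall>i \<in> hyper_indices (2 * m) n. \<psi> (hyper_gen ?q (2 * m) n i) = \<phi> (hyper_gen ?q (2 * m) n i)" for \<psi> y
    by (rule H.presented_hom_unique[OF A.T.assoc_algebra_axioms that(1)[unfolded hyper_algebra_def]
          \<phi>[unfolded hyper_algebra_def] _ that(2)[unfolded hyper_algebra_def]])
       (use that(3) in \<open>simp add: hyper_gen_def\<close>)
  have det: "\<phi> (hyper_det ?q (2 * m) n)
      = qfact (?q ^ 2) n ^ (m - 1) \<odot>\<^bsub>?T\<^esub> pure_tensor ?A m (\<lambda>s. mat_qdet ?q n)"
  proof -
    let ?P = "{1..2 * m} \<rightarrow>\<^sub>E {\<sigma>. \<sigma> permutes {1..n}}"
    let ?w = "\<lambda>\<tau>. map (\<lambda>i. hyper_gen ?q (2 * m) n (\<lambda>s\<in>{1..2 * m}. \<tau> s i)) [1..<Suc n]"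
    let ?c = "\<lambda>\<tau>. (- ?q) ^ (\<Sum>s=1..2 * m. perm_inv n (\<tau> s))"
    have index: "(\<lambda>s\<in>{1..2 * m}. \<tau> s i) \<in> hyper_indices (2 * m) n"
      if "\<tau> \<in> ?P" "i \<in> set [1..<Suc n]" for \<tau> i
      using that permutes_in_image[of _ "{1..n}" i]
      by (auto simp: hyper_indices_def restrict_PiE_iff PiE_iff[of \<tau>] simp del: atLeastAtMost_iff upt_Suc)
         auto
    have word: "set (?w \<tau>) \<subseteq> carrier ?H" if "\<tau> \<in> ?P" for \<tau>
      unfolding set_map using index[OF that] by (intro image_subsetI gen)
    have fin: "finite ?P"
      by (intro finite_PiE finite_permutations) auto
    have summand: "?c \<tau> \<odot>\<^bsub>?H\<^esub> list_prod ?H (?w \<tau>) \<in> carrier ?H" if "\<tau> \<in> ?P" for \<tau>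
      using word[OF that] by (intro H'.smult_closed H'.list_prod_closed)
    have "\<phi> (\<Oplus>\<^bsub>?H\<^esub>\<tau>\<in>?P. ?c \<tau> \<odot>\<^bsub>?H\<^esub> list_prod ?H (?w \<tau>))
        = (\<Oplus>\<^bsub>?T\<^esub>\<tau>\<in>?P. \<phi> (?c \<tau> \<odot>\<^bsub>?H\<^esub> list_prod ?H (?w \<tau>)))"
      using fin summand by (intro alg_hom_finsum[OF H A.T.assoc_algebra_axioms \<phi>]) auto
    also have "\<dots> = (\<Oplus>\<^bsub>?T\<^esub>\<tau>\<in>?P. ?c \<tau> \<odot>\<^bsub>?T\<^esub>
        list_prod ?T (map (\<lambda>i. A.hyper_image (\<lambda>s\<in>{1..2 * m}. \<tau> s i)) [1..<Suc n]))"
    proof (intro A.T.finsum_cong'[OF refl] Pi_I)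
      fix \<tau> assume \<tau>: "\<tau> \<in> ?P"
      show "?c \<tau> \<odot>\<^bsub>?T\<^esub> list_prod ?T (map (\<lambda>i. A.hyper_image (\<lambda>s\<in>{1..2 * m}. \<tau> s i)) [1..<Suc n])
          \<in> carrier ?T"
        unfolding set_map
        using A.hyper_image_closed[OF index[OF \<tau>]]
        by (intro A.T.smult_closed A.T.list_prod_closed) (auto simp del: upt_Suc)
      have "\<phi> (list_prod ?H (?w \<tau>)) = list_prod ?T (map \<phi> (?w \<tau>))"
        using H \<phi> word[OF \<tau>] by (rule alg_hom_list_prod)
      also have "map \<phi> (?w \<tau>) = map (\<lambda>i. A.hyper_image (\<lambda>s\<in>{1..2 * m}. \<tau> s i)) [1..<Suc n]"
        using \<phi>_gen[OF index[OF \<tau>]] by (simp del: upt_Suc)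
      finally have "\<phi> (list_prod ?H (?w \<tau>))
          = list_prod ?T (map (\<lambda>i. A.hyper_image (\<lambda>s\<in>{1..2 * m}. \<tau> s i)) [1..<Suc n])" .
      then show "\<phi> (?c \<tau> \<odot>\<^bsub>?H\<^esub> list_prod ?H (?w \<tau>)) = ?c \<tau> \<odot>\<^bsub>?T\<^esub>
          list_prod ?T (map (\<lambda>i. A.hyper_image (\<lambda>s\<in>{1..2 * m}. \<tau> s i)) [1..<Suc n])"
        unfolding alg_hom_smult[OF \<phi> H'.list_prod_closed[OF word[OF \<tau>]]] by (rule arg_cong)
    qed
    also have "\<dots> = qfact (?q ^ 2) n ^ m \<odot>\<^bsub>?T\<^esub> pure_tensor ?A m (\<lambda>_. A.row_det id)"
      by (rule A.tensor_double_sum_det)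
    finally have sum: "\<phi> (\<Oplus>\<^bsub>?H\<^esub>\<tau>\<in>?P. ?c \<tau> \<odot>\<^bsub>?H\<^esub> list_prod ?H (?w \<tau>))
        = qfact (?q ^ 2) n ^ m \<odot>\<^bsub>?T\<^esub> pure_tensor ?A m (\<lambda>_. mat_qdet ?q n)"
      unfolding mat_qdet_eq_row_det[OF q] .
    have closed: "pure_tensor ?A m (\<lambda>_. mat_qdet ?q n) \<in> carrier ?T"
      unfolding mat_qdet_eq_row_det[OF q] by (intro A.tensor_closed Pi_I A.row_det_closed) auto
    (* m >= 1 matters: the denominator cancels the contribution of one factor *)
    have power: "1 / qfact (?q ^ 2) n * qfact (?q ^ 2) n ^ m = qfact (?q ^ 2) n ^ (m - 1)"
      using m_pos generic by (cases m) simp_all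
    have sum_closed: "(\<Oplus>\<^bsub>?H\<^esub>\<tau>\<in>?P. ?c \<tau> \<odot>\<^bsub>?H\<^esub> list_prod ?H (?w \<tau>)) \<in> carrier ?H"
      using summand by (intro H'.finsum_closed Pi_I)
    show ?thesis
      unfolding hyper_det_def alg_hom_smult[OF \<phi> sum_closed] sum A.T.smult_smult[OF closed] power ..
  qed
  show ?thesis
  proof (intro bexI[OF _ \<phi>] conjI ballI allI impI)
    show "\<phi> (hyper_gen ?q (2 * m) n i)
        = pure_tensor ?A m (\<lambda>s. mat_gen ?q n (i (2 * s - 1)) (i (2 * s)))"
      if "i \<in> hyper_indices (2 * m) n" for i
      using \<phi>_gen[OF that] unfolding A.hyper_image_def .
    show "\<phi> \<circ> hyper_act \<sigma> \<in> alg_hom ?H ?T" if "\<sigma> permutes {1..2 * m}" for \<sigma>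
      using hyper_act_alg_hom[OF that] \<phi> by (rule alg_hom_comp)
  qed (use unique det in blast)+
qed

end
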